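(* Let $n\ge2$ be an integer, $p\ge2$, and let $f\in C^1(\mathbb{R})$ satisfy $uf(u)>0$ for all $u\ne0$. Suppose there exist constants $\alpha_0$ and $\beta_0$ such that one of the following holds: (1) $p<n$ and $p-1<\alpha_0\le\beta_0<h(\alpha_0)$, where $$h(t)=\frac{n(p-1)}{n-p}+\frac{p}{n-p}\cdot\frac{2t-(p-1)+2\sqrt{t[t-(p-1)]}}{p-1};$$ (2) $p\ge n$ and $p-1<\alpha_0\le\beta_0<\infty$. Assume further that $u^2f'(u)\ge\alpha_0\,uf(u)$ for all $u\in\mathbb{R}$, and that there exist $c>0$ and $M>0$ such that $uf(u)\ge c|u|^{\beta_0+1}$ for all $|u|<M$. Then every stable solution $u$ of $-\Delta_p^H u=f(u)$ in $\mathbb{R}^n$ is trivial, that is, $u\equiv0$.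
   Context: $H\in C^2(\mathbb{R}^n\setminus\{0\})\cap C(\mathbb{R}^n)$ is a fixed positively homogeneous function of degree one ($H(t\xi)=tH(\xi)$ for $t>0$, $H(0)=0$), positive on $\mathbb{S}^{n-1}$ (not assumed even), and uniformly convex, i.e. the unit ball $\{\xi: H(\xi)<1\}$ is uniformly convex (its boundary has principal curvatures bounded below by a positive constant). Set $a(\xi)=\frac1p\nabla_\xi H^p(\xi)$ (with $a(0)=0$) and $\Delta_p^H u=\operatorname{div}(a(\nabla u))$. A solution of $-\Delta_p^H u=f(u)$ in $\mathbb{R}^n$ is a (possibly sign-changing) function $u\in W^{1,p}_{\mathrm{loc}}(\mathbb{R}^n)\cap L^\infty_{\mathrm{loc}}(\mathbb{R}^n)$ such that $\int_{\mathbb{R}^n}a(\nabla u)\cdot\nabla\varphi=\int_{\mathbb{R}^n}f(u)\varphi$ for all $\varphi\in C_c^\infty(\mathbb{R}^n)$. The linearized operator $\mathcal{L}_u$ at $u$ is given by $$\langle\mathcal{L}_u\varphi,\psi\rangle_{L^2}=\int_{\mathbb{R}^n}\frac1p\nabla^2_{\xi_i\xi_j}H^p(\nabla u)\,\partial_i\varphi\,\partial_j\psi-\int_{\mathbb{R}^n}f'(u)\varphi\psi,\qquad\varphi,\psi\in C_c^1(\mathbb{R}^n)$$ (summation over repeated indices; for $p>2$ the matrix $\nabla_\xi^2H^p(\xi)$ is extended by $0$ to $\xi=0$; for $p=2$ it is given any fixed symmetric matrix value at $\xi=0$, the natural one if $H^2$ is $C^2$ at $0$). The solution $u$ is stable if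 $\langle\mathcal{L}_u\varphi,\varphi\rangle_{L^2}\ge0$ for all $\varphi\in C_c^1(\mathbb{R}^n)$. *)

theory Defs
  imports "HOL-Analysis.Analysis"
begin

section \<open>Classical derivatives\<close>

definition pd :: "'n::finite \<Rightarrow> (real ^ 'n \<Rightarrow> real) \<Rightarrow> real ^ 'n \<Rightarrow> real" where
  "pd i F x = frechet_derivative F (at x) (axis i 1)"

definition grad :: "(real ^ 'n::finite \<Rightarrow> real) \<Rightarrow> real ^ 'n \<Rightarrow> real ^ 'n" where
  "grad F x = (\<chi> i. pd i F x)"

definition hessian :: "(real ^ 'n::finite \<Rightarrow> real) \<Rightarrow> real ^ 'n \<Rightarrow> real ^ 'n ^ 'n" where
  "hessian F x = (\<chi> i j. pd i (pd j F) x)"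

text \<open>\<open>Ck_on k S F\<close> says that \<open>F\<close> is of class \<open>C\<^sup>k\<close> on the set \<open>S\<close>, which is meant to be open
  (the derivatives are taken in the whole space).\<close>

fun Ck_on :: "nat \<Rightarrow> 'a::real_normed_vector set \<Rightarrow> ('a \<Rightarrow> 'b::real_normed_vector) \<Rightarrow> bool" where
  "Ck_on 0 S F \<longleftrightarrow> continuous_on S F"
| "Ck_on (Suc k) S F \<longleftrightarrow> (\<forall>x\<in>S. F differentiable (at x)) \<and>
     (\<forall>v. Ck_on k S (\<lambda>x. frechet_derivative F (at x) v))"

definition compact_support :: "('a::topological_space \<Rightarrow> 'b::zero) \<Rightarrow> bool" where
  "compact_support \<phi> \<longleftrightarrow> compact (closure {x. \<phi> x \<noteq> 0})"

definition Cc1 :: "(real ^ 'n::finite \<Rightarrow> real) set" where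
  "Cc1 = {\<phi>. Ck_on 1 UNIV \<phi> \<and> compact_support \<phi>}"

definition Cc_infinity :: "(real ^ 'n::finite \<Rightarrow> real) set" where
  "Cc_infinity = {\<phi>. (\<forall>k. Ck_on k UNIV \<phi>) \<and> compact_support \<phi>}"

section \<open>Local Lebesgue and Sobolev spaces\<close>

text \<open>Functions stand for their almost-everywhere classes.\<close>

definition Lp_loc :: "real \<Rightarrow> (real ^ 'n::finite \<Rightarrow> 'b::euclidean_space) set" where
  "Lp_loc p = {g \<in> borel_measurable lebesgue.
     \<forall>K. compact K \<longrightarrow> set_integrable lebesgue K (\<lambda>x. norm (g x) powr p)}"

definition Linf_loc :: "(real ^ 'n::finite \<Rightarrow> real) set" where
  "Linf_loc = {g \<in> borel_measurable lebesgue.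
     \<forall>K. compact K \<longrightarrow> (\<exists>B. AE x in lebesgue. x \<in> K \<longrightarrow> \<bar>g x\<bar> \<le> B)}"

definition is_weak_grad :: "(real ^ 'n::finite \<Rightarrow> real) \<Rightarrow> (real ^ 'n \<Rightarrow> real ^ 'n) \<Rightarrow> bool" where
  "is_weak_grad u G \<longleftrightarrow> u \<in> Lp_loc 1 \<and> G \<in> Lp_loc 1 \<and>
     (\<forall>\<phi>\<in>Cc_infinity. \<forall>i.
        (\<integral>x. u x * pd i \<phi> x \<partial>lebesgue) = - (\<integral>x. G x $ i * \<phi> x \<partial>lebesgue))"

definition W1p_loc :: "real \<Rightarrow> (real ^ 'n::finite \<Rightarrow> real) set" where
  "W1p_loc p = {u \<in> Lp_loc p. \<exists>G\<in>Lp_loc p. is_weak_grad u G}"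

text \<open>A representative of the weak gradient, which is unique up to null sets.\<close>

definition weak_grad :: "(real ^ 'n::finite \<Rightarrow> real) \<Rightarrow> real ^ 'n \<Rightarrow> real ^ 'n" where
  "weak_grad u = (SOME G. is_weak_grad u G)"

section \<open>Uniform convexity\<close>

text \<open>\<open>outer_normal H\<close> restricted to a regular level set \<open>{H = c}\<close> is the unit normal pointing out of
  \<open>{H < c}\<close>. With respect to it, the principal curvatures of the level set are the eigenvalues of
  the shape operator, the derivative of the normal field in tangential directions (they are \<open>1/r\<close>
  for a sphere of radius \<open>r\<close>).\<close>

definition outer_normal :: "(real ^ 'n::finite \<Rightarrow> real) \<Rightarrow> real ^ 'n \<Rightarrow> real ^ 'n" where
  "outer_normal H \<xi> = grad H \<xi> /\<^sub>R norm (grad H \<xi>)"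

definition principal_curvature :: "(real ^ 'n::finite \<Rightarrow> real) \<Rightarrow> real ^ 'n \<Rightarrow> real \<Rightarrow> bool" where
  "principal_curvature H \<xi> \<kappa> \<longleftrightarrow> (\<exists>v. v \<noteq> 0 \<and> v \<bullet> outer_normal H \<xi> = 0 \<and>
     frechet_derivative (outer_normal H) (at \<xi>) v = \<kappa> *\<^sub>R v)"

definition uniformly_convex :: "(real ^ 'n::finite \<Rightarrow> real) \<Rightarrow> bool" where
  "uniformly_convex H \<longleftrightarrow> (\<exists>c>0. \<forall>\<xi>\<in>frontier {\<xi>. H \<xi> < 1}.
     \<forall>\<kappa>. principal_curvature H \<xi> \<kappa> \<longrightarrow> c \<le> \<kappa>)"

section \<open>The anisotropic p-Laplacian\<close>

definition a_field :: "real \<Rightarrow> (real ^ 'n::finite \<Rightarrow> real) \<Rightarrow> real ^ 'n \<Rightarrow> real ^ 'n" where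
  "a_field p H \<xi> = (if \<xi> = 0 then 0 else (1 / p) *\<^sub>R grad (\<lambda>\<zeta>. H \<zeta> powr p) \<xi>)"

definition weak_solution ::
    "real \<Rightarrow> (real ^ 'n::finite \<Rightarrow> real) \<Rightarrow> (real \<Rightarrow> real) \<Rightarrow> (real ^ 'n \<Rightarrow> real) \<Rightarrow> bool" where
  "weak_solution p H f u \<longleftrightarrow> u \<in> W1p_loc p \<and> u \<in> Linf_loc \<and>
     (\<forall>\<phi>\<in>Cc_infinity.
        (\<integral>x. a_field p H (weak_grad u x) \<bullet> grad \<phi> x \<partial>lebesgue) = (\<integral>x. f (u x) * \<phi> x \<partial>lebesgue))"

text \<open>The possible values \<open>Z\<close> at \<open>\<xi> = 0\<close> of the matrix \<open>\<nabla>\<^sup>2H\<^sup>p(\<xi>)\<close> (without the factor \<open>1/p\<close>).\<close>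

definition admissible_value_at_0 ::
    "real \<Rightarrow> (real ^ 'n::finite \<Rightarrow> real) \<Rightarrow> real ^ 'n ^ 'n \<Rightarrow> bool" where
  "admissible_value_at_0 p H Z \<longleftrightarrow> transpose Z = Z \<and> (p > 2 \<longrightarrow> Z = 0) \<and>
     (p = 2 \<and> Ck_on 2 UNIV (\<lambda>\<zeta>. H \<zeta> powr p) \<longrightarrow> Z = hessian (\<lambda>\<zeta>. H \<zeta> powr p) 0)"

definition hessian_Hp ::
    "real \<Rightarrow> (real ^ 'n::finite \<Rightarrow> real) \<Rightarrow> real ^ 'n ^ 'n \<Rightarrow> real ^ 'n \<Rightarrow> real ^ 'n ^ 'n" where
  "hessian_Hp p H Z \<xi> = (if \<xi> = 0 then Z else hessian (\<lambda>\<zeta>. H \<zeta> powr p) \<xi>)"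

definition linearized_form ::
    "real \<Rightarrow> (real ^ 'n::finite \<Rightarrow> real) \<Rightarrow> real ^ 'n ^ 'n \<Rightarrow> (real \<Rightarrow> real) \<Rightarrow> (real ^ 'n \<Rightarrow> real)
      \<Rightarrow> (real ^ 'n \<Rightarrow> real) \<Rightarrow> (real ^ 'n \<Rightarrow> real) \<Rightarrow> real" where
  "linearized_form p H Z f u \<phi> \<psi> =
     (\<integral>x. (\<Sum>i\<in>UNIV. \<Sum>j\<in>UNIV.
        (1 / p) * hessian_Hp p H Z (weak_grad u x) $ i $ j * pd i \<phi> x * pd j \<psi> x) \<partial>lebesgue)
     - (\<integral>x. deriv f (u x) * \<phi> x * \<psi> x \<partial>lebesgue)"

definition stable ::
    "real \<Rightarrow> (real ^ 'n::finite \<Rightarrow> real) \<Rightarrow> real ^ 'n ^ 'n \<Rightarrow> (real \<Rightarrow> real) \<Rightarrow> (real ^ 'n \<Rightarrow> real)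
      \<Rightarrow> bool" where
  "stable p H Z f u \<longleftrightarrow> (\<forall>\<phi>\<in>Cc1. 0 \<le> linearized_form p H Z f u \<phi> \<phi>)"

definition h_exponent :: "nat \<Rightarrow> real \<Rightarrow> real \<Rightarrow> real" where
  "h_exponent n p t = real n * (p - 1) / (real n - p) +
     p / (real n - p) * ((2 * t - (p - 1) + 2 * sqrt (t * (t - (p - 1)))) / (p - 1))"

end

theory Submission
  imports Defs
begin

text \<open>
  Write \<open>E = H\<^sup>p\<close> and let \<open>a\<close> be the flux, so that \<open>a(\<xi>) \<bullet> \<xi> = E(\<xi>)\<close>, while \<open>E''(\<xi>)/p\<close> maps \<open>\<xi>\<close> to
  \<open>(p - 1) a(\<xi>)\<close>. Test the equation with \<open>|u|\<^bsup>\<gamma>-1\<^esup> u \<theta>\<^sup>2\<close> and the stability inequality with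
  \<open>|u|\<^bsup>(\<gamma>-1)/2\<^esup> u \<theta>\<close>. If \<open>(p - 1)(\<gamma> + 1)\<^sup>2 < 4 \<alpha>\<^sub>0 \<gamma>\<close>, then together they bound
  \<open>\<integral> f(u) u |u|\<^bsup>\<gamma>-1\<^esup> \<theta>\<^sup>2\<close> and \<open>\<integral> |u|\<^bsup>\<gamma>-1\<^esup> E(\<nabla>u) \<theta>\<^sup>2\<close> by terms containing \<open>\<nabla>\<theta>\<close>. For \<open>\<theta>\<close> a high
  power of a cutoff at scale \<open>R\<close>, Young's inequality absorbs those terms up to
  \<open>O(R\<^bsup>n-\<kappa>\<^esup>)\<close> with \<open>\<kappa> = p (\<gamma> + \<beta>\<^sub>0) / (\<beta>\<^sub>0 - p + 1)\<close>; the hypothesis on the exponents says that some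
  admissible \<open>\<gamma> > 1\<close> has \<open>\<kappa> > n\<close>. The test functions are powers of mollifications of \<open>u\<close>, which
  converge strongly enough in \<open>W\<^bsup>1,p\<^esup>\<close> locally, so no regularity theory is used.
\<close>

section \<open>Gradients, \<open>C\<^sup>k\<close> functions and smooth bumps\<close>

text \<open>Two conditions on \<open>\<gamma>\<close> explain \<open>h_exponent\<close>. The
  inequality \<open>(p - 1) * (\<gamma> + 1)\<^sup>2 < 4 * \<alpha>\<^sub>0 * \<gamma>\<close> is
  quadratic; its roots have product 1, and the larger one is the last fraction in
  \<open>h_exponent\<close>. The condition \<kappa> > n is linear, with threshold ((n - p)
  \<open>\<beta>\<^sub>0\<close> - n (p - 1)) / p. For p < n the bound on
  \<open>\<beta>\<^sub>0\<close> says exactly that the threshold lies below the larger root; for p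
  \<ge> n the threshold is not positive. Three obstacles shape the rest. The lower bound on
  \<open>f\<close> has the power \<open>\<beta>\<^sub>0\<close> near 0, but for large values only
  the power \<open>\<alpha>\<^sub>0\<close> can be derived, so Young's inequality is run with both,
  and the slower decay in R, which belongs to \<open>\<beta>\<^sub>0\<close>, decides. The weak
  gradient may vanish on a set of positive measure, where the second derivatives of E have only an
  assigned value. The weak equation admits smooth test functions, but signed powers are just C^1, so
  besides the solution the test functions are mollified too.\<close>

definition C1_gradient :: "('a::real_inner \<Rightarrow> real) \<Rightarrow> ('a \<Rightarrow> 'a) \<Rightarrow> bool" where
  "C1_gradient \<phi> D \<longleftrightarrow> (\<forall>x. GDERIV \<phi> x :> D x) \<and> continuous_on UNIV D"

lemma GDERIV_frechet_derivative:
  assumes "GDERIV \<phi> x :> d"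
  shows "frechet_derivative \<phi> (at x) v = v \<bullet> d"
proof -
  have "(\<lambda>h. h \<bullet> d) = frechet_derivative \<phi> (at x)"
    using assms unfolding gderiv_def by (rule frechet_derivative_at)
  from fun_cong[OF this, of v] show ?thesis by simp
qed

lemma GDERIV_differentiable: "GDERIV \<phi> x :> d \<Longrightarrow> \<phi> differentiable (at x)"
  by (auto simp: gderiv_def differentiable_def)

lemma GDERIV_pd: "GDERIV \<phi> x :> d \<Longrightarrow> pd i \<phi> x = d $ i"
  by (simp add: pd_def GDERIV_frechet_derivative inner_axis')

lemma GDERIV_grad: "GDERIV \<phi> x :> d \<Longrightarrow> grad \<phi> x = d"
  by (simp add: grad_def GDERIV_pd vec_eq_iff)

lemma differentiable_GDERIV_grad:
  fixes \<phi> :: "real ^ 'n::finite \<Rightarrow> real"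
  assumes "\<phi> differentiable (at x)"
  shows "GDERIV \<phi> x :> grad \<phi> x"
proof -
  let ?D = "frechet_derivative \<phi> (at x)"
  have D: "(\<phi> has_derivative ?D) (at x)"
    using assms frechet_derivative_works by blast
  then have lin: "linear ?D" by (rule has_derivative_linear)
  have "?D h = h \<bullet> grad \<phi> x" for h
  proof -
    have "?D h = ?D (\<Sum>i\<in>UNIV. h $ i *\<^sub>R axis i 1)"
      using basis_expansion[of h] by (simp add: scalar_mult_eq_scaleR)
    also have "\<dots> = (\<Sum>i\<in>UNIV. h $ i * ?D (axis i 1))"
      by (simp add: linear_sum[OF lin] linear_scale[OF lin])
    finally show ?thesis by (simp add: inner_vec_def grad_def pd_def)
  qed
  then have "?D = (\<lambda>h. h \<bullet> grad \<phi> x)" by auto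
  with D show ?thesis by (simp add: gderiv_def)
qed

lemma C1_gradient_grad: "C1_gradient \<phi> D \<Longrightarrow> grad \<phi> x = D x"
  by (simp add: C1_gradient_def GDERIV_grad)

lemma C1_gradient_pd: "C1_gradient \<phi> D \<Longrightarrow> pd i \<phi> x = D x $ i"
  by (simp add: C1_gradient_def GDERIV_pd)

lemma C1_gradient_continuous:
  assumes "C1_gradient \<phi> D"
  shows "continuous_on UNIV \<phi>" "continuous_on UNIV D"
proof -
  have "isCont \<phi> x" for x
    using assms differentiable_imp_continuous_within[of \<phi> x UNIV]
    by (auto simp: C1_gradient_def dest!: GDERIV_differentiable)
  then show "continuous_on UNIV \<phi>" by (simp add: continuous_at_imp_continuous_on)
qed (use assms in \<open>simp add: C1_gradient_def\<close>)

lemma C1_gradient_imp_Ck_on_1: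
  assumes "C1_gradient \<phi> D"
  shows "Ck_on 1 UNIV \<phi>"
proof -
  have "continuous_on UNIV (\<lambda>x. v \<bullet> D x)" for v
    using C1_gradient_continuous[OF assms] by (intro continuous_intros)
  moreover have "(\<lambda>x. frechet_derivative \<phi> (at x) v) = (\<lambda>x. v \<bullet> D x)" for v
    using assms by (auto simp: C1_gradient_def GDERIV_frechet_derivative)
  moreover have "\<phi> differentiable (at x)" for x
    using assms GDERIV_differentiable[of \<phi> x "D x"] unfolding C1_gradient_def by blast
  ultimately show ?thesis by simp
qed

lemma Ck_on_1_imp_C1_gradient:
  fixes \<phi> :: "real ^ 'n::finite \<Rightarrow> real"
  assumes "Ck_on 1 UNIV \<phi>"
  shows "C1_gradient \<phi> (grad \<phi>)"
proof -
  have "continuous_on UNIV (pd i \<phi>)" for i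
    using assms by (simp add: pd_def[abs_def])
  then have "continuous_on UNIV (grad \<phi>)"
    by (simp add: grad_def[abs_def] continuous_on_vec_lambda)
  then show ?thesis
    using assms by (auto simp: C1_gradient_def intro!: differentiable_GDERIV_grad)
qed

section \<open>Compact supports\<close>

lemma compact_support_cball:
  fixes \<phi> :: "'a::euclidean_space \<Rightarrow> 'b::zero"
  assumes "\<And>x. norm x > r \<Longrightarrow> \<phi> x = 0"
  shows "compact_support \<phi>"
proof -
  have "{x. \<phi> x \<noteq> 0} \<subseteq> cball 0 r" using assms by (force simp: not_less)
  then have "closure {x. \<phi> x \<noteq> 0} \<subseteq> cball 0 r" by (simp add: closure_minimal)
  then show ?thesis unfolding compact_support_def
    using compact_cball compact_closure bounded_cball bounded_subset closure_subset by metis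
qed

lemma compact_supportE:
  fixes \<phi> :: "'a::euclidean_space \<Rightarrow> 'b::zero"
  assumes "compact_support \<phi>"
  obtains r where "r > 0" "\<And>x. norm x \<ge> r \<Longrightarrow> \<phi> x = 0"
proof -
  have "bounded (closure {x. \<phi> x \<noteq> 0})"
    using assms by (simp add: compact_support_def compact_imp_bounded)
  then obtain r where "r > 0" "\<And>x. x \<in> closure {x. \<phi> x \<noteq> 0} \<Longrightarrow> norm x < r"
    by (metis bounded_normE_less)
  with closure_subset that show thesis by (metis (mono_tags, lifting) mem_Collect_eq not_less subsetD)
qed

lemma Cc_infinity_C1_gradient: "\<phi> \<in> Cc_infinity \<Longrightarrow> C1_gradient \<phi> (grad \<phi>)"
  by (rule Ck_on_1_imp_C1_gradient) (simp add: Cc_infinity_def del: Ck_on.simps)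

lemma C1_gradient_outside_support:
  assumes "C1_gradient \<phi> D" "\<And>x. norm x \<ge> r \<Longrightarrow> \<phi> x = 0" "norm x \<ge> r"
  shows "D x = 0"
proof -
  have *: "D x = 0" if "norm x > r" for x
  proof -
    have "eventually (\<lambda>y. y \<in> {y. norm y > r}) (nhds x)"
      using that by (intro eventually_nhds_in_open open_Collect_less continuous_intros) auto
    then have ev: "eventually (\<lambda>y. 0 = \<phi> y) (nhds x)"
      by eventually_elim (use assms(2) in force)
    have "((\<lambda>y. 0) has_derivative (\<lambda>h. h \<bullet> D x)) (at x)"
    proof (rule has_derivative_transform_eventually)
      show "(\<phi> has_derivative (\<lambda>h. h \<bullet> D x)) (at x)"
        using assms(1) by (auto simp: C1_gradient_def gderiv_def)
      show "eventually (\<lambda>y. \<phi> y = 0) (at x within UNIV)"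
        using ev by (auto simp: eventually_at_filter elim: eventually_mono)
      show "\<phi> x = 0" using that assms(2) by simp
    qed simp
    then have "(\<lambda>h. h \<bullet> D x) = (\<lambda>h. 0)"
      using has_derivative_unique has_derivative_const by blast
    then have "D x \<bullet> D x = 0" by metis
    then show ?thesis by simp
  qed
  show ?thesis
  proof (cases "norm x > r")
    case False
    then have eq: "norm x = r" using assms(3) by simp
    show ?thesis
    proof (cases "x = 0")
      case False
      \<comment> \<open>A point of the boundary sphere is approached from outside along its own ray,
        and continuity of \<open>D\<close> carries the value 0 to it.\<close>
      have "(\<lambda>k. D ((1 + inverse (real (Suc k))) *\<^sub>R x)) \<longlonglongrightarrow> D ((1 + 0) *\<^sub>R x)"
        using C1_gradient_continuous(2)[OF assms(1)]
        by (intro continuous_on_tendsto_compose[where f=D and s=UNIV] tendsto_intros LIMSEQ_inverse_real_of_nat) auto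
      moreover have "D ((1 + inverse (real (Suc k))) *\<^sub>R x) = 0" for k
        using False by (intro *) (simp add: eq[symmetric] abs_of_pos distrib_right)
      ultimately show ?thesis by (simp add: LIMSEQ_const_iff)
    next
      case True
      \<comment> \<open>Here \<open>r = 0\<close>. The origin spans no ray, but the support is
        empty.\<close>
      with eq have "\<phi> = (\<lambda>x. 0)" using assms(2) by auto
      then have "GDERIV \<phi> x :> 0" by (simp add: GDERIV_const)
      with assms(1) show ?thesis
        unfolding C1_gradient_def
        by (metis (mono_tags, lifting) GDERIV_frechet_derivative inner_eq_zero_iff inner_zero_right)
    qed
  qed (rule *)
qed

section \<open>Smooth bumps and mollifiers\<close>

text \<open>Directional derivatives never leave the class, so induction on \<open>k\<close> reaches
  every order without computing a higher derivative. The class is chosen separately for bumps,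
  convolutions and reflected kernels.\<close>

lemma Ck_on_closed_class:
  assumes "F \<in> \<F>" "\<And>F x. F \<in> \<F> \<Longrightarrow> F differentiable (at x)"
    "\<And>F v. F \<in> \<F> \<Longrightarrow> (\<lambda>x. frechet_derivative F (at x) v) \<in> \<F>"
  shows "Ck_on k UNIV F"
  using assms(1)
proof (induction k arbitrary: F)
  case 0
  then show ?case
    using assms(2) by (auto intro!: continuous_at_imp_continuous_on differentiable_imp_continuous_within)
qed (use assms in auto)

text \<open>The classical flat function is \<open>flat_exp 0\<close>. The powers of
  \<open>1 / t\<close> are included because differentiation produces them: the derivative of a
  member is a combination of the members with index \<open>m + 1\<close> and
  \<open>m + 2\<close>.\<close>

definition flat_exp :: "nat \<Rightarrow> real \<Rightarrow> real" where
  "flat_exp m t = (if t \<le> 0 then 0 else (1 / t) ^ m * exp (- (1 / t)))"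

lemma flat_exp_tendsto_0: "(flat_exp m \<longlongrightarrow> 0) (at 0)"
proof -
  have "((\<lambda>t::real. (1 / t) ^ m / exp (1 / t)) \<longlongrightarrow> 0) (at_right 0)"
    by (rule filterlim_compose[OF tendsto_power_div_exp_0])
       (simp add: divide_inverse filterlim_inverse_at_top_right)
  then have "(flat_exp m \<longlongrightarrow> 0) (at_right 0)"
    by (rule Lim_transform_eventually)
       (auto simp: eventually_at_filter flat_exp_def exp_minus divide_inverse)
  moreover have "(flat_exp m \<longlongrightarrow> 0) (at_left 0)"
    by (rule Lim_transform_eventually[OF tendsto_const])
       (auto simp: eventually_at_filter flat_exp_def)
  ultimately show ?thesis by (rule filterlim_split_at[rotated])
qed

lemma DERIV_flat_exp:
  "DERIV (flat_exp m) t :> flat_exp (m + 2) t - real m * flat_exp (m + 1) t"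
proof (cases t "0::real" rule: linorder_cases)
  case less
  have "DERIV (\<lambda>t. 0) t :> 0" for t :: real by simp
  then have "DERIV (flat_exp m) t :> 0"
    by (rule has_field_derivative_transform_within_open[where S="{..<0}"])
       (use less in \<open>auto simp: flat_exp_def\<close>)
  then show ?thesis using less by (simp add: flat_exp_def)
next
  case equal
  \<comment> \<open>Dividing by \<open>h\<close> only raises the index by one, so flatness of
    \<open>flat_exp (m + 1)\<close> gives the derivative at 0.\<close>
  have "((\<lambda>h. flat_exp m h / h) \<longlongrightarrow> 0) (at 0)"
    by (rule Lim_transform_eventually[OF flat_exp_tendsto_0[of "m + 1"]])
       (auto simp: eventually_at_filter flat_exp_def)
  then have "DERIV (flat_exp m) 0 :> 0"
    by (simp add: DERIV_def flat_exp_def)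
  then show ?thesis using equal by (simp add: flat_exp_def)
next
  case greater
  have "DERIV (\<lambda>t. (1 / t) ^ m * exp (- (1 / t))) t :>
     flat_exp (m + 2) t - real m * flat_exp (m + 1) t"
    using greater
    by (auto intro!: derivative_eq_intros simp: flat_exp_def power2_eq_square power_divide)
       (cases m; simp add: field_simps)
  then show ?thesis
    by (rule has_field_derivative_transform_within_open[where S="{0<..}"])
       (use greater in \<open>auto simp: flat_exp_def\<close>)
qed

text \<open>The generators are dictated by differentiation: the derivative of
  \<open>flat_exp m (\<epsilon> - x \<bullet> x)\<close> in a direction \<open>v\<close> brings in
  the linear function \<open>x \<bullet> v\<close> and two higher indices, and the product rule then
  asks for sums and products.\<close>

inductive_set bump_class :: "real \<Rightarrow> (real ^ 'n::finite \<Rightarrow> real) set" for \<epsilon> where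
  "(\<lambda>x. c) \<in> bump_class \<epsilon>"
| "(\<lambda>x. x \<bullet> a) \<in> bump_class \<epsilon>"
| "(\<lambda>x. flat_exp m (\<epsilon> - x \<bullet> x)) \<in> bump_class \<epsilon>"
| "F \<in> bump_class \<epsilon> \<Longrightarrow> F' \<in> bump_class \<epsilon> \<Longrightarrow> (\<lambda>x. F x + F' x) \<in> bump_class \<epsilon>"
| "F \<in> bump_class \<epsilon> \<Longrightarrow> F' \<in> bump_class \<epsilon> \<Longrightarrow> (\<lambda>x. F x * F' x) \<in> bump_class \<epsilon>"

lemma GDERIV_radial:
  assumes "DERIV g (c - x \<bullet> x) :> d"
  shows "GDERIV (\<lambda>x. g (c - x \<bullet> x)) x :> (- 2 * d) *\<^sub>R x"
proof -
  have "GDERIV (\<lambda>x. c - x \<bullet> x) x :> (- 2) *\<^sub>R x"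
    unfolding gderiv_def
    by (auto intro!: derivative_eq_intros simp: inner_commute)
  from GDERIV_DERIV_compose[OF this assms] show ?thesis by (simp add: mult.commute)
qed

lemma bump_class_derivative:
  fixes F :: "real ^ 'n::finite \<Rightarrow> real"
  assumes "F \<in> bump_class \<epsilon>"
  shows "\<exists>D. (\<forall>x. GDERIV F x :> D x) \<and> (\<forall>v. (\<lambda>x. v \<bullet> D x) \<in> bump_class \<epsilon>)"
  using assms
proof induction
  case (1 c)
  show ?case
    by (rule exI[of _ "\<lambda>x. 0"]) (auto simp: GDERIV_const intro: bump_class.intros)
next
  case (2 a)
  show ?case
    by (rule exI[of _ "\<lambda>x. a"])
       (auto simp: gderiv_def intro!: bump_class.intros derivative_eq_intros)
next
  case (3 m)
  define D where "D x = (- 2 * (flat_exp (m + 2) (\<epsilon> - x \<bullet> x) - real m * flat_exp (m + 1) (\<epsilon> - x \<bullet> x))) *\<^sub>R x"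
    for x :: "real ^ 'n"
  have "(\<lambda>x. v \<bullet> D x) = (\<lambda>x. ((- 2) * flat_exp (m + 2) (\<epsilon> - x \<bullet> x) + (2 * real m) * flat_exp (m + 1) (\<epsilon> - x \<bullet> x)) * (x \<bullet> v))" for v
    by (auto simp: D_def algebra_simps inner_commute)
  then have "(\<lambda>x. v \<bullet> D x) \<in> bump_class \<epsilon>" for v
    by (simp only:) (intro bump_class.intros)
  moreover have "GDERIV (\<lambda>x. flat_exp m (\<epsilon> - x \<bullet> x)) x :> D x" for x
    unfolding D_def by (rule GDERIV_radial) (rule DERIV_flat_exp)
  ultimately show ?case by (intro exI[of _ D]) blast
next
  case (4 F F')
  then obtain D D' where *: "\<forall>x. GDERIV F x :> D x" "\<forall>x. GDERIV F' x :> D' x"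
    "\<forall>v. (\<lambda>x. v \<bullet> D x) \<in> bump_class \<epsilon>" "\<forall>v. (\<lambda>x. v \<bullet> D' x) \<in> bump_class \<epsilon>" by blast
  then show ?case
    by (intro exI[of _ "\<lambda>x. D x + D' x"])
       (auto simp: inner_add_right intro!: bump_class.intros GDERIV_add)
next
  case (5 F F')
  then obtain D D' where *: "\<forall>x. GDERIV F x :> D x" "\<forall>x. GDERIV F' x :> D' x"
    "\<forall>v. (\<lambda>x. v \<bullet> D x) \<in> bump_class \<epsilon>" "\<forall>v. (\<lambda>x. v \<bullet> D' x) \<in> bump_class \<epsilon>" by blast
  with 5 show ?case
    by (intro exI[of _ "\<lambda>x. F x *\<^sub>R D' x + F' x *\<^sub>R D x"])
       (auto simp: inner_add_right intro!: bump_class.intros GDERIV_mult)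
qed

lemma bump_class_Ck_on:
  assumes "F \<in> bump_class \<epsilon>"
  shows "Ck_on k UNIV F"
  using assms
proof (rule Ck_on_closed_class)
  fix F :: "real ^ 'a \<Rightarrow> real" and x v
  assume "F \<in> bump_class \<epsilon>"
  from bump_class_derivative[OF this] obtain D where D: "\<forall>x. GDERIV F x :> D x" "\<forall>v. (\<lambda>x. v \<bullet> D x) \<in> bump_class \<epsilon>"
    by blast
  show "F differentiable (at x)" using D(1) GDERIV_differentiable by blast
  have "(\<lambda>x. frechet_derivative F (at x) v) = (\<lambda>x. v \<bullet> D x)"
    using D(1) by (auto simp: GDERIV_frechet_derivative)
  then show "(\<lambda>x. frechet_derivative F (at x) v) \<in> bump_class \<epsilon>" using D(2) by simp
qed

text \<open>Only a bound on the support radius is recorded, rather than the rescalings of one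
  profile. Estimates are therefore stated for every kernel supported in a small enough ball.\<close>

definition mollifier :: "real \<Rightarrow> (real ^ 'n::finite \<Rightarrow> real) \<Rightarrow> bool" where
  "mollifier \<epsilon> \<rho> \<longleftrightarrow> \<rho> \<in> Cc_infinity \<and> (\<forall>x. 0 \<le> \<rho> x) \<and> (\<forall>x. norm x \<ge> \<epsilon> \<longrightarrow> \<rho> x = 0) \<and>
     (\<integral>x. \<rho> x \<partial>lborel) = 1"

lemma integrable_lborel_compact_support:
  fixes \<phi> :: "'a::euclidean_space \<Rightarrow> 'b::euclidean_space"
  assumes "continuous_on UNIV \<phi>" "\<And>x. norm x \<ge> r \<Longrightarrow> \<phi> x = 0"
  shows "integrable lborel \<phi>"
proof -
  have "set_integrable lborel (cball 0 r) \<phi>"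
    unfolding set_integrable_def
    by (rule borel_integrable_compact[OF compact_cball continuous_on_subset[OF assms(1)]]) simp
  moreover have "(\<lambda>x. indicator (cball 0 r) x *\<^sub>R \<phi> x) = \<phi>"
    using assms(2) by (auto simp: indicator_def fun_eq_iff)
  ultimately show ?thesis by (simp add: set_integrable_def)
qed

lemma mollifier_exists:
  assumes "\<epsilon> > 0"
  shows "\<exists>\<rho>. mollifier \<epsilon> (\<rho> :: real ^ 'n::finite \<Rightarrow> real)"
proof -
  define b :: "real ^ 'n \<Rightarrow> real" where "b x = flat_exp 0 (\<epsilon>\<^sup>2 - x \<bullet> x)" for x
  have cls: "(\<lambda>x. c * b x) \<in> bump_class (\<epsilon>\<^sup>2)" for c
    unfolding b_def by (intro bump_class.intros)
  have nn: "b x \<ge> 0" for x by (simp add: b_def flat_exp_def)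
  have supp: "b x = 0" if "norm x \<ge> \<epsilon>" for x
    using power_mono[OF that, of 2] assms by (simp add: b_def flat_exp_def power2_norm_eq_inner)
  have cont: "continuous_on UNIV b"
    using bump_class_Ck_on[OF cls[of 1], of 0] by simp
  have int: "integrable lborel b"
    using cont supp by (rule integrable_lborel_compact_support)
  have "(\<integral>x. b x \<partial>lborel) \<noteq> 0"
  proof
    assume "(\<integral>x. b x \<partial>lborel) = 0"
    \<comment> \<open>A continuous function vanishing almost everywhere vanishes on a closed set of
      full measure, hence everywhere; but \<open>b 0 > 0\<close>.\<close>
    then have "AE x in lborel. b x = 0"
      using integral_nonneg_eq_0_iff_AE[OF int] nn by simp
    then have "AE x in lborel. x \<in> {x. b x = 0}" by simp
    moreover have "closed {x. b x = 0}"
      using cont by (intro closed_Collect_eq continuous_intros)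
    ultimately have "0 \<in> {x. b x = 0}"
      by (metis UNIV_I mem_closed_if_AE_lebesgue AE_completion)
    then show False using assms by (simp add: b_def flat_exp_def)
  qed
  moreover have "(\<integral>x. b x \<partial>lborel) \<ge> 0" using nn by simp
  ultimately have pos: "(\<integral>x. b x \<partial>lborel) > 0" by simp
  define \<rho> where "\<rho> x = (1 / (\<integral>x. b x \<partial>lborel)) * b x" for x
  have "\<rho> \<in> bump_class (\<epsilon>\<^sup>2)" unfolding \<rho>_def[abs_def] by (rule cls)
  then have "\<rho> \<in> Cc_infinity"
    unfolding Cc_infinity_def using bump_class_Ck_on supp
    by (auto intro!: compact_support_cball[of \<epsilon>] simp: \<rho>_def)
  then show ?thesis
    using pos nn supp unfolding mollifier_def by (intro exI[of _ \<rho>]) (auto simp: \<rho>_def[abs_def])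
qed

section \<open>Convolution\<close>

lemma lborel_reflect: "lborel = distr lborel borel (\<lambda>y::'a::euclidean_space. x - y)"
proof -
  have "lborel = density (distr lborel borel (\<lambda>y. x + (- 1) *\<^sub>R y)) (\<lambda>_. ennreal (\<bar>- 1\<bar> ^ DIM('a)))"
    by (rule lborel_affine) simp
  then show ?thesis by (simp add: density_1)
qed

lemma nn_integral_lborel_reflect:
  fixes x :: "'a::euclidean_space"
  assumes [measurable]: "f \<in> borel_measurable borel"
  shows "(\<integral>\<^sup>+y. f (x - y) \<partial>lborel) = (\<integral>\<^sup>+y. f y \<partial>lborel)"
  by (subst (2) lborel_reflect[of x]) (simp add: nn_integral_distr)

lemma integral_lborel_reflect:
  fixes x :: "'a::euclidean_space" and f :: "'a \<Rightarrow> real"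
  assumes [measurable]: "f \<in> borel_measurable borel"
  shows "(\<integral>y. f (x - y) \<partial>lborel) = (\<integral>y. f y \<partial>lborel)"
  by (subst (2) lborel_reflect[of x]) (simp add: integral_distr)

lemma nn_integral_lborel_translate:
  fixes x :: "'a::euclidean_space"
  assumes [measurable]: "f \<in> borel_measurable borel"
  shows "(\<integral>\<^sup>+y. f (y - x) \<partial>lborel) = (\<integral>\<^sup>+y. f y \<partial>lborel)"
proof -
  have "(\<integral>\<^sup>+y. f (y - x) \<partial>lborel) = (\<integral>\<^sup>+y. f ((- x) - y) \<partial>lborel)"
    using nn_integral_lborel_reflect[of "\<lambda>y. f (y - x)" 0] by (simp add: minus_diff_commute)
  then show ?thesis by (simp only: nn_integral_lborel_reflect assms)
qed

section \<open>Local integrability and regularity of convolutions\<close>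

lemma Lp_loc_1_integrable:
  assumes "w \<in> Lp_loc 1" "compact K"
  shows "integrable lebesgue (\<lambda>x. indicator K x *\<^sub>R w x)"
proof -
  have [measurable]: "w \<in> borel_measurable lebesgue" "K \<in> sets lebesgue"
    using assms by (auto simp: Lp_loc_def borel_compact)
  have *: "integrable lebesgue (\<lambda>x. indicator K x *\<^sub>R (norm (w x) powr 1))"
    using assms by (simp add: Lp_loc_def set_integrable_def)
  show ?thesis
    by (rule Bochner_Integration.integrable_bound[OF *]) (auto simp: indicator_def)
qed

lemma bounded_compact_support:
  fixes \<Phi> :: "'a::euclidean_space \<Rightarrow> 'b::real_normed_vector"
  assumes "continuous_on UNIV \<Phi>" "\<And>x. norm x \<ge> r \<Longrightarrow> \<Phi> x = 0"
  obtains B where "B > 0" "\<And>x. norm (\<Phi> x) \<le> B"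
proof -
  have "compact (\<Phi> ` cball 0 r)"
    by (intro compact_continuous_image continuous_on_subset[OF assms(1)]) auto
  then obtain B where B: "B > 0" "\<forall>y\<in>\<Phi> ` cball 0 r. norm y \<le> B"
    using compact_imp_bounded bounded_pos by metis
  have "norm (\<Phi> x) \<le> B" for x
  proof (cases "norm x \<le> r")
    case True then show ?thesis using B(2) by simp
  next
    case False then show ?thesis using B(1) assms(2)[of x] by simp
  qed
  with B(1) that show thesis by blast
qed

lemma uniformly_continuous_compact_support:
  fixes \<Phi> :: "'a::euclidean_space \<Rightarrow> 'b::real_normed_vector"
  assumes "continuous_on UNIV \<Phi>" "\<And>x. norm x \<ge> r \<Longrightarrow> \<Phi> x = 0" "e > 0"
  obtains d where "d > 0" "d \<le> 1" "\<And>x y. norm (x - y) < d \<Longrightarrow> norm (\<Phi> x - \<Phi> y) < e"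
proof -
  have "uniformly_continuous_on (cball 0 (r + 1)) \<Phi>"
    by (intro compact_uniformly_continuous continuous_on_subset[OF assms(1)]) auto
  then obtain d where d: "d > 0"
    "\<And>x y. x \<in> cball 0 (r+1) \<Longrightarrow> y \<in> cball 0 (r+1) \<Longrightarrow> dist y x < d \<Longrightarrow> dist (\<Phi> y) (\<Phi> x) < e"
    using assms(3) by (auto simp: uniformly_continuous_on_def)
  have "norm (\<Phi> x - \<Phi> y) < e" if xy: "norm (x - y) < min d 1" for x y
  proof (cases "norm x < r \<or> norm y < r")
    case True
    then have "norm x \<le> r + 1" "norm y \<le> r + 1"
      using xy norm_triangle_sub[of x y] norm_triangle_sub[of y x] by (auto simp: norm_minus_commute)
    then show ?thesis using d(2)[of y x] xy by (simp add: dist_norm)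
  next
    case False
    then show ?thesis using assms by (simp add: not_less)
  qed
  with that[of "min d 1"] d(1) show thesis by simp
qed

text \<open>The kernel comes first and carries all the regularity; \<open>w\<close> is only Lebesgue
  measurable and locally integrable, which is why the integral is over
  \<open>lebesgue\<close>.\<close>

definition conv :: "(real ^ 'n::finite \<Rightarrow> real) \<Rightarrow> (real ^ 'n \<Rightarrow> real) \<Rightarrow> real ^ 'n \<Rightarrow> real" where
  "conv \<phi> w x = (\<integral>y. w y * \<phi> (x - y) \<partial>lebesgue)"

lemma continuous_lebesgue_measurable:
  fixes f :: "'a::euclidean_space \<Rightarrow> 'b::euclidean_space"
  shows "continuous_on UNIV f \<Longrightarrow> f \<in> borel_measurable lebesgue"
  by (rule measurable_completion) (simp add: borel_measurable_continuous_onI)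

lemma continuous_reflect:
  fixes f :: "'a::euclidean_space \<Rightarrow> 'b::euclidean_space"
  assumes "continuous_on UNIV f"
  shows "continuous_on UNIV (\<lambda>y. f (x - y))"
  by (rule continuous_on_compose2[OF assms]) (auto intro!: continuous_intros)

lemma conv_integrable:
  fixes w :: "real ^ 'n::finite \<Rightarrow> real" and \<Phi> :: "real ^ 'n \<Rightarrow> 'b::euclidean_space"
  assumes w: "w \<in> Lp_loc 1" and \<Phi>: "continuous_on UNIV \<Phi>" "\<And>x. norm x \<ge> r \<Longrightarrow> \<Phi> x = 0"
  shows "integrable lebesgue (\<lambda>y. w y *\<^sub>R \<Phi> (x - y))"
proof -
  obtain B where B: "\<And>x. norm (\<Phi> x) \<le> B" using bounded_compact_support[OF \<Phi>] by blast
  have [measurable]: "w \<in> borel_measurable lebesgue" using w by (auto simp: Lp_loc_def)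
  have [measurable]: "(\<lambda>y. \<Phi> (x - y)) \<in> borel_measurable lebesgue"
    by (intro continuous_lebesgue_measurable continuous_reflect \<Phi>)
  have *: "integrable lebesgue (\<lambda>y. B * norm (indicator (cball x r) y *\<^sub>R w y))"
    using Lp_loc_1_integrable[OF w] by (intro integrable_mult_right integrable_norm) auto
  show ?thesis
  proof (rule Bochner_Integration.integrable_bound[OF *])
    have "norm (w y *\<^sub>R \<Phi> (x - y)) \<le> norm (B * norm (indicator (cball x r) y *\<^sub>R w y))" for y
      using B[of "x - y"] \<Phi>(2)[of "x - y"] order_trans[OF norm_ge_zero B[of 0]]
      by (auto simp: indicator_def dist_norm not_le abs_mult mult.commute[of B] intro!: mult_left_mono)
    then show "AE y in lebesgue. norm (w y *\<^sub>R \<Phi> (x - y)) \<le> norm (B * norm (indicator (cball x r) y *\<^sub>R w y))"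
      by simp
  qed measurable
qed

text \<open>The common estimate behind continuity and differentiability of convolutions. There
  \<open>\<Psi>\<close> is a difference or a Taylor remainder of the kernel, uniformly small and
  supported in one fixed ball.\<close>

lemma conv_norm_bound:
  fixes w :: "real ^ 'n::finite \<Rightarrow> real" and \<Psi> :: "real ^ 'n \<Rightarrow> 'b::euclidean_space"
  assumes w: "w \<in> Lp_loc 1" and int: "integrable lebesgue (\<lambda>y. w y *\<^sub>R \<Psi> y)"
    and \<Psi>: "\<And>y. norm (\<Psi> y) \<le> e" "\<And>y. y \<notin> cball x s \<Longrightarrow> \<Psi> y = 0"
  shows "norm (\<integral>y. w y *\<^sub>R \<Psi> y \<partial>lebesgue) \<le> e * (\<integral>y. norm (indicator (cball x s) y *\<^sub>R w y) \<partial>lebesgue)"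
proof -
  have e: "e \<ge> 0" using \<Psi>(1) norm_ge_zero order_trans by blast
  have ib: "integrable lebesgue (\<lambda>y. e * norm (indicator (cball x s) y *\<^sub>R w y))"
    using Lp_loc_1_integrable[OF w] by (intro integrable_mult_right integrable_norm) auto
  have le: "norm (w y *\<^sub>R \<Psi> y) \<le> e * norm (indicator (cball x s) y *\<^sub>R w y)" for y
    using \<Psi>(1)[of y] \<Psi>(2)[of y] e
    by (cases "y \<in> cball x s") (auto simp: mult.commute[of e] intro!: mult_left_mono)
  have "norm (\<integral>y. w y *\<^sub>R \<Psi> y \<partial>lebesgue) \<le> (\<integral>y. norm (w y *\<^sub>R \<Psi> y) \<partial>lebesgue)"
    by (rule integral_norm_bound)
  also have "\<dots> \<le> (\<integral>y. e * norm (indicator (cball x s) y *\<^sub>R w y) \<partial>lebesgue)"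
    by (rule integral_mono[OF integrable_norm[OF int] ib le])
  finally have "norm (\<integral>y. w y *\<^sub>R \<Psi> y \<partial>lebesgue) \<le> (\<integral>y. e * norm (indicator (cball x s) y *\<^sub>R w y) \<partial>lebesgue)" .
  then show ?thesis by simp
qed

lemma continuous_conv:
  fixes w :: "real ^ 'n::finite \<Rightarrow> real" and \<Phi> :: "real ^ 'n \<Rightarrow> 'b::euclidean_space"
  assumes w: "w \<in> Lp_loc 1" and \<Phi>: "continuous_on UNIV \<Phi>" "\<And>x. norm x \<ge> r \<Longrightarrow> \<Phi> x = 0"
  shows "continuous_on UNIV (\<lambda>x. \<integral>y. w y *\<^sub>R \<Phi> (x - y) \<partial>lebesgue)"
proof (rule continuous_at_imp_continuous_on, rule, unfold continuous_at_eps_delta, intro allI impI)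
  fix x :: "real ^ 'n" and e :: real assume "e > 0"
  \<comment> \<open>Points \<open>x'\<close> closer than \<open>d \<le> 1\<close> to
    \<open>x\<close> see \<open>w\<close> only inside radius \<open>r + 1\<close>. Dividing by
    \<open>M + 1\<close> below avoids the case \<open>M = 0\<close>.\<close>
  define M where "M = (\<integral>y. norm (indicator (cball x (r + 1)) y *\<^sub>R w y) \<partial>lebesgue)"
  have M: "M \<ge> 0" by (simp add: M_def)
  with \<open>e > 0\<close> have "e / (M + 1) > 0" by simp
  then obtain d where d: "d > 0" "d \<le> 1" "\<And>a b. norm (a - b) < d \<Longrightarrow> norm (\<Phi> a - \<Phi> b) < e / (M + 1)"
    using uniformly_continuous_compact_support[OF \<Phi>] by metis
  have "dist (\<integral>y. w y *\<^sub>R \<Phi> (x' - y) \<partial>lebesgue) (\<integral>y. w y *\<^sub>R \<Phi> (x - y) \<partial>lebesgue) < e"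
    if x': "dist x' x < d" for x'
  proof -
    have "dist (\<integral>y. w y *\<^sub>R \<Phi> (x' - y) \<partial>lebesgue) (\<integral>y. w y *\<^sub>R \<Phi> (x - y) \<partial>lebesgue)
      = norm (\<integral>y. w y *\<^sub>R (\<Phi> (x' - y) - \<Phi> (x - y)) \<partial>lebesgue)"
      using conv_integrable[OF w \<Phi>] by (simp add: dist_norm scaleR_diff_right)
    also have "\<dots> \<le> (e / (M + 1)) * M" unfolding M_def
    proof (rule conv_norm_bound[OF w])
      show "integrable lebesgue (\<lambda>y. w y *\<^sub>R (\<Phi> (x' - y) - \<Phi> (x - y)))"
        using conv_integrable[OF w \<Phi>] by (simp add: scaleR_diff_right)
      show "norm (\<Phi> (x' - y) - \<Phi> (x - y)) \<le> e / (integral\<^sup>L lebesgue (\<lambda>y. norm (indicat_real (cball x (r + 1)) y *\<^sub>R w y)) + 1)" for y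
        using d(3)[of "x' - y" "x - y"] x' by (simp add: dist_norm M_def)
      show "\<Phi> (x' - y) - \<Phi> (x - y) = 0" if "y \<notin> cball x (r + 1)" for y
        using that x' d(2) norm_triangle_ineq[of "x - x'" "x' - y"] \<Phi>(2)
        by (simp add: dist_norm norm_minus_commute)
    qed
    also have "\<dots> < e" using M \<open>e > 0\<close> by (simp add: field_simps)
    finally show ?thesis .
  qed
  with d(1) show "\<exists>d>0. \<forall>x'. dist x' x < d \<longrightarrow>
      dist (\<integral>y. w y *\<^sub>R \<Phi> (x' - y) \<partial>lebesgue) (\<integral>y. w y *\<^sub>R \<Phi> (x - y) \<partial>lebesgue) < e" by blast
qed

text \<open>The mean value inequality turns a modulus of continuity of the gradient into a Taylor
  remainder. For compact support the modulus is uniform in the base point, so the remainder can be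
  integrated against \<open>w\<close>.\<close>

lemma C1_gradient_linearization:
  assumes "C1_gradient \<phi> D" "\<And>z. norm (z - a) < d \<Longrightarrow> norm (D z - D a) \<le> e" "norm (b - a) < d"
  shows "\<bar>\<phi> b - \<phi> a - (b - a) \<bullet> D a\<bar> \<le> e * norm (b - a)"
proof -
  have e: "e \<ge> 0" using assms(2)[of a] assms(3) le_less_trans[OF norm_ge_zero assms(3)] by simp
  have "norm (\<phi> b - \<phi> a - (\<lambda>h. h \<bullet> D a) (b - a)) \<le> norm (b - a) * e"
  proof (rule differentiable_bound_linearization[where S="ball a d" and f'="\<lambda>x h. h \<bullet> D x"])
    show "(\<phi> has_derivative (\<lambda>h. h \<bullet> D x)) (at x within ball a d)" for x
      using assms(1) by (auto simp: C1_gradient_def gderiv_def intro: has_derivative_at_withinI)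
    show "onorm ((\<lambda>h. h \<bullet> D x) - (\<lambda>h. h \<bullet> D a)) \<le> e" if "x \<in> ball a d" for x
    proof (rule onorm_bound[OF e])
      fix h
      have "\<bar>h \<bullet> (D x - D a)\<bar> \<le> norm h * norm (D x - D a)" by (rule Cauchy_Schwarz_ineq2)
      also have "\<dots> \<le> norm h * e"
        using assms(2)[of x] that by (intro mult_left_mono) (auto simp: dist_norm norm_minus_commute)
      finally show "norm (((\<lambda>h. h \<bullet> D x) - (\<lambda>h. h \<bullet> D a)) h) \<le> e * norm h"
        by (simp add: inner_diff_right mult.commute)
    qed
    show "a \<in> ball a d" using assms(3) le_less_trans[OF norm_ge_zero assms(3)] by simp
    show "a + t *\<^sub>R (b - a) \<in> ball a d" if "t \<in> {0..1}" for t
    proof -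
      have "t * norm (b - a) \<le> 1 * norm (b - a)" using that by (intro mult_right_mono) auto
      then show ?thesis using that assms(3) by (simp add: dist_norm)
    qed
  qed
  then show ?thesis by (simp add: mult.commute)
qed

text \<open>Differentiation under the integral: the Taylor remainder of \<open>\<phi>\<close> at
  \<open>x - y\<close> is at most \<open>e / (M + 1)\<close> times the increment for all
  \<open>y\<close> at once, and its integral against \<open>w\<close> costs a factor at most
  \<open>M\<close>.\<close>

lemma C1_gradient_conv:
  assumes w: "w \<in> Lp_loc 1" and \<phi>: "C1_gradient \<phi> D" "\<And>x. norm x \<ge> r \<Longrightarrow> \<phi> x = 0"
  shows "C1_gradient (conv \<phi> w) (\<lambda>x. \<integral>y. w y *\<^sub>R D (x - y) \<partial>lebesgue)"
proof -
  note cont = C1_gradient_continuous[OF \<phi>(1)]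
  have D0: "D x = 0" if "norm x \<ge> r" for x
    using C1_gradient_outside_support[OF \<phi> that] by simp
  have "GDERIV (conv \<phi> w) x :> (\<integral>y. w y *\<^sub>R D (x - y) \<partial>lebesgue)" for x
    unfolding gderiv_def has_derivative_at_alt
  proof (intro conjI allI impI)
    fix e :: real assume "e > 0"
    define M where "M = (\<integral>y. norm (indicator (cball x (r + 1)) y *\<^sub>R w y) \<partial>lebesgue)"
    have M: "M \<ge> 0" by (simp add: M_def)
    with \<open>e > 0\<close> have e': "e / (M + 1) > 0" by simp
    then obtain d where d: "d > 0" "d \<le> 1" "\<And>a b. norm (a - b) < d \<Longrightarrow> norm (D a - D b) < e / (M + 1)"
      using uniformly_continuous_compact_support[OF cont(2) D0] by metis
    have "norm (conv \<phi> w x' - conv \<phi> w x - (x' - x) \<bullet> (\<integral>y. w y *\<^sub>R D (x - y) \<partial>lebesgue)) \<le> e * norm (x' - x)"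
      if x': "norm (x' - x) < d" for x'
    proof -
      have i1: "integrable lebesgue (\<lambda>y. w y * \<phi> (z - y))" for z
        using conv_integrable[OF w cont(1) \<phi>(2)] by simp
      have i2: "integrable lebesgue (\<lambda>y. w y *\<^sub>R D (x - y))"
        using conv_integrable[OF w cont(2) D0] by simp
      have i3: "integrable lebesgue (\<lambda>y. w y * ((x' - x) \<bullet> D (x - y)))"
        using integrable_inner_right[of "x' - x", OF i2] by simp
      have "conv \<phi> w x' - conv \<phi> w x - (x' - x) \<bullet> (\<integral>y. w y *\<^sub>R D (x - y) \<partial>lebesgue)
        = (\<integral>y. w y * \<phi> (x' - y) - w y * \<phi> (x - y) - (x' - x) \<bullet> (w y *\<^sub>R D (x - y)) \<partial>lebesgue)"
        using i1 i3 integral_inner_right[OF i2, of "x' - x"] by (simp add: conv_def)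
      also have "\<dots> = (\<integral>y. w y *\<^sub>R (\<phi> (x' - y) - \<phi> (x - y) - (x' - x) \<bullet> D (x - y)) \<partial>lebesgue)"
        by (simp add: algebra_simps)
      finally have "norm (conv \<phi> w x' - conv \<phi> w x - (x' - x) \<bullet> (\<integral>y. w y *\<^sub>R D (x - y) \<partial>lebesgue))
        = norm (\<integral>y. w y *\<^sub>R (\<phi> (x' - y) - \<phi> (x - y) - (x' - x) \<bullet> D (x - y)) \<partial>lebesgue)" by simp
      also have "\<dots> \<le> (e / (M + 1) * norm (x' - x)) * M" unfolding M_def
      proof (rule conv_norm_bound[OF w])
        show "integrable lebesgue (\<lambda>y. w y *\<^sub>R (\<phi> (x' - y) - \<phi> (x - y) - (x' - x) \<bullet> D (x - y)))"
          using i1 i3 by (simp add: right_diff_distrib)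
        have "\<bar>\<phi> (x' - y) - \<phi> (x - y) - ((x' - y) - (x - y)) \<bullet> D (x - y)\<bar> \<le> e / (M + 1) * norm ((x' - y) - (x - y))" for y
          by (rule C1_gradient_linearization[OF \<phi>(1), where d=d])
             (use d(3) x' in \<open>auto simp: less_imp_le\<close>)
        then show "norm (\<phi> (x' - y) - \<phi> (x - y) - (x' - x) \<bullet> D (x - y)) \<le>
           e / (integral\<^sup>L lebesgue (\<lambda>y. norm (indicat_real (cball x (r + 1)) y *\<^sub>R w y)) + 1) * norm (x' - x)" for y
          by (simp add: M_def)
        show "\<phi> (x' - y) - \<phi> (x - y) - (x' - x) \<bullet> D (x - y) = 0" if "y \<notin> cball x (r + 1)" for y
          using that x' d(2) norm_triangle_ineq[of "x - x'" "x' - y"] \<phi>(2) D0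
          by (simp add: dist_norm norm_minus_commute)
      qed
      also have "\<dots> = e * norm (x' - x) * (M / (M + 1))" by simp
      also have "\<dots> \<le> e * norm (x' - x) * 1"
        using M \<open>e > 0\<close> by (intro mult_left_mono) auto
      finally show ?thesis by simp
    qed
    with d(1) show "\<exists>d>0. \<forall>x'. norm (x' - x) < d \<longrightarrow>
      norm (conv \<phi> w x' - conv \<phi> w x - (x' - x) \<bullet> (\<integral>y. w y *\<^sub>R D (x - y) \<partial>lebesgue)) \<le> e * norm (x' - x)"
      by blast
  qed (rule bounded_linear_inner_left)
  then show ?thesis
    using continuous_conv[OF w cont(2) D0] by (simp add: C1_gradient_def)
qed

lemma C1_gradient_conv_nth:
  assumes w: "w \<in> Lp_loc 1" and \<phi>: "C1_gradient \<phi> D" "\<And>x. norm x \<ge> r \<Longrightarrow> \<phi> x = 0"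
  shows "(\<integral>y. w y *\<^sub>R D (x - y) \<partial>lebesgue) $ i = conv (\<lambda>x. D x $ i) w x"
proof -
  have "integrable lebesgue (\<lambda>y. w y *\<^sub>R D (x - y))"
    using C1_gradient_outside_support[OF \<phi>] C1_gradient_continuous[OF \<phi>(1)]
    by (intro conv_integrable[OF w]) auto
  from integral_inner_left[OF this, of "axis i 1"]
  have "(\<integral>y. w y *\<^sub>R D (x - y) \<partial>lebesgue) \<bullet> axis i 1 = (\<integral>y. (w y *\<^sub>R D (x - y)) \<bullet> axis i 1 \<partial>lebesgue)"
    by (simp only:)
  then show ?thesis by (simp add: conv_def inner_axis)
qed

lemma compact_support_cball_iff:
  fixes \<phi> :: "'a::euclidean_space \<Rightarrow> 'b::zero"
  shows "compact_support \<phi> \<longleftrightarrow> (\<exists>r. \<forall>x. norm x \<ge> r \<longrightarrow> \<phi> x = 0)"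
proof
  assume "compact_support \<phi>"
  then show "\<exists>r. \<forall>x. norm x \<ge> r \<longrightarrow> \<phi> x = 0" by (rule compact_supportE) blast
next
  assume "\<exists>r. \<forall>x. norm x \<ge> r \<longrightarrow> \<phi> x = 0"
  then obtain r where "\<forall>x. norm x \<ge> r \<longrightarrow> \<phi> x = 0" by blast
  then show "compact_support \<phi>" by (intro compact_support_cball[of r]) auto
qed

lemma Cc_infinity_frechet_derivative:
  assumes "\<phi> \<in> Cc_infinity"
  shows "(\<lambda>x. frechet_derivative \<phi> (at x) v) \<in> Cc_infinity"
proof -
  have "Ck_on (Suc k) UNIV \<phi>" for k using assms unfolding Cc_infinity_def by blast
  then have "Ck_on k UNIV (\<lambda>x. frechet_derivative \<phi> (at x) v)" for k by simp
  moreover obtain r where r: "\<And>x. norm x \<ge> r \<Longrightarrow> \<phi> x = 0"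
    using assms compact_supportE unfolding Cc_infinity_def by blast
  have g: "C1_gradient \<phi> (grad \<phi>)" by (rule Cc_infinity_C1_gradient[OF assms])
  have "frechet_derivative \<phi> (at x) v = 0" if "norm x \<ge> r" for x
    using C1_gradient_outside_support[OF g r that] g GDERIV_frechet_derivative[of \<phi> x "grad \<phi> x" v]
    unfolding C1_gradient_def by (metis inner_zero_right)
  then have "compact_support (\<lambda>x. frechet_derivative \<phi> (at x) v)"
    by (auto simp: compact_support_cball_iff)
  ultimately show ?thesis by (simp add: Cc_infinity_def)
qed

text \<open>Every derivative falls on the kernel, whose derivatives are again test functions. The
  convolutions of the fixed \<open>w\<close> with all test functions thus form a class closed under
  differentiation.\<close>

lemma conv_Ck_on:
  assumes w: "w \<in> Lp_loc 1" and \<phi>: "\<phi> \<in> Cc_infinity"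
  shows "Ck_on k UNIV (conv \<phi> w)"
proof (rule Ck_on_closed_class[where \<F>="(\<lambda>\<phi>. conv \<phi> w) ` Cc_infinity"])
  fix F x v assume "F \<in> (\<lambda>\<phi>. conv \<phi> w) ` Cc_infinity"
  then obtain \<phi> where \<phi>: "\<phi> \<in> Cc_infinity" and F: "F = conv \<phi> w" by blast
  obtain r where r: "\<And>x. norm x \<ge> r \<Longrightarrow> \<phi> x = 0"
    using \<phi> compact_supportE unfolding Cc_infinity_def by blast
  note g = Cc_infinity_C1_gradient[OF \<phi>]
  have *: "GDERIV F x :> (\<integral>y. w y *\<^sub>R grad \<phi> (x - y) \<partial>lebesgue)" for x
    using C1_gradient_conv[OF w g r] by (simp add: C1_gradient_def F)
  then show "F differentiable (at x)" using GDERIV_differentiable by blast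
  have "frechet_derivative F (at x) v = conv (\<lambda>x. frechet_derivative \<phi> (at x) v) w x" for x
  proof -
    have i: "integrable lebesgue (\<lambda>y. w y *\<^sub>R grad \<phi> (x - y))"
      using C1_gradient_outside_support[OF g r] C1_gradient_continuous[OF g]
      by (intro conv_integrable[OF w]) auto
    have "frechet_derivative \<phi> (at z) v = v \<bullet> grad \<phi> z" for z
      using g by (simp add: C1_gradient_def GDERIV_frechet_derivative)
    then show ?thesis
      using integral_inner_right[OF i, of v, symmetric] by (simp add: conv_def GDERIV_frechet_derivative[OF *])
  qed
  then show "(\<lambda>x. frechet_derivative F (at x) v) \<in> (\<lambda>\<phi>. conv \<phi> w) ` Cc_infinity"
    using Cc_infinity_frechet_derivative[OF \<phi>] by auto
qed (use \<phi> in auto)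

section \<open>Mollification in \<open>L\<^sup>p\<close>\<close>

text \<open>Convexity of the power, as a tangent line that can be integrated. For
  \<open>s > 0\<close> it is the weighted geometric mean inequality for \<open>s powr p\<close> and
  \<open>t powr p\<close> with weights \<open>1 / p\<close> and \<open>1 - 1 / p\<close>.\<close>

lemma powr_tangent:
  fixes s t p :: real
  assumes "p \<ge> 1" "s \<ge> 0" "t > 0"
  shows "t powr p + p * t powr (p - 1) * (s - t) \<le> s powr p"
proof (cases "s = 0")
  case True
  have "t powr (p - 1) * t = t powr p" using assms by (simp add: powr_diff)
  then have "p * t powr (p - 1) * (s - t) = - (p * t powr p)" using True by simp
  moreover have "1 * t powr p \<le> p * t powr p" using assms by (intro mult_right_mono) auto
  moreover have "s powr p = 0" using True by simp
  ultimately show ?thesis by linarith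
next
  case False
  then have s: "s > 0" using assms by simp
  have "(s powr p) powr (1 / p) * (t powr p) powr (1 - 1 / p) \<le> (1 / p) * s powr p + (1 - 1 / p) * t powr p"
    using assms s by (intro Youngs_inequality_0) (auto simp: field_simps)
  moreover have "(s powr p) powr (1 / p) = s" using assms s by (simp add: powr_powr)
  moreover have "(t powr p) powr (1 - 1 / p) = t powr (p - 1)"
    using assms by (simp add: powr_powr right_diff_distrib)
  ultimately have "p * (s * t powr (p - 1)) \<le> p * ((1 / p) * s powr p + (1 - 1 / p) * t powr p)"
    using assms by (intro mult_left_mono) auto
  also have "\<dots> = s powr p + (p - 1) * t powr p" using assms by (simp add: field_simps)
  finally have *: "p * (s * t powr (p - 1)) \<le> s powr p + (p - 1) * t powr p" .
  have "t powr (p - 1) * t = t powr p" using assms by (simp add: powr_diff)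
  then have "p * t powr (p - 1) * (s - t) = p * (s * t powr (p - 1)) - p * t powr p"
    by (simp add: algebra_simps)
  moreover have "(p - 1) * t powr p = p * t powr p - t powr p" by (simp add: algebra_simps)
  ultimately show ?thesis using * by linarith
qed

text \<open>On sets of finite measure this yields the inclusion of L^p in L^q without Hoelder's
  inequality.\<close>

lemma powr_le_one_add:
  fixes t p q :: real
  assumes "0 \<le> q" "q \<le> p" "t \<ge> 0"
  shows "t powr q \<le> 1 + t powr p"
proof (cases "t \<le> 1")
  case True
  then have "t powr q \<le> 1 powr q" using assms by (intro powr_mono2) auto
  then show ?thesis by (simp add: add_increasing2)
next
  case False
  then have "t powr q \<le> t powr p" using assms by (intro powr_mono) auto
  then show ?thesis by simp
qed

lemma powr_add_le:
  fixes a b p :: real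
  assumes "p \<ge> 0" "a \<ge> 0" "b \<ge> 0"
  shows "(a + b) powr p \<le> 2 powr p * (a powr p + b powr p)"
proof -
  have "(a + b) powr p \<le> (2 * max a b) powr p" using assms by (intro powr_mono2) auto
  also have "\<dots> = 2 powr p * max a b powr p" using assms by (simp add: powr_mult)
  also have "\<dots> \<le> 2 powr p * (a powr p + b powr p)"
    by (intro mult_left_mono) (auto simp: max_def)
  finally show ?thesis .
qed

lemma Lp_loc_mono:
  assumes g: "g \<in> Lp_loc p" and "0 \<le> q" "q \<le> p"
  shows "g \<in> Lp_loc q"
proof -
  have [measurable]: "g \<in> borel_measurable lebesgue" using g by (simp add: Lp_loc_def)
  have "set_integrable lebesgue K (\<lambda>x. norm (g x) powr q)" if K: "compact K" for K
  proof -
    have [measurable]: "K \<in> sets lebesgue" using K by (simp add: borel_compact)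
    have "integrable lebesgue (indicator K :: _ \<Rightarrow> real)"
      using fmeasurableD2[OF lmeasurable_compact[OF K]]
      by (intro integrable_real_indicator) (auto simp: less_top)
    moreover have "integrable lebesgue (\<lambda>x. indicator K x *\<^sub>R (norm (g x) powr p))"
      using g K by (simp add: Lp_loc_def set_integrable_def)
    ultimately have *: "integrable lebesgue (\<lambda>x. indicator K x + indicator K x *\<^sub>R (norm (g x) powr p))"
      by simp
    show ?thesis unfolding set_integrable_def
      by (rule Bochner_Integration.integrable_bound[OF *])
         (use powr_le_one_add[of q p] assms in \<open>auto simp: indicator_def\<close>)
  qed
  then show ?thesis by (simp add: Lp_loc_def)
qed

lemma Lp_loc_measurable: "g \<in> Lp_loc p \<Longrightarrow> g \<in> borel_measurable lebesgue"
  by (simp add: Lp_loc_def)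

lemma Lp_locI_nn_integral:
  fixes g :: "real ^ 'n::finite \<Rightarrow> real"
  assumes [measurable]: "g \<in> borel_measurable lebesgue"
    and "(\<integral>\<^sup>+x. ennreal (\<bar>g x\<bar> powr p) \<partial>lebesgue) < \<infinity>"
  shows "g \<in> Lp_loc p"
proof -
  have *: "integrable lebesgue (\<lambda>x. \<bar>g x\<bar> powr p)"
    by (rule integrableI_bounded) (use assms in auto)
  have "set_integrable lebesgue K (\<lambda>x. \<bar>g x\<bar> powr p)" if "compact K" for K
    unfolding set_integrable_def using that
    by (intro integrable_mult_indicator *) (simp add: borel_compact)
  then show ?thesis by (simp add: Lp_loc_def)
qed

section \<open>Averages against a mollifier\<close>

lemma mollifierD:
  assumes "mollifier \<epsilon> \<rho>"
  shows "\<rho> \<in> Cc_infinity" "\<And>x. \<rho> x \<ge> 0" "\<And>x. norm x \<ge> \<epsilon> \<Longrightarrow> \<rho> x = 0" "(\<integral>x. \<rho> x \<partial>lborel) = 1"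
    "continuous_on UNIV \<rho>" "\<rho> \<in> borel_measurable borel" "integrable lborel \<rho>"
proof -
  show *: "\<rho> \<in> Cc_infinity" "\<And>x. \<rho> x \<ge> 0" "\<And>x. norm x \<ge> \<epsilon> \<Longrightarrow> \<rho> x = 0" "(\<integral>x. \<rho> x \<partial>lborel) = 1"
    using assms by (auto simp: mollifier_def)
  show c: "continuous_on UNIV \<rho>"
    using Cc_infinity_C1_gradient[OF *(1)] C1_gradient_continuous by blast
  then show "\<rho> \<in> borel_measurable borel" by (simp add: borel_measurable_continuous_onI)
  show "integrable lborel \<rho>" by (rule integrable_lborel_compact_support[OF c *(3)])
qed

lemma mollifier_integral_reflect:
  assumes "mollifier \<epsilon> \<rho>"
  shows "(\<integral>y. \<rho> (x - y) \<partial>lebesgue) = 1" "integrable lebesgue (\<lambda>y. \<rho> (x - y))"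
proof -
  note [measurable] = mollifierD(6)[OF assms]
  show eq: "(\<integral>y. \<rho> (x - y) \<partial>lebesgue) = 1"
    using integral_lborel_reflect[of \<rho> x] mollifierD(4)[OF assms] by (simp add: integral_completion)
  then show "integrable lebesgue (\<lambda>y. \<rho> (x - y))"
    using not_integrable_integral_eq by fastforce
qed

text \<open>An average stays as close to \<open>c\<close> as the averaged values do. With
  \<open>c = 0\<close> this gives sup bounds and supports of mollifications, with \<open>c\<close>
  the value at the centre it gives uniform convergence.\<close>

lemma mollifier_conv_bound:
  assumes m: "mollifier \<epsilon> \<rho>" and w: "w \<in> Lp_loc 1"
    and B: "AE y in lebesgue. y \<in> ball x \<epsilon> \<longrightarrow> \<bar>w y - c\<bar> \<le> B"
  shows "\<bar>conv \<rho> w x - c\<bar> \<le> B"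
proof -
  note r = mollifier_integral_reflect[OF m, of x]
  have i: "integrable lebesgue (\<lambda>y. w y * \<rho> (x - y))"
    using conv_integrable[OF w mollifierD(5)[OF m] mollifierD(3)[OF m]] by simp
  then have i': "integrable lebesgue (\<lambda>y. w y * \<rho> (x - y) - c * \<rho> (x - y))" using r by simp
  have "\<bar>conv \<rho> w x - c\<bar> = \<bar>\<integral>y. w y * \<rho> (x - y) - c * \<rho> (x - y) \<partial>lebesgue\<bar>"
    using i r by (simp add: conv_def)
  also have "\<dots> \<le> (\<integral>y. \<bar>w y * \<rho> (x - y) - c * \<rho> (x - y)\<bar> \<partial>lebesgue)"
    by (rule integral_abs_bound)
  also have "\<dots> \<le> (\<integral>y. B * \<rho> (x - y) \<partial>lebesgue)"
  proof (rule integral_mono_AE)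
    show "integrable lebesgue (\<lambda>y. \<bar>w y * \<rho> (x - y) - c * \<rho> (x - y)\<bar>)" using i' by simp
    show "integrable lebesgue (\<lambda>y. B * \<rho> (x - y))" using r by simp
    show "AE y in lebesgue. \<bar>w y * \<rho> (x - y) - c * \<rho> (x - y)\<bar> \<le> B * \<rho> (x - y)"
      using B
    proof eventually_elim
      case (elim y)
      show ?case
      proof (cases "y \<in> ball x \<epsilon>")
        case True
        then have "\<bar>w y - c\<bar> * \<rho> (x - y) \<le> B * \<rho> (x - y)"
          using elim mollifierD(2)[OF m] by (intro mult_right_mono) auto
        then show ?thesis using mollifierD(2)[OF m, of "x - y"]
          by (simp add: left_diff_distrib[symmetric] abs_mult)
      next
        case False
        then have "\<rho> (x - y) = 0" by (intro mollifierD(3)[OF m]) (simp add: dist_norm)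
        then show ?thesis by simp
      qed
    qed
  qed
  also have "\<dots> = B" using r by simp
  finally show ?thesis .
qed

text \<open>Jensen's inequality for the probability density \<open>\<rho> (x - y)\<close>: the
  tangent line at the mean \<open>t\<close> of \<open>\<bar>h\<bar>\<close> is integrated, and its
  linear part has integral 0.\<close>

lemma mollifier_Jensen:
  assumes m: "mollifier \<epsilon> \<rho>" and p: "p \<ge> 1" and h: "h \<in> Lp_loc p"
  shows "\<bar>conv \<rho> h x\<bar> powr p \<le> (\<integral>y. \<bar>h y\<bar> powr p * \<rho> (x - y) \<partial>lebesgue)"
proof -
  have h1: "h \<in> Lp_loc 1" using Lp_loc_mono[OF h] p by simp
  have [measurable]: "h \<in> borel_measurable lebesgue" using h by (simp add: Lp_loc_def)
  have "(\<lambda>y. \<bar>h y\<bar> powr p) \<in> Lp_loc 1" using h by (simp add: Lp_loc_def)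
  from conv_integrable[OF this mollifierD(5)[OF m] mollifierD(3)[OF m]]
  have ip: "integrable lebesgue (\<lambda>y. \<bar>h y\<bar> powr p * \<rho> (x - y))" by simp
  have i: "integrable lebesgue (\<lambda>y. h y * \<rho> (x - y))"
    using conv_integrable[OF h1 mollifierD(5)[OF m] mollifierD(3)[OF m]] by simp
  then have ia: "integrable lebesgue (\<lambda>y. \<bar>h y\<bar> * \<rho> (x - y))"
    using integrable_abs[OF i] mollifierD(2)[OF m] by (simp add: abs_mult)
  note r = mollifier_integral_reflect[OF m, of x]
  define t where "t = (\<integral>y. \<bar>h y\<bar> * \<rho> (x - y) \<partial>lebesgue)"
  have t0: "t \<ge> 0" unfolding t_def using mollifierD(2)[OF m] by (intro Bochner_Integration.integral_nonneg) auto
  have "\<bar>conv \<rho> h x\<bar> \<le> t"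
    using integral_abs_bound[of lebesgue "\<lambda>y. h y * \<rho> (x - y)"] mollifierD(2)[OF m]
    by (simp add: conv_def t_def abs_mult)
  then have "\<bar>conv \<rho> h x\<bar> powr p \<le> t powr p" using p by (intro powr_mono2) auto
  also have "t powr p \<le> (\<integral>y. \<bar>h y\<bar> powr p * \<rho> (x - y) \<partial>lebesgue)"
  proof (cases "t = 0")
    case True
    then show ?thesis using mollifierD(2)[OF m] p by (auto intro!: Bochner_Integration.integral_nonneg)
  next
    case False
    then have t: "t > 0" using t0 by simp
    let ?k = "p * t powr (p - 1)"
    have eq: "(t powr p + ?k * (\<bar>h y\<bar> - t)) * \<rho> (x - y)
        = (t powr p - ?k * t) * \<rho> (x - y) + ?k * (\<bar>h y\<bar> * \<rho> (x - y))" for y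
      by (simp add: algebra_simps)
    have ie: "integrable lebesgue (\<lambda>y. (t powr p + ?k * (\<bar>h y\<bar> - t)) * \<rho> (x - y))"
      unfolding eq using ia r by auto
    have "t powr p = (\<integral>y. (t powr p + ?k * (\<bar>h y\<bar> - t)) * \<rho> (x - y) \<partial>lebesgue)"
      unfolding eq using ia r by (simp add: t_def[symmetric])
    also have "\<dots> \<le> (\<integral>y. \<bar>h y\<bar> powr p * \<rho> (x - y) \<partial>lebesgue)"
    proof (rule integral_mono[OF ie ip])
      show "(t powr p + ?k * (\<bar>h y\<bar> - t)) * \<rho> (x - y) \<le> \<bar>h y\<bar> powr p * \<rho> (x - y)" for y
        using powr_tangent[OF p, of "\<bar>h y\<bar>" t] t mollifierD(2)[OF m] by (intro mult_right_mono) auto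
    qed
    finally show ?thesis .
  qed
  finally show ?thesis .
qed

text \<open>After Jensen's inequality and an exchange of integrals, every point \<open>y\<close> is
  weighted with the total mass 1 of the kernel.\<close>

lemma mollifier_Lp_contraction:
  assumes m: "mollifier \<epsilon> \<rho>" and p: "p \<ge> 1" and h: "h \<in> Lp_loc p"
  shows "(\<integral>\<^sup>+x. ennreal (\<bar>conv \<rho> h x\<bar> powr p) \<partial>lebesgue) \<le> (\<integral>\<^sup>+x. ennreal (\<bar>h x\<bar> powr p) \<partial>lebesgue)"
proof -
  have hm[measurable]: "h \<in> borel_measurable lebesgue" using h by (simp add: Lp_loc_def)
  \<comment> \<open>The exchange of integrals takes place for \<open>lborel\<close>, so
    \<open>h\<close> is replaced by a Borel function that agrees with it almost everywhere.\<close>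
  from completion_ex_borel_measurable_real[OF hm]
  obtain h' where "h' \<in> borel_measurable lborel" and eq: "AE x in lborel. h x = h' x" by blast
  then have h'[measurable]: "h' \<in> borel_measurable borel" by simp
  have eq': "AE x in lebesgue. h x = h' x" using eq by (rule AE_completion)
  note [measurable] = mollifierD(6)[OF m]
  have "(\<lambda>y. \<bar>h y\<bar> powr p) \<in> Lp_loc 1" using h by (simp add: Lp_loc_def)
  from conv_integrable[OF this mollifierD(5)[OF m] mollifierD(3)[OF m]]
  have ip: "integrable lebesgue (\<lambda>y. \<bar>h y\<bar> powr p * \<rho> (x - y))" for x by simp
  have "ennreal (\<bar>conv \<rho> h x\<bar> powr p) \<le> (\<integral>\<^sup>+y. ennreal (\<bar>h' y\<bar> powr p * \<rho> (x - y)) \<partial>lborel)" for x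
  proof -
    have "ennreal (\<bar>conv \<rho> h x\<bar> powr p) \<le> ennreal (\<integral>y. \<bar>h y\<bar> powr p * \<rho> (x - y) \<partial>lebesgue)"
      using mollifier_Jensen[OF m p h] by (rule ennreal_leI)
    also have "\<dots> = (\<integral>\<^sup>+y. ennreal (\<bar>h y\<bar> powr p * \<rho> (x - y)) \<partial>lebesgue)"
      using ip mollifierD(2)[OF m] by (subst nn_integral_eq_integral) auto
    also have "\<dots> = (\<integral>\<^sup>+y. ennreal (\<bar>h' y\<bar> powr p * \<rho> (x - y)) \<partial>lebesgue)"
      using eq' by (intro nn_integral_cong_AE) (auto elim!: eventually_mono)
    finally show ?thesis by (simp add: nn_integral_completion)
  qed
  then have "(\<integral>\<^sup>+x. ennreal (\<bar>conv \<rho> h x\<bar> powr p) \<partial>lebesgue)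
      \<le> (\<integral>\<^sup>+x. (\<integral>\<^sup>+y. ennreal (\<bar>h' y\<bar> powr p * \<rho> (x - y)) \<partial>lborel) \<partial>lebesgue)"
    by (intro nn_integral_mono) auto
  also have "\<dots> = (\<integral>\<^sup>+x. (\<integral>\<^sup>+y. ennreal (\<bar>h' y\<bar> powr p * \<rho> (x - y)) \<partial>lborel) \<partial>lborel)"
    by (rule nn_integral_completion)
  also have "\<dots> = (\<integral>\<^sup>+y. (\<integral>\<^sup>+x. ennreal (\<bar>h' y\<bar> powr p * \<rho> (x - y)) \<partial>lborel) \<partial>lborel)"
    by (rule lborel_pair.Fubini') measurable
  also have "\<dots> = (\<integral>\<^sup>+y. ennreal (\<bar>h' y\<bar> powr p) * (\<integral>\<^sup>+x. ennreal (\<rho> (x - y)) \<partial>lborel) \<partial>lborel)"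
    using mollifierD(2)[OF m] by (simp add: ennreal_mult' nn_integral_cmult)
  also have "\<dots> = (\<integral>\<^sup>+y. ennreal (\<bar>h' y\<bar> powr p) \<partial>lborel)"
  proof -
    have "(\<integral>\<^sup>+x. ennreal (\<rho> (x - y)) \<partial>lborel) = 1" for y
      using nn_integral_lborel_translate[of "\<lambda>x. ennreal (\<rho> x)" y] mollifierD(2,4,7)[OF m]
      by (simp add: nn_integral_eq_integral)
    then show ?thesis by simp
  qed
  also have "\<dots> = (\<integral>\<^sup>+y. ennreal (\<bar>h' y\<bar> powr p) \<partial>lebesgue)"
    by (simp add: nn_integral_completion)
  also have "\<dots> = (\<integral>\<^sup>+x. ennreal (\<bar>h x\<bar> powr p) \<partial>lebesgue)"
    using eq' by (intro nn_integral_cong_AE) (auto elim!: eventually_mono)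
  finally show ?thesis .
qed

section \<open>Approximation in L^p by continuous functions\<close>

lemma Lp_truncate:
  fixes w :: "real ^ 'n::finite \<Rightarrow> real"
  assumes [measurable]: "w \<in> borel_measurable lebesgue" and p: "p \<ge> 1"
    and fin: "(\<integral>\<^sup>+x. ennreal (\<bar>w x\<bar> powr p) \<partial>lebesgue) < \<infinity>" and \<delta>: "\<delta> > 0"
  shows "\<exists>N::nat. (\<integral>\<^sup>+x. ennreal (\<bar>w x - max (- real N) (min (real N) (w x))\<bar> powr p) \<partial>lebesgue) < ennreal \<delta>"
proof -
  have "(\<lambda>N. \<integral>\<^sup>+x. ennreal (\<bar>w x - max (- real N) (min (real N) (w x))\<bar> powr p) \<partial>lebesgue)
    \<longlonglongrightarrow> (\<integral>\<^sup>+x. (\<lambda>_. 0) x \<partial>(lebesgue :: (real ^ 'n) measure))"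
  proof (rule nn_integral_dominated_convergence[where w="\<lambda>x. ennreal (\<bar>w x\<bar> powr p)"])
    show "AE x in lebesgue. ennreal (\<bar>w x - max (- real j) (min (real j) (w x))\<bar> powr p) \<le> ennreal (\<bar>w x\<bar> powr p)" for j
      using p by (intro always_eventually allI ennreal_leI powr_mono2) auto
    have "eventually (\<lambda>N. ennreal (\<bar>w x - max (- real N) (min (real N) (w x))\<bar> powr p) = 0) sequentially" for x
    proof -
      obtain N0 :: nat where "\<bar>w x\<bar> \<le> real N0" using real_arch_simple by blast
      show ?thesis
      proof (rule eventually_sequentiallyI[of N0])
        fix N assume "N0 \<le> N"
        then have "\<bar>w x\<bar> \<le> real N" using \<open>\<bar>w x\<bar> \<le> real N0\<close> by linarith
        then have "w x - max (- real N) (min (real N) (w x)) = 0" by linarith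
        then show "ennreal (\<bar>w x - max (- real N) (min (real N) (w x))\<bar> powr p) = 0" by simp
      qed
    qed
    then show "AE x in lebesgue. (\<lambda>N. ennreal (\<bar>w x - max (- real N) (min (real N) (w x))\<bar> powr p)) \<longlonglongrightarrow> 0"
      by (intro always_eventually allI) (rule tendsto_eventually)
  qed (use fin in auto)
  then have "(\<lambda>N. \<integral>\<^sup>+x. ennreal (\<bar>w x - max (- real N) (min (real N) (w x))\<bar> powr p) \<partial>lebesgue) \<longlonglongrightarrow> 0"
    by simp
  then have "eventually (\<lambda>N. (\<integral>\<^sup>+x. ennreal (\<bar>w x - max (- real N) (min (real N) (w x))\<bar> powr p) \<partial>lebesgue) < ennreal \<delta>) sequentially"
    by (rule order_tendstoD) (use \<delta> in simp)
  then show ?thesis using eventually_happens'[OF sequentially_bot] by blast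
qed

lemma bounded_Lp_approx_continuous:
  fixes w :: "real ^ 'n::finite \<Rightarrow> real"
  assumes [measurable]: "w \<in> borel_measurable lebesgue" and p: "p \<ge> 1"
    and N: "\<And>x. \<bar>w x\<bar> \<le> real N" and supp: "\<And>x. norm x > r \<Longrightarrow> w x = 0" and \<delta>: "\<delta> > 0"
  shows "\<exists>v. continuous_on UNIV v \<and> (\<forall>x. norm x \<ge> r + 1 \<longrightarrow> v x = 0) \<and>
     (\<integral>\<^sup>+x. ennreal (\<bar>w x - v x\<bar> powr p) \<partial>lebesgue) < ennreal \<delta>"
proof -
  have "w measurable_on UNIV" by (rule lebesgue_measurable_imp_measurable_on) auto
  then obtain S g where S: "negligible S" and g: "\<And>n. continuous_on UNIV (g n)"
    and lim: "\<And>x. x \<notin> S \<Longrightarrow> (\<lambda>n. g n x) \<longlonglongrightarrow> w x"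
    unfolding measurable_on_def by auto
  \<comment> \<open>Clipping at \<open>N\<close> and cutting off provide a common integrable
    majorant. Neither changes the limit, because \<open>w\<close> is bounded by \<open>N\<close> and
    vanishes outside radius \<open>r\<close>, where \<open>cut\<close> starts to decrease.\<close>
  define cut where "cut x = max 0 (min 1 (r + 1 - norm x))" for x :: "real ^ 'n"
  define v where "v n x = cut x * max (- real N) (min (real N) (g n x))" for n x
  have cont: "continuous_on UNIV (v n)" for n
    unfolding v_def cut_def by (intro continuous_intros g)
  have [measurable]: "v n \<in> borel_measurable lebesgue" for n
    by (intro continuous_lebesgue_measurable cont)
  have v0: "v n x = 0" if "norm x \<ge> r + 1" for n x using that by (simp add: v_def cut_def)
  have "\<bar>cut x\<bar> \<le> 1" "\<bar>max (- real N) (min (real N) (g n x))\<bar> \<le> real N" for n x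
    by (auto simp: cut_def)
  then have vN: "\<bar>v n x\<bar> \<le> 1 * real N" for n x
    unfolding v_def abs_mult by (intro mult_mono) auto
  have "(\<lambda>n. \<integral>\<^sup>+x. ennreal (\<bar>w x - v n x\<bar> powr p) \<partial>lebesgue) \<longlonglongrightarrow> (\<integral>\<^sup>+x. (\<lambda>_. 0) x \<partial>(lebesgue :: (real ^ 'n) measure))"
  proof (rule nn_integral_dominated_convergence[where w="\<lambda>x. ennreal ((2 * real N) powr p) * indicator (cball 0 (r + 1)) x"])
    show "AE x in lebesgue. ennreal (\<bar>w x - v j x\<bar> powr p) \<le> ennreal ((2 * real N) powr p) * indicator (cball 0 (r + 1)) x" for j
    proof (intro always_eventually allI)
      fix x
      show "ennreal (\<bar>w x - v j x\<bar> powr p) \<le> ennreal ((2 * real N) powr p) * indicator (cball 0 (r + 1)) x"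
      proof (cases "norm x \<le> r + 1")
        case True
        have "\<bar>w x - v j x\<bar> powr p \<le> (2 * real N) powr p"
          using N[of x] vN[of j x] p by (intro powr_mono2) auto
        then show ?thesis using True by (simp add: ennreal_leI)
      next
        case False
        then show ?thesis using supp[of x] v0[of x j] by simp
      qed
    qed
    show "(\<integral>\<^sup>+x. ennreal ((2 * real N) powr p) * indicator (cball 0 (r + 1)) x \<partial>(lebesgue :: (real ^ 'n) measure)) < \<infinity>"
      using fmeasurableD2[OF lmeasurable_cball[of "0 :: real ^ 'n" "r + 1"]]
      by (subst nn_integral_cmult_indicator) (auto simp: ennreal_mult_less_top less_top)
    have "(\<lambda>n. ennreal (\<bar>w x - v n x\<bar> powr p)) \<longlonglongrightarrow> 0" if "x \<notin> S" for x
    proof -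
      have "(\<lambda>n. v n x) \<longlonglongrightarrow> cut x * max (- real N) (min (real N) (w x))"
        unfolding v_def by (intro tendsto_intros lim that)
      moreover have "cut x * max (- real N) (min (real N) (w x)) = w x"
      proof (cases "norm x \<le> r")
        case True then have "cut x = 1" by (simp add: cut_def)
        moreover have "max (- real N) (min (real N) (w x)) = w x" using N[of x] by linarith
        ultimately show ?thesis by simp
      next
        case False then show ?thesis using supp[of x] by simp
      qed
      ultimately have "(\<lambda>n. v n x) \<longlonglongrightarrow> w x" by simp
      then have "(\<lambda>n. \<bar>w x - v n x\<bar>) \<longlonglongrightarrow> \<bar>w x - w x\<bar>"
        by (intro tendsto_intros)
      then have "(\<lambda>n. \<bar>w x - v n x\<bar>) \<longlonglongrightarrow> 0" by simp
      then have "(\<lambda>n. \<bar>w x - v n x\<bar> powr p) \<longlonglongrightarrow> 0 powr p"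
        using p by (intro tendsto_powr2) auto
      then have "(\<lambda>n. ennreal (\<bar>w x - v n x\<bar> powr p)) \<longlonglongrightarrow> ennreal (0 powr p)"
        by (rule tendsto_ennrealI)
      then show ?thesis by simp
    qed
    moreover have "AE x in lebesgue. x \<notin> S"
      using S by (simp add: negligible_iff_null_sets AE_not_in)
    ultimately show "AE x in lebesgue. (\<lambda>n. ennreal (\<bar>w x - v n x\<bar> powr p)) \<longlonglongrightarrow> 0"
      by (auto elim: eventually_mono)
    show "(\<lambda>x. ennreal ((2 * real N) powr p) * indicator (cball (0 :: real ^ 'n) (r + 1)) x) \<in> borel_measurable lebesgue"
      by (intro borel_measurable_times_ennreal borel_measurable_const borel_measurable_indicator) simp
  qed measurable
  then have "(\<lambda>n. \<integral>\<^sup>+x. ennreal (\<bar>w x - v n x\<bar> powr p) \<partial>lebesgue) \<longlonglongrightarrow> 0" by simp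
  then have "eventually (\<lambda>n. (\<integral>\<^sup>+x. ennreal (\<bar>w x - v n x\<bar> powr p) \<partial>lebesgue) < ennreal \<delta>) sequentially"
    by (rule order_tendstoD) (use \<delta> in simp)
  then obtain n where "(\<integral>\<^sup>+x. ennreal (\<bar>w x - v n x\<bar> powr p) \<partial>lebesgue) < ennreal \<delta>"
    using eventually_happens'[OF sequentially_bot] by blast
  then show ?thesis using cont v0 by blast
qed

text \<open>A crude substitute for Minkowski's inequality. The factor \<open>2 powr p\<close> is
  harmless because the errors it is applied to can be made as small as desired.\<close>

lemma nn_integral_powr_add_le:
  fixes a b :: "'a \<Rightarrow> real"
  assumes [measurable]: "a \<in> borel_measurable M" "b \<in> borel_measurable M" and p: "p \<ge> 0"
    and le: "\<And>x. \<bar>c x\<bar> \<le> \<bar>a x\<bar> + \<bar>b x\<bar>"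
    and A: "(\<integral>\<^sup>+x. ennreal (\<bar>a x\<bar> powr p) \<partial>M) \<le> ennreal A" "A \<ge> 0"
    and B: "(\<integral>\<^sup>+x. ennreal (\<bar>b x\<bar> powr p) \<partial>M) \<le> ennreal B" "B \<ge> 0"
  shows "(\<integral>\<^sup>+x. ennreal (\<bar>c x\<bar> powr p) \<partial>M) \<le> ennreal (2 powr p * (A + B))"
proof -
  have "\<bar>c x\<bar> powr p \<le> 2 powr p * (\<bar>a x\<bar> powr p + \<bar>b x\<bar> powr p)" for x
    using powr_mono2[OF p abs_ge_zero le[of x]] powr_add_le[OF p, of "\<bar>a x\<bar>" "\<bar>b x\<bar>"] by simp
  then have "(\<integral>\<^sup>+x. ennreal (\<bar>c x\<bar> powr p) \<partial>M) \<le>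
      (\<integral>\<^sup>+x. ennreal (2 powr p) * (ennreal (\<bar>a x\<bar> powr p) + ennreal (\<bar>b x\<bar> powr p)) \<partial>M)"
    by (intro nn_integral_mono) (auto simp: ennreal_mult[symmetric] ennreal_plus[symmetric] simp del: ennreal_plus intro!: ennreal_leI)
  also have "\<dots> = ennreal (2 powr p) * ((\<integral>\<^sup>+x. ennreal (\<bar>a x\<bar> powr p) \<partial>M) + (\<integral>\<^sup>+x. ennreal (\<bar>b x\<bar> powr p) \<partial>M))"
    by (simp add: nn_integral_cmult nn_integral_add)
  also have "\<dots> \<le> ennreal (2 powr p) * (ennreal A + ennreal B)"
    using A B by (intro mult_left_mono add_mono) auto
  also have "\<dots> = ennreal (2 powr p * (A + B))" using A B by (simp add: ennreal_mult)
  finally show ?thesis .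
qed

lemma Lp_approx_continuous:
  fixes w :: "real ^ 'n::finite \<Rightarrow> real"
  assumes w[measurable]: "w \<in> borel_measurable lebesgue" and p: "p \<ge> 1"
    and fin: "(\<integral>\<^sup>+x. ennreal (\<bar>w x\<bar> powr p) \<partial>lebesgue) < \<infinity>"
    and supp: "\<And>x. norm x > r \<Longrightarrow> w x = 0" and \<delta>: "\<delta> > 0"
  shows "\<exists>v. continuous_on UNIV v \<and> (\<forall>x. norm x \<ge> r + 1 \<longrightarrow> v x = 0) \<and>
     (\<integral>\<^sup>+x. ennreal (\<bar>w x - v x\<bar> powr p) \<partial>lebesgue) \<le> ennreal \<delta>"
proof -
  define \<delta>' where "\<delta>' = \<delta> / (2 powr p * 2)"
  have \<delta>': "\<delta>' > 0" using \<delta> by (simp add: \<delta>'_def)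
  obtain N :: nat where N: "(\<integral>\<^sup>+x. ennreal (\<bar>w x - max (- real N) (min (real N) (w x))\<bar> powr p) \<partial>lebesgue) < ennreal \<delta>'"
    using Lp_truncate[OF w p fin \<delta>'] by blast
  have "\<exists>v. continuous_on UNIV v \<and> (\<forall>x. norm x \<ge> r + 1 \<longrightarrow> v x = 0) \<and>
     (\<integral>\<^sup>+x. ennreal (\<bar>max (- real N) (min (real N) (w x)) - v x\<bar> powr p) \<partial>lebesgue) < ennreal \<delta>'"
    by (rule bounded_Lp_approx_continuous[where N=N]) (use p \<delta>' supp in auto)
  then obtain v where v: "continuous_on UNIV v" "\<forall>x. norm x \<ge> r + 1 \<longrightarrow> v x = 0"
     "(\<integral>\<^sup>+x. ennreal (\<bar>max (- real N) (min (real N) (w x)) - v x\<bar> powr p) \<partial>lebesgue) < ennreal \<delta>'"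
    by blast
  have [measurable]: "v \<in> borel_measurable lebesgue" by (rule continuous_lebesgue_measurable[OF v(1)])
  have "(\<integral>\<^sup>+x. ennreal (\<bar>w x - v x\<bar> powr p) \<partial>lebesgue) \<le> ennreal (2 powr p * (\<delta>' + \<delta>'))"
    by (rule nn_integral_powr_add_le[where a="\<lambda>x. w x - max (- real N) (min (real N) (w x))"
        and b="\<lambda>x. max (- real N) (min (real N) (w x)) - v x"])
       (use p N v \<delta>' in \<open>auto simp: less_imp_le\<close>)
  also have "2 powr p * (\<delta>' + \<delta>') = \<delta>" by (simp add: \<delta>'_def)
  finally show ?thesis using v by blast
qed

lemma continuous_compact_support_Lp_loc:
  fixes \<phi> :: "real ^ 'n::finite \<Rightarrow> real"
  assumes "continuous_on UNIV \<phi>" "\<And>x. norm x \<ge> r \<Longrightarrow> \<phi> x = 0"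
  shows "\<phi> \<in> Lp_loc 1"
proof (rule Lp_locI_nn_integral)
  show "\<phi> \<in> borel_measurable lebesgue" by (rule continuous_lebesgue_measurable[OF assms(1)])
  have "integrable lborel \<phi>" by (rule integrable_lborel_compact_support[OF assms])
  then have "integrable lebesgue \<phi>" by (simp add: integrable_completion)
  then show "(\<integral>\<^sup>+x. ennreal (\<bar>\<phi> x\<bar> powr 1) \<partial>lebesgue) < \<infinity>"
    by (simp add: integrable_iff_bounded)
qed

lemma mollify_uniform:
  fixes v :: "real ^ 'n::finite \<Rightarrow> real"
  assumes v: "continuous_on UNIV v" "\<And>x. norm x \<ge> r \<Longrightarrow> v x = 0" and \<tau>: "\<tau> > 0"
  shows "\<exists>\<epsilon>\<^sub>0>0. \<epsilon>\<^sub>0 \<le> 1 \<and> (\<forall>\<epsilon> \<rho>. \<epsilon> \<le> \<epsilon>\<^sub>0 \<longrightarrow> mollifier \<epsilon> \<rho> \<longrightarrow>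
     (\<forall>x. \<bar>conv \<rho> v x - v x\<bar> \<le> \<tau>) \<and> (\<forall>x. norm x \<ge> r + 1 \<longrightarrow> conv \<rho> v x = 0))"
proof -
  obtain d where d: "d > 0" "d \<le> 1" "\<And>x y. norm (x - y) < d \<Longrightarrow> norm (v x - v y) < \<tau>"
    using uniformly_continuous_compact_support[OF v \<tau>] by metis
  have v1: "v \<in> Lp_loc 1" by (rule continuous_compact_support_Lp_loc[OF v])
  have "\<bar>conv \<rho> v x - v x\<bar> \<le> \<tau>" if m: "mollifier \<epsilon> \<rho>" and "\<epsilon> \<le> d" for \<epsilon> \<rho> x
  proof (rule mollifier_conv_bound[OF m v1], intro always_eventually allI impI)
    fix y assume "y \<in> ball x \<epsilon>"
    then show "\<bar>v y - v x\<bar> \<le> \<tau>"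
      using d(3)[of y x] that by (simp add: dist_norm norm_minus_commute)
  qed
  moreover have "conv \<rho> v x = 0" if m: "mollifier \<epsilon> \<rho>" and "\<epsilon> \<le> d" "norm x \<ge> r + 1" for \<epsilon> \<rho> x
  proof -
    have "\<bar>conv \<rho> v x - 0\<bar> \<le> 0"
    proof (rule mollifier_conv_bound[OF m v1], intro always_eventually allI impI)
      fix y assume "y \<in> ball x \<epsilon>"
      then have "norm y \<ge> r"
        using that d(2) norm_triangle_ineq2[of x y] by (simp add: dist_norm)
      then show "\<bar>v y - 0\<bar> \<le> 0" using v(2) by simp
    qed
    then show ?thesis by simp
  qed
  ultimately show ?thesis using d by blast
qed

lemma conv_measurable:
  assumes "mollifier \<epsilon> \<rho>" "w \<in> Lp_loc 1"
  shows "conv \<rho> w \<in> borel_measurable lebesgue"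
proof (rule continuous_lebesgue_measurable)
  show "continuous_on UNIV (conv \<rho> w)"
    using continuous_conv[OF assms(2) mollifierD(5)[OF assms(1)] mollifierD(3)[OF assms(1)]]
    by (simp add: conv_def[abs_def])
qed

lemma conv_diff:
  assumes m: "mollifier \<epsilon> \<rho>" and w: "w \<in> Lp_loc 1" "v \<in> Lp_loc 1"
  shows "conv \<rho> (\<lambda>x. w x - v x) x = conv \<rho> w x - conv \<rho> v x"
  using conv_integrable[OF w(1) mollifierD(5)[OF m] mollifierD(3)[OF m], where x=x]
    conv_integrable[OF w(2) mollifierD(5)[OF m] mollifierD(3)[OF m], where x=x]
  by (simp add: conv_def left_diff_distrib)

text \<open>For a continuous \<open>v\<close> of compact support near \<open>w\<close>, the error
  splits into the mollification of \<open>w - v\<close>, the error of mollifying \<open>v\<close>,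
  and \<open>v - w\<close>. Contraction bounds the first by the last, and the middle one is
  uniformly small on a ball.\<close>

proposition mollify_Lp:
  fixes w :: "real ^ 'n::finite \<Rightarrow> real"
  assumes w[measurable]: "w \<in> borel_measurable lebesgue" and p: "p \<ge> 1"
    and fin: "(\<integral>\<^sup>+x. ennreal (\<bar>w x\<bar> powr p) \<partial>lebesgue) < \<infinity>"
    and supp: "\<And>x. norm x > r \<Longrightarrow> w x = 0" and \<delta>: "\<delta> > 0"
  shows "\<exists>\<epsilon>\<^sub>0>0. \<forall>\<epsilon> \<rho>. \<epsilon> \<le> \<epsilon>\<^sub>0 \<longrightarrow> mollifier \<epsilon> \<rho> \<longrightarrow>
     (\<integral>\<^sup>+x. ennreal (\<bar>conv \<rho> w x - w x\<bar> powr p) \<partial>lebesgue) \<le> ennreal \<delta>"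
proof -
  \<comment> \<open>The two uses of \<open>nn_integral_powr_add_le\<close> below multiply
    \<open>\<delta>'\<close> by exactly this denominator.\<close>
  define \<delta>' where "\<delta>' = \<delta> / (2 powr p * (1 + 2 powr p * 2))"
  have "1 + 2 powr p * 2 > 0" using powr_gt_zero[of 2 p] by linarith
  then have \<delta>': "\<delta>' > 0" using \<delta> by (simp add: \<delta>'_def)
  obtain v where v: "continuous_on UNIV v" "\<And>x. norm x \<ge> r + 1 \<Longrightarrow> v x = 0"
     "(\<integral>\<^sup>+x. ennreal (\<bar>w x - v x\<bar> powr p) \<partial>lebesgue) \<le> ennreal \<delta>'"
    using Lp_approx_continuous[OF w p fin supp \<delta>'] by blast
  have [measurable]: "v \<in> borel_measurable lebesgue" by (rule continuous_lebesgue_measurable[OF v(1)])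
  define C where "C = measure lebesgue (cball (0 :: real ^ 'n) (r + 2))"
  \<comment> \<open>A uniform error \<open>\<tau>\<close> on a ball of volume \<open>C\<close>
    contributes \<open>\<tau> powr p * C\<close>, which is thereby at most
    \<open>\<delta>'\<close>.\<close>
  define \<tau> where "\<tau> = (\<delta>' / (C + 1)) powr (1 / p)"
  have C: "C \<ge> 0" by (simp add: C_def)
  then have \<tau>: "\<tau> > 0" using \<delta>' by (simp add: \<tau>_def)
  have \<tau>p: "\<tau> powr p * C \<le> \<delta>'"
  proof -
    have "\<tau> powr p * C = \<delta>' * (C / (C + 1))"
      using p \<delta>' C by (simp add: \<tau>_def powr_powr)
    also have "\<dots> \<le> \<delta>' * 1" using \<delta>' C by (intro mult_left_mono) auto
    finally show ?thesis by simp
  qed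
  obtain \<epsilon>\<^sub>0 where \<epsilon>: "\<epsilon>\<^sub>0 > 0"
    "\<And>\<epsilon> \<rho> x. \<epsilon> \<le> \<epsilon>\<^sub>0 \<Longrightarrow> mollifier \<epsilon> \<rho> \<Longrightarrow> \<bar>conv \<rho> v x - v x\<bar> \<le> \<tau>"
    "\<And>\<epsilon> \<rho> x. \<epsilon> \<le> \<epsilon>\<^sub>0 \<Longrightarrow> mollifier \<epsilon> \<rho> \<Longrightarrow> norm x \<ge> r + 1 + 1 \<Longrightarrow> conv \<rho> v x = 0"
    using mollify_uniform[OF v(1,2) \<tau>] by blast
  have wp: "w \<in> Lp_loc p" by (rule Lp_locI_nn_integral[OF w fin])
  have wvp: "(\<lambda>x. w x - v x) \<in> Lp_loc p"
    by (rule Lp_locI_nn_integral) (use v(3) in \<open>auto intro: le_less_trans\<close>)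
  have w1: "w \<in> Lp_loc 1" using Lp_loc_mono[OF wp] p by simp
  have wv1: "(\<lambda>x. w x - v x) \<in> Lp_loc 1" using Lp_loc_mono[OF wvp] p by simp
  have v1: "v \<in> Lp_loc 1" by (rule continuous_compact_support_Lp_loc[OF v(1,2)])
  have "(\<integral>\<^sup>+x. ennreal (\<bar>conv \<rho> w x - w x\<bar> powr p) \<partial>lebesgue) \<le> ennreal \<delta>"
    if e: "\<epsilon> \<le> \<epsilon>\<^sub>0" and m: "mollifier \<epsilon> \<rho>" for \<epsilon> \<rho>
  proof -
    note [measurable] = conv_measurable[OF m w1] conv_measurable[OF m v1] conv_measurable[OF m wv1]
    have "(\<integral>\<^sup>+x. ennreal (\<bar>conv \<rho> v x - v x\<bar> powr p) \<partial>lebesgue)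
      \<le> (\<integral>\<^sup>+x. ennreal (\<tau> powr p) * indicator (cball (0 :: real ^ 'n) (r + 2)) x \<partial>lebesgue)"
    proof (intro nn_integral_mono)
      fix x :: "real ^ 'n"
      show "ennreal (\<bar>conv \<rho> v x - v x\<bar> powr p) \<le> ennreal (\<tau> powr p) * indicator (cball 0 (r + 2)) x"
      proof (cases "norm x \<le> r + 2")
        case True
        then show ?thesis using powr_mono2[OF _ _ \<epsilon>(2)[OF e m, of x], of p] p by (simp add: ennreal_leI)
      next
        case False
        then show ?thesis using \<epsilon>(3)[OF e m, of x] v(2)[of x] by simp
      qed
    qed
    also have "\<dots> = ennreal (\<tau> powr p) * ennreal C"
      using fmeasurableD2[OF lmeasurable_cball[of "0 :: real ^ 'n" "r + 2"]]
      by (subst nn_integral_cmult_indicator) (auto simp: C_def emeasure_eq_measure2)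
    also have "\<dots> \<le> ennreal \<delta>'"
      using \<tau>p C by (simp add: ennreal_mult[symmetric] ennreal_leI)
    finally have 1: "(\<integral>\<^sup>+x. ennreal (\<bar>conv \<rho> v x - v x\<bar> powr p) \<partial>lebesgue) \<le> ennreal \<delta>'" .
    have 2: "(\<integral>\<^sup>+x. ennreal (\<bar>conv \<rho> (\<lambda>x. w x - v x) x\<bar> powr p) \<partial>lebesgue) \<le> ennreal \<delta>'"
      using mollifier_Lp_contraction[OF m p wvp] v(3) by (rule order_trans)
    have 3: "(\<integral>\<^sup>+x. ennreal (\<bar>(conv \<rho> v x - v x) + - (w x - v x)\<bar> powr p) \<partial>lebesgue) \<le> ennreal (2 powr p * (\<delta>' + \<delta>'))"
      by (rule nn_integral_powr_add_le[where a="\<lambda>x. conv \<rho> v x - v x" and b="\<lambda>x. w x - v x"])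
         (use p 1 v(3) \<delta>' in \<open>auto simp: less_imp_le\<close>)
    have "(\<integral>\<^sup>+x. ennreal (\<bar>conv \<rho> w x - w x\<bar> powr p) \<partial>lebesgue) \<le> ennreal (2 powr p * (\<delta>' + 2 powr p * (\<delta>' + \<delta>')))"
    proof (rule nn_integral_powr_add_le[where a="conv \<rho> (\<lambda>x. w x - v x)" and b="\<lambda>x. (conv \<rho> v x - v x) + - (w x - v x)"])
      show "\<bar>conv \<rho> w x - w x\<bar> \<le> \<bar>conv \<rho> (\<lambda>x. w x - v x) x\<bar> + \<bar>conv \<rho> v x - v x + - (w x - v x)\<bar>" for x
        using conv_diff[OF m w1 v1, of x] by linarith
    qed (use p 2 3 \<delta>' in auto)
    also have "2 powr p * (\<delta>' + 2 powr p * (\<delta>' + \<delta>')) = \<delta>' * (2 powr p * (1 + 2 powr p * 2))"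
      by (simp add: algebra_simps)
    also have "\<dots> = \<delta>"
      using \<open>1 + 2 powr p * 2 > 0\<close> unfolding \<delta>'_def by (simp del: distrib_left)
    finally show ?thesis .
  qed
  then show ?thesis using \<epsilon>(1) by blast
qed

section \<open>Weak gradients\<close>

lemma GDERIV_reflect:
  assumes "GDERIV \<psi> (x - y) :> d"
  shows "GDERIV (\<lambda>y. \<psi> (x - y)) y :> - d"
proof -
  have "((\<lambda>y. x - y) has_derivative (\<lambda>h. - h)) (at y)"
    by (auto intro!: derivative_eq_intros)
  from has_derivative_compose[OF this, of \<psi> "\<lambda>h. h \<bullet> d"] assms show ?thesis
    by (simp add: gderiv_def)
qed

lemma Cc_infinity_reflect:
  fixes \<phi> :: "real ^ 'n::finite \<Rightarrow> real"
  assumes \<phi>: "\<phi> \<in> Cc_infinity"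
  shows "(\<lambda>y. \<phi> (x - y)) \<in> Cc_infinity"
proof -
  \<comment> \<open>The scalars \<open>c\<close> are part of the class because each derivative of
    the reflected function produces a factor \<open>- 1\<close>.\<close>
  define \<F> where "\<F> = {\<lambda>y. c * \<psi> (x - y) | c \<psi>. \<psi> \<in> (Cc_infinity :: (real ^ 'n \<Rightarrow> real) set)}"
  have *: "(\<lambda>y. 1 * \<phi> (x - y)) \<in> \<F>" unfolding \<F>_def using \<phi> by blast
  have G: "GDERIV (\<lambda>y. c * \<psi> (x - y)) y :> (- c) *\<^sub>R grad \<psi> (x - y)" if "\<psi> \<in> Cc_infinity" for c \<psi> y
  proof -
    have "GDERIV (\<lambda>y. \<psi> (x - y)) y :> - grad \<psi> (x - y)"
      using Cc_infinity_C1_gradient[OF that] by (intro GDERIV_reflect) (simp add: C1_gradient_def)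
    from GDERIV_mult[OF GDERIV_const[of c] this] show ?thesis by simp
  qed
  have "Ck_on k UNIV (\<lambda>y. 1 * \<phi> (x - y))" for k
    using *
  proof (rule Ck_on_closed_class)
    fix F y v assume "F \<in> \<F>"
    then obtain c \<psi> where \<psi>: "\<psi> \<in> Cc_infinity" and F: "F = (\<lambda>y. c * \<psi> (x - y))"
      unfolding \<F>_def by blast
    show "F differentiable (at y)" unfolding F by (rule GDERIV_differentiable[OF G[OF \<psi>]])
    have "frechet_derivative \<psi> (at z) v = v \<bullet> grad \<psi> z" for z
      using Cc_infinity_C1_gradient[OF \<psi>] by (simp add: C1_gradient_def GDERIV_frechet_derivative)
    then have "(\<lambda>y. frechet_derivative F (at y) v) = (\<lambda>y. (- c) * (\<lambda>z. frechet_derivative \<psi> (at z) v) (x - y))"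
      unfolding F by (auto simp: GDERIV_frechet_derivative[OF G[OF \<psi>]])
    then show "(\<lambda>y. frechet_derivative F (at y) v) \<in> \<F>"
      unfolding \<F>_def mem_Collect_eq
      by (intro exI[of _ "- c"] exI[of _ "\<lambda>z. frechet_derivative \<psi> (at z) v"] conjI
          Cc_infinity_frechet_derivative[OF \<psi>]) simp
  qed
  moreover have "compact_support (\<lambda>y. \<phi> (x - y))"
  proof -
    obtain r where r: "\<And>x. norm x \<ge> r \<Longrightarrow> \<phi> x = 0"
      using \<phi> compact_supportE unfolding Cc_infinity_def by blast
    have "\<phi> (x - y) = 0" if "norm y \<ge> r + norm x" for y
      using that norm_triangle_ineq2[of y x] by (intro r) (simp add: norm_minus_commute)
    then show ?thesis by (auto simp: compact_support_cball_iff)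
  qed
  ultimately show ?thesis by (simp add: Cc_infinity_def)
qed

text \<open>For fixed \<open>x\<close> the reflected kernel \<open>\<rho> (x - y)\<close> is itself
  a test function in the definition of the weak gradient. The minus sign of the reflection cancels
  the one from integration by parts.\<close>

lemma weak_grad_conv:
  assumes wg: "is_weak_grad u G" and m: "mollifier \<epsilon> \<rho>"
  shows "C1_gradient (conv \<rho> u) (\<lambda>x. \<chi> i. conv \<rho> (\<lambda>y. G y $ i) x)"
proof -
  have u: "u \<in> Lp_loc 1" using wg by (simp add: is_weak_grad_def)
  note g = Cc_infinity_C1_gradient[OF mollifierD(1)[OF m]]
  have "(\<integral>y. u y *\<^sub>R grad \<rho> (x - y) \<partial>lebesgue) $ i = conv \<rho> (\<lambda>y. G y $ i) x" for x i
  proof -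
    define \<phi> where "\<phi> y = \<rho> (x - y)" for y
    have \<phi>: "\<phi> \<in> Cc_infinity" unfolding \<phi>_def[abs_def] by (rule Cc_infinity_reflect[OF mollifierD(1)[OF m]])
    have "pd i \<phi> y = - (grad \<rho> (x - y) $ i)" for y
    proof -
      have "GDERIV \<phi> y :> - grad \<rho> (x - y)"
        unfolding \<phi>_def[abs_def] using g by (intro GDERIV_reflect) (simp add: C1_gradient_def)
      then show ?thesis by (simp add: GDERIV_pd)
    qed
    moreover have "(\<integral>y. u y * pd i \<phi> y \<partial>lebesgue) = - (\<integral>y. G y $ i * \<phi> y \<partial>lebesgue)"
      using wg \<phi> unfolding is_weak_grad_def by blast
    ultimately have "(\<integral>y. u y * - (grad \<rho> (x - y) $ i) \<partial>lebesgue) = - (\<integral>y. G y $ i * \<rho> (x - y) \<partial>lebesgue)"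
      by (simp only: \<phi>_def)
    then show ?thesis
      using C1_gradient_conv_nth[OF u g mollifierD(3)[OF m], where x=x and i=i] by (simp add: conv_def)
  qed
  then have "(\<integral>y. u y *\<^sub>R grad \<rho> (x - y) \<partial>lebesgue) = (\<chi> i. conv \<rho> (\<lambda>y. G y $ i) x)" for x
    by (simp add: vec_eq_iff)
  then show ?thesis using C1_gradient_conv[OF u g mollifierD(3)[OF m]] by simp
qed

lemma Lp_loc_nth:
  assumes "G \<in> Lp_loc p" "p \<ge> 0"
  shows "(\<lambda>y. G y $ i) \<in> Lp_loc p"
proof -
  have [measurable]: "G \<in> borel_measurable lebesgue" using assms by (simp add: Lp_loc_def)
  have [measurable]: "(\<lambda>y. G y $ i) \<in> borel_measurable lebesgue"
    by (rule measurable_compose[of G lebesgue borel])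
       (simp_all add: borel_measurable_continuous_onI continuous_on_component)
  have "set_integrable lebesgue K (\<lambda>x. norm (G x $ i) powr p)" if K: "compact K" for K
  proof -
    have [measurable]: "K \<in> sets lebesgue" using K by (simp add: borel_compact)
    have *: "integrable lebesgue (\<lambda>x. indicator K x *\<^sub>R (norm (G x) powr p))"
      using assms K by (simp add: Lp_loc_def set_integrable_def)
    show ?thesis unfolding set_integrable_def
      by (rule Bochner_Integration.integrable_bound[OF *])
         (use assms(2) in \<open>auto simp: indicator_def intro!: always_eventually powr_mono2 Finite_Cartesian_Product.norm_nth_le\<close>)
  qed
  then show ?thesis by (simp add: Lp_loc_def)
qed

lemma Lp_loc_cutoff:
  fixes w :: "real ^ 'n::finite \<Rightarrow> real"
  assumes w: "w \<in> Lp_loc p"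
  shows "(\<lambda>x. indicator (cball 0 r) x * w x) \<in> borel_measurable lebesgue" (is ?A)
    "(\<integral>\<^sup>+x. ennreal (\<bar>indicator (cball 0 r) x * w x\<bar> powr p) \<partial>lebesgue) < \<infinity>" (is ?B)
proof -
  have [measurable]: "w \<in> borel_measurable lebesgue" using w by (simp add: Lp_loc_def)
  have [measurable]: "cball (0 :: real ^ 'n) r \<in> sets lebesgue" by simp
  show ?A by measurable
  have *: "integrable lebesgue (\<lambda>x. indicator (cball 0 r) x *\<^sub>R (norm (w x) powr p))"
    using w by (simp add: Lp_loc_def set_integrable_def)
  have "\<bar>indicator (cball 0 r) x * w x\<bar> powr p = norm (indicator (cball 0 r) x *\<^sub>R (norm (w x) powr p))" for x :: "real ^ 'n"
    by (simp add: indicator_def)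
  then show ?B using * by (simp only: integrable_iff_bounded)
qed

text \<open>A kernel of radius at most 1 sees only the ball one unit larger. This carries the global
  L^p statements over to functions that are only locally in L^p.\<close>

lemma conv_cutoff:
  assumes m: "mollifier \<epsilon> \<rho>" and "\<epsilon> \<le> 1" "norm x \<le> r"
  shows "conv \<rho> (\<lambda>y. indicator (cball 0 (r + 1)) y * w y) x = conv \<rho> w x"
proof -
  have "indicator (cball 0 (r + 1)) y * w y * \<rho> (x - y) = w y * \<rho> (x - y)" for y
  proof (cases "norm (x - y) \<ge> \<epsilon>")
    case True
    then show ?thesis using mollifierD(3)[OF m] by simp
  next
    case False
    then have "norm y \<le> r + 1"
      using assms norm_triangle_sub[of y x] by (simp add: norm_minus_commute)
    then show ?thesis by simp
  qed
  then show ?thesis unfolding conv_def by (simp only:)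
qed

text \<open>One kernel has to serve finitely many functions at once, since a function and all
  components of its gradient must be mollified together.\<close>

lemma mollifier_exists_Lp_close:
  fixes W :: "'i::finite \<Rightarrow> real ^ 'n::finite \<Rightarrow> real"
  assumes p: "p \<ge> 1" and W: "\<And>i. W i \<in> Lp_loc p" and \<delta>: "\<delta> > 0"
  shows "\<exists>\<epsilon> \<rho>. mollifier \<epsilon> \<rho> \<and> \<epsilon> \<le> 1 \<and>
    (\<forall>i. (\<integral>\<^sup>+x. ennreal (\<bar>conv \<rho> (\<lambda>y. indicator (cball 0 r) y * W i y) x - indicator (cball 0 r) x * W i x\<bar> powr p) \<partial>lebesgue) \<le> ennreal \<delta>)"
proof -
  define P where "P i \<epsilon>\<^sub>0 \<longleftrightarrow> \<epsilon>\<^sub>0 > 0 \<and> (\<forall>\<epsilon> \<rho>. \<epsilon> \<le> \<epsilon>\<^sub>0 \<longrightarrow> mollifier \<epsilon> \<rho> \<longrightarrow>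
    (\<integral>\<^sup>+x. ennreal (\<bar>conv \<rho> (\<lambda>y. indicator (cball 0 r) y * W i y) x - indicator (cball 0 r) x * W i x\<bar> powr p) \<partial>lebesgue) \<le> ennreal \<delta>)" for i \<epsilon>\<^sub>0
  have "\<exists>\<epsilon>\<^sub>0. P i \<epsilon>\<^sub>0" for i
    unfolding P_def using Lp_loc_cutoff[OF W] by (intro mollify_Lp[where r=r] p \<delta>) auto
  then obtain e where "\<And>i. P i (e i)" by metis
  then have e: "\<And>i. e i > 0" "\<And>i \<epsilon> \<rho>. \<epsilon> \<le> e i \<Longrightarrow> mollifier \<epsilon> \<rho> \<Longrightarrow>
    (\<integral>\<^sup>+x. ennreal (\<bar>conv \<rho> (\<lambda>y. indicator (cball 0 r) y * W i y) x - indicator (cball 0 r) x * W i x\<bar> powr p) \<partial>lebesgue) \<le> ennreal \<delta>"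
    unfolding P_def by blast+
  define \<epsilon> where "\<epsilon> = min 1 (Min (range e))"
  have \<epsilon>: "\<epsilon> > 0" "\<epsilon> \<le> 1" using e(1) by (auto simp: \<epsilon>_def)
  have le: "\<epsilon> \<le> e i" for i by (auto simp: \<epsilon>_def min.coboundedI2)
  obtain \<rho> :: "real ^ 'n \<Rightarrow> real" where "mollifier \<epsilon> \<rho>" using mollifier_exists[OF \<epsilon>(1)] by blast
  then show ?thesis using e(2)[OF le] \<epsilon>(2) by blast
qed

text \<open>Mollifications converge to \<open>w\<close> in L^1 on every ball, so if all of them
  vanish the L^1 norm of \<open>w\<close> there is below every \<open>\<delta>\<close>.\<close>

lemma conv_zero_imp_AE_zero:
  fixes w :: "real ^ 'n::finite \<Rightarrow> real"
  assumes w: "w \<in> Lp_loc 1" and zero: "\<And>\<epsilon> \<rho> x. mollifier \<epsilon> \<rho> \<Longrightarrow> conv \<rho> w x = 0"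
  shows "AE x in lebesgue. w x = 0"
proof -
  have [measurable]: "w \<in> borel_measurable lebesgue" using w by (simp add: Lp_loc_def)
  have [measurable]: "cball (0 :: real ^ 'n) r \<in> sets lebesgue" for r by simp
  have ball: "AE x in lebesgue. norm x \<le> r \<longrightarrow> w x = 0" for r
  proof -
    have "(\<integral>\<^sup>+x. ennreal \<bar>indicator (cball 0 r) x * w x\<bar> \<partial>lebesgue) \<le> ennreal \<delta>" if \<delta>: "\<delta> > 0" for \<delta>
    proof -
      obtain \<epsilon> \<rho> where m: "mollifier \<epsilon> \<rho>" "\<epsilon> \<le> 1"
        and le: "(\<integral>\<^sup>+x. ennreal (\<bar>conv \<rho> (\<lambda>y. indicator (cball 0 (r + 1)) y * w y) x - indicator (cball 0 (r + 1)) x * w x\<bar> powr 1) \<partial>lebesgue) \<le> ennreal \<delta>"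
        using mollifier_exists_Lp_close[where W="\<lambda>i::unit. w" and p=1 and r="r + 1" and \<delta>=\<delta>] w \<delta> by auto
      have "\<bar>indicator (cball 0 r) x * w x\<bar> \<le>
        \<bar>conv \<rho> (\<lambda>y. indicator (cball 0 (r + 1)) y * w y) x - indicator (cball 0 (r + 1)) x * w x\<bar> powr 1" for x
        using conv_cutoff[OF m, of x r w] zero[OF m(1), of x] by (auto simp: indicator_def)
      then show ?thesis
        by (intro order_trans[OF _ le] nn_integral_mono ennreal_leI)
    qed
    then have "(\<integral>\<^sup>+x. ennreal \<bar>indicator (cball 0 r) x * w x\<bar> \<partial>lebesgue) = 0"
      by (intro antisym[OF ennreal_le_epsilon]) auto
    then have "AE x in lebesgue. ennreal \<bar>indicator (cball 0 r) x * w x\<bar> = 0"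
      by (subst (asm) nn_integral_0_iff_AE) auto
    then show ?thesis by eventually_elim (auto simp: indicator_def)
  qed
  have "AE x in lebesgue. \<forall>k::nat. norm x \<le> real k \<longrightarrow> w x = 0"
    unfolding AE_all_countable using ball by blast
  then show ?thesis by eventually_elim (use real_arch_simple in blast)
qed

text \<open>A mollification of \<open>u\<close> is classically differentiable, and its gradient is
  the mollification of any weak gradient. Hence two weak gradients have the same
  mollifications.\<close>

lemma weak_grad_unique:
  assumes "is_weak_grad u G" "is_weak_grad u G'"
  shows "AE x in lebesgue. G x = G' x"
proof -
  have G: "(\<lambda>y. G y $ i) \<in> Lp_loc 1" "(\<lambda>y. G' y $ i) \<in> Lp_loc 1" for i
    using assms by (auto simp: is_weak_grad_def intro: Lp_loc_nth)
  have [measurable]: "(\<lambda>y. G y $ i) \<in> borel_measurable lebesgue" "(\<lambda>y. G' y $ i) \<in> borel_measurable lebesgue" for i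
    using G Lp_loc_measurable by blast+
  have "AE x in lebesgue. G x $ i - G' x $ i = 0" for i
  proof (rule conv_zero_imp_AE_zero)
    have "set_integrable lebesgue K (\<lambda>x. norm (G x $ i - G' x $ i) powr 1)" if K: "compact K" for K
    proof -
      have "integrable lebesgue (\<lambda>x. indicator K x *\<^sub>R (G x $ i) - indicator K x *\<^sub>R (G' x $ i))"
        using Lp_loc_1_integrable[OF G(1) K] Lp_loc_1_integrable[OF G(2) K] by simp
      then have "integrable lebesgue (\<lambda>x. norm (indicator K x *\<^sub>R (G x $ i) - indicator K x *\<^sub>R (G' x $ i)))"
        by (rule integrable_norm)
      moreover have "norm (indicator K x *\<^sub>R (G x $ i) - indicator K x *\<^sub>R (G' x $ i)) = indicator K x *\<^sub>R norm (G x $ i - G' x $ i) powr 1" for x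
        by (simp add: indicator_def)
      ultimately show ?thesis by (simp only: set_integrable_def)
    qed
    then show "(\<lambda>x. G x $ i - G' x $ i) \<in> Lp_loc 1" by (simp add: Lp_loc_def)
  next
    fix \<epsilon> \<rho> x assume m: "mollifier \<epsilon> (\<rho> :: real ^ 'a \<Rightarrow> real)"
    have "(\<chi> i. conv \<rho> (\<lambda>y. G y $ i) x) = (\<chi> i. conv \<rho> (\<lambda>y. G' y $ i) x)"
      using C1_gradient_grad[OF weak_grad_conv[OF assms(1) m]] C1_gradient_grad[OF weak_grad_conv[OF assms(2) m]] by metis
    then have "conv \<rho> (\<lambda>y. G y $ i) x = conv \<rho> (\<lambda>y. G' y $ i) x" by (simp add: vec_eq_iff)
    then show "conv \<rho> (\<lambda>x. G x $ i - G' x $ i) x = 0" using conv_diff[OF m G] by simp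
  qed
  then have "AE x in lebesgue. \<forall>i\<in>UNIV. G x $ i - G' x $ i = 0" by (intro AE_finite_allI) auto
  then show ?thesis by eventually_elim (simp add: vec_eq_iff)
qed

text \<open>The choice operator in \<open>weak_grad\<close> promises only local integrability.
  Uniqueness transfers the p-th power bound from the gradient that membership in
  \<open>W1p_loc\<close> supplies.\<close>

lemma W1p_loc_weak_grad:
  assumes "u \<in> W1p_loc p"
  shows "is_weak_grad u (weak_grad u)" "weak_grad u \<in> Lp_loc p"
proof -
  obtain G where G: "G \<in> Lp_loc p" "is_weak_grad u G" using assms by (auto simp: W1p_loc_def)
  show wg: "is_weak_grad u (weak_grad u)" using someI[of "is_weak_grad u", OF G(2)] by (simp add: weak_grad_def)
  have m[measurable]: "weak_grad u \<in> borel_measurable lebesgue" "G \<in> borel_measurable lebesgue"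
    using wg G by (auto simp: is_weak_grad_def Lp_loc_def)
  have ae: "AE x in lebesgue. G x = weak_grad u x" by (rule weak_grad_unique[OF G(2) wg])
  have "set_integrable lebesgue K (\<lambda>x. norm (weak_grad u x) powr p)" if K: "compact K" for K
  proof -
    have [measurable]: "K \<in> sets lebesgue" using K by (simp add: borel_compact)
    have "integrable lebesgue (\<lambda>x. indicator K x *\<^sub>R norm (G x) powr p)"
      using G K by (simp add: Lp_loc_def set_integrable_def)
    then show ?thesis unfolding set_integrable_def
      by (rule integrable_cong_AE_imp) (measurable, use ae in \<open>auto elim: eventually_mono\<close>)
  qed
  then show "weak_grad u \<in> Lp_loc p" using m by (simp add: Lp_loc_def)
qed

section \<open>Approximation almost everywhere with an L^p majorant\<close>

lemma tendsto_zero_powrD: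
  fixes a :: "nat \<Rightarrow> real"
  assumes "p > 0" "(\<lambda>k. \<bar>a k\<bar> powr p) \<longlonglongrightarrow> 0"
  shows "a \<longlonglongrightarrow> 0"
proof -
  have "(\<lambda>k. (\<bar>a k\<bar> powr p) powr (1 / p)) \<longlonglongrightarrow> 0 powr (1 / p)"
    using assms by (intro tendsto_powr2) auto
  then have "(\<lambda>k. \<bar>a k\<bar>) \<longlonglongrightarrow> 0" using assms(1) by (simp add: powr_powr)
  then show ?thesis by (simp add: tendsto_rabs_zero_iff)
qed

text \<open>Choosing the \<open>k\<close>-th mollification \<open>2\<^sup>-\<^sup>k\<close>-close in \<open>L\<^sup>p\<close> makes the sum over \<open>k\<close> of
  the \<open>p\<close>-th powers of the errors integrable. Its finiteness gives convergence almost everywhere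
  and an \<open>L\<^sup>p\<close> majorant at the same time.\<close>

proposition Sobolev_approximation:
  fixes u :: "real ^ 'n::finite \<Rightarrow> real"
  assumes p: "p \<ge> 1" and u: "u \<in> Lp_loc p" and G: "G \<in> Lp_loc p" and wg: "is_weak_grad u G"
    and B: "AE x in lebesgue. x \<in> cball 0 (r + 1) \<longrightarrow> \<bar>u x\<bar> \<le> B"
  obtains v D S where "\<And>k. C1_gradient (v k) (D k)" "\<And>k x. norm x \<le> r \<Longrightarrow> \<bar>v k x\<bar> \<le> B"
    "S \<in> borel_measurable lebesgue" "\<And>x. S x \<ge> 1"
    "integrable lebesgue (\<lambda>x. indicator (cball 0 r) x * S x powr p)"
    "AE x in lebesgue. norm x \<le> r \<longrightarrow> (\<lambda>k::nat. v k x) \<longlonglongrightarrow> u x \<and> (\<lambda>k. D k x) \<longlonglongrightarrow> G x \<and>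
       norm (G x) \<le> S x \<and> (\<forall>k. norm (D k x) \<le> S x)"
proof -
  \<comment> \<open>The index \<open>None\<close> stands for \<open>u\<close> and
    \<open>Some j\<close> for the \<open>j\<close>-th component of \<open>G\<close>, so that one
    kernel treats them all.\<close>
  define W where "W i = (case i of None \<Rightarrow> u | Some j \<Rightarrow> (\<lambda>y. G y $ j))" for i :: "'n option"
  have W: "W i \<in> Lp_loc p" for i
    using u Lp_loc_nth[OF G] p by (auto simp: W_def split: option.split)
  have W1: "W i \<in> Lp_loc 1" for i using Lp_loc_mono[OF W] p by simp
  note Gm[measurable] = Lp_loc_measurable[OF G]
  define I where "I = (\<lambda>x :: real ^ 'n. indicator (cball 0 (r + 1)) x :: real)"
  define P where "P k \<epsilon> \<rho> \<longleftrightarrow> mollifier \<epsilon> \<rho> \<and> \<epsilon> \<le> 1 \<and>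
    (\<forall>i. (\<integral>\<^sup>+x. ennreal (\<bar>conv \<rho> (\<lambda>y. I y * W i y) x - I x * W i x\<bar> powr p) \<partial>lebesgue) \<le> ennreal ((1 / 2) ^ k))" for k :: nat and \<epsilon> \<rho>
  have "\<exists>\<epsilon> \<rho>. P k \<epsilon> \<rho>" for k
    unfolding P_def I_def by (intro mollifier_exists_Lp_close p W) simp
  then obtain \<epsilon> \<rho> where "\<And>k. P k (\<epsilon> k) (\<rho> k)" by metis
  then have m: "\<And>k. mollifier (\<epsilon> k) (\<rho> k)" "\<And>k. \<epsilon> k \<le> 1" and
    close: "\<And>k i. (\<integral>\<^sup>+x. ennreal (\<bar>conv (\<rho> k) (\<lambda>y. I y * W i y) x - I x * W i x\<bar> powr p) \<partial>lebesgue) \<le> ennreal ((1 / 2) ^ k)"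
    unfolding P_def by blast+
  define T where "T k i x = \<bar>conv (\<rho> k) (\<lambda>y. I y * W i y) x - I x * W i x\<bar> powr p" for k i x
  have IW: "(\<lambda>y. I y * W i y) \<in> Lp_loc p" for i
    unfolding I_def using Lp_loc_cutoff[OF W] by (intro Lp_locI_nn_integral) auto
  have IW1: "(\<lambda>y. I y * W i y) \<in> Lp_loc 1" for i using Lp_loc_mono[OF IW] p by simp
  have [measurable]: "(\<lambda>y. I y * W i y) \<in> borel_measurable lebesgue" for i
    by (rule Lp_loc_measurable[OF IW])
  have [measurable]: "T k i \<in> borel_measurable lebesgue" for k i
    unfolding T_def[abs_def] using conv_measurable[OF m(1) IW1] by measurable
  define F where "F x = (\<Sum>k. ennreal (\<Sum>i\<in>UNIV. T k i x))" for x
  have [measurable]: "F \<in> borel_measurable lebesgue" unfolding F_def[abs_def] by measurable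
  have T0: "T k i x \<ge> 0" for k i x by (simp add: T_def)
  have "(\<integral>\<^sup>+x. F x \<partial>lebesgue) = (\<Sum>k. \<integral>\<^sup>+x. ennreal (\<Sum>i\<in>UNIV. T k i x) \<partial>lebesgue)"
    unfolding F_def by (rule nn_integral_suminf) measurable
  also have "\<dots> \<le> (\<Sum>k. ennreal (real CARD('n option) * (1 / 2) ^ k))"
  proof (intro suminf_le)
    fix k
    have "(\<integral>\<^sup>+x. ennreal (\<Sum>i\<in>UNIV. T k i x) \<partial>lebesgue) = (\<Sum>i\<in>UNIV. \<integral>\<^sup>+x. ennreal (T k i x) \<partial>lebesgue)"
      by (subst nn_integral_sum[symmetric]) (simp_all add: T0)
    also have "\<dots> \<le> (\<Sum>i\<in>(UNIV :: 'n option set). ennreal ((1 / 2) ^ k))"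
      using close unfolding T_def by (intro sum_mono)
    also have "\<dots> = ennreal (real CARD('n option) * (1 / 2) ^ k)"
      by (simp add: ennreal_mult ennreal_of_nat_eq_real_of_nat del: card_option)
    finally show "(\<integral>\<^sup>+x. ennreal (\<Sum>i\<in>UNIV. T k i x) \<partial>lebesgue) \<le> ennreal (real CARD('n option) * (1 / 2) ^ k)" .
  qed auto
  also have "\<dots> = ennreal (real CARD('n option) * 2)"
    by (intro suminf_ennreal_eq sums_mult) (use power_half_series geometric_sums[of "1 / 2 :: real"] in auto)
  finally have Fint: "(\<integral>\<^sup>+x. F x \<partial>lebesgue) < \<infinity>" by (simp add: le_less_trans)
  then have Ffin: "AE x in lebesgue. F x \<noteq> \<infinity>"
    by (intro nn_integral_PInf_AE) auto
  have TF: "T k i x \<le> enn2real (F x)" "(\<lambda>k. T k i x) \<longlonglongrightarrow> 0" if "F x \<noteq> \<infinity>" for k i x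
  proof -
    have Ts: "T k i x \<le> (\<Sum>i\<in>UNIV. T k i x)" for k i by (rule member_le_sum) (auto simp: T0)
    have "ennreal (\<Sum>i\<in>UNIV. T k i x) \<le> F x"
      unfolding F_def using sum_le_suminf[of "\<lambda>k. ennreal (\<Sum>i\<in>UNIV. T k i x)" "{k}"] by simp
    then have "ennreal (T k i x) \<le> F x" using Ts by (meson ennreal_leI order_trans)
    then have "enn2real (ennreal (T k i x)) \<le> enn2real (F x)"
      using that by (intro enn2real_mono) (auto simp: less_top)
    then show "T k i x \<le> enn2real (F x)" using T0 by simp
    have "summable (\<lambda>k. \<Sum>i\<in>UNIV. T k i x)"
      using that by (intro summable_suminf_not_top) (auto simp: F_def T0 sum_nonneg)
    then have *: "(\<lambda>k. \<Sum>i\<in>UNIV. T k i x) \<longlonglongrightarrow> 0" by (rule summable_LIMSEQ_zero)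
    show "(\<lambda>k. T k i x) \<longlonglongrightarrow> 0"
      by (rule real_tendsto_sandwich[OF _ _ tendsto_const *]) (auto simp: T0 Ts)
  qed
  define N where "N = real CARD('n)"
  \<comment> \<open>Each component of \<open>D k x - G x\<close> is at most the p-th root of
    \<open>F x\<close>, which explains the factor \<open>N\<close>. The summand 1 lets lower powers
    of \<open>S\<close> be bounded by \<open>S powr p\<close>. On the null set where
    \<open>F\<close> is infinite, \<open>enn2real\<close> returns 0.\<close>
  define S where "S x = 1 + (norm (G x) + N * enn2real (F x) powr (1 / p))" for x
  have N0: "N \<ge> 0" by (simp add: N_def)
  have [measurable]: "S \<in> borel_measurable lebesgue" unfolding S_def[abs_def] by measurable
  define v where "v k = conv (\<rho> k) u" for k
  define D where "D k x = (\<chi> i. conv (\<rho> k) (\<lambda>y. G y $ i) x)" for k x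
  have cutoff: "conv (\<rho> k) (\<lambda>y. I y * W i y) x - I x * W i x = conv (\<rho> k) (W i) x - W i x"
    if "norm x \<le> r" for k i x
    using conv_cutoff[OF m that] that by (simp add: I_def)
  show thesis
  proof
    show "C1_gradient (v k) (D k)" for k
      unfolding v_def D_def by (rule weak_grad_conv[OF wg m(1)])
    show "\<bar>v k x\<bar> \<le> B" if "norm x \<le> r" for k x
    proof -
      have sub: "ball x (\<epsilon> k) \<subseteq> cball 0 (r + 1)"
      proof
        fix y assume "y \<in> ball x (\<epsilon> k)"
        then show "y \<in> cball 0 (r + 1)"
          using that m(2)[of k] norm_triangle_sub[of y x] by (simp add: dist_norm norm_minus_commute)
      qed
      have "\<bar>conv (\<rho> k) u x - 0\<bar> \<le> B"
        by (rule mollifier_conv_bound[OF m(1)[of k]])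
           (use W1[of None] B sub in \<open>auto simp: W_def elim!: eventually_mono\<close>)
      then show ?thesis by (simp add: v_def)
    qed
    show "S x \<ge> 1" for x using N0 by (simp add: S_def)
    show "integrable lebesgue (\<lambda>x. indicator (cball 0 r) x * S x powr p)"
    proof -
      define c where "c = 2 powr p"
      have i1: "integrable lebesgue (\<lambda>x :: real ^ 'n. indicator (cball 0 r) x :: real)"
        using fmeasurableD2[OF lmeasurable_cball[of "0 :: real ^ 'n" r]]
        by (intro integrable_real_indicator) (auto simp: less_top)
      have i2: "integrable lebesgue (\<lambda>x. indicator (cball 0 r) x * norm (G x) powr p)"
        using G by (simp add: Lp_loc_def set_integrable_def)
      have i3: "integrable lebesgue (\<lambda>x. enn2real (F x))"
      proof (rule integrableI_bounded)
        have "(\<integral>\<^sup>+x. ennreal (norm (enn2real (F x))) \<partial>lebesgue) = (\<integral>\<^sup>+x. F x \<partial>lebesgue)"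
          using Ffin by (intro nn_integral_cong_AE) (auto elim!: eventually_mono simp: less_top)
        then show "(\<integral>\<^sup>+x. ennreal (norm (enn2real (F x))) \<partial>lebesgue) < \<infinity>" using Fint by simp
      qed measurable
      have le: "indicator (cball 0 r) x * S x powr p \<le>
         c * indicator (cball 0 r) x + c * c * (indicator (cball 0 r) x * norm (G x) powr p) + c * c * N powr p * enn2real (F x)" for x
      proof (cases "x \<in> cball 0 r")
        case True
        have "S x powr p \<le> c * (1 powr p + (norm (G x) + N * enn2real (F x) powr (1 / p)) powr p)"
          unfolding S_def c_def using p N0 by (intro powr_add_le) auto
        also have "\<dots> \<le> c * (1 powr p + c * (norm (G x) powr p + (N * enn2real (F x) powr (1 / p)) powr p))"
          unfolding c_def using p N0 by (intro mult_left_mono add_left_mono powr_add_le) auto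
        also have "(N * enn2real (F x) powr (1 / p)) powr p = N powr p * enn2real (F x)"
          using p N0 by (simp add: powr_mult powr_powr)
        finally show ?thesis using True by (simp add: algebra_simps)
      next
        case False
        then show ?thesis by (simp add: c_def)
      qed
      show ?thesis
        by (rule Bochner_Integration.integrable_bound[where
            f="\<lambda>x. c * indicator (cball 0 r) x + c * c * (indicator (cball 0 r) x * norm (G x) powr p) + c * c * N powr p * enn2real (F x)"])
           (use i1 i2 i3 le in \<open>auto intro!: always_eventually order_trans[OF _ abs_ge_self]\<close>)
    qed
    show "AE x in lebesgue. norm x \<le> r \<longrightarrow> (\<lambda>k. v k x) \<longlonglongrightarrow> u x \<and> (\<lambda>k. D k x) \<longlonglongrightarrow> G x \<and>
       norm (G x) \<le> S x \<and> (\<forall>k. norm (D k x) \<le> S x)"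
      using Ffin
    proof eventually_elim
      case (elim x)
      show ?case
      proof (intro impI conjI allI)
        assume x: "norm x \<le> r"
        have Teq: "T k i x = \<bar>conv (\<rho> k) (W i) x - W i x\<bar> powr p" for k i
          by (simp add: T_def cutoff[OF x])
        have lim: "(\<lambda>k. conv (\<rho> k) (W i) x) \<longlonglongrightarrow> W i x" for i
          using tendsto_zero_powrD[of p "\<lambda>k. conv (\<rho> k) (W i) x - W i x"] TF(2)[OF elim, of i] p
          by (simp add: Teq LIM_zero_iff)
        show "(\<lambda>k. v k x) \<longlonglongrightarrow> u x" using lim[of None] by (simp add: v_def W_def)
        show "(\<lambda>k. D k x) \<longlonglongrightarrow> G x"
        proof (rule vec_tendstoI)
          show "(\<lambda>k. D k x $ i) \<longlonglongrightarrow> G x $ i" for i using lim[of "Some i"] by (simp add: D_def W_def)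
        qed
        show "norm (G x) \<le> S x" using N0 by (simp add: S_def)
        show "norm (D k x) \<le> S x" for k
        proof -
          have "\<bar>(D k x - G x) $ i\<bar> \<le> enn2real (F x) powr (1 / p)" for i
          proof -
            have "(\<bar>(D k x - G x) $ i\<bar> powr p) powr (1 / p) \<le> enn2real (F x) powr (1 / p)"
              using TF(1)[OF elim, of k "Some i"] p by (intro powr_mono2) (auto simp: Teq D_def W_def)
            then show ?thesis using p by (simp add: powr_powr)
          qed
          then have "norm (D k x - G x) \<le> (\<Sum>i\<in>(UNIV :: 'n set). enn2real (F x) powr (1 / p))"
            by (intro order_trans[OF norm_le_l1_cart] sum_mono)
          then have "norm (D k x - G x) \<le> N * enn2real (F x) powr (1 / p)" by (simp add: N_def)
          then show ?thesis using norm_triangle_sub[of "D k x" "G x"] by (simp add: S_def)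
        qed
      qed
    qed
  qed measurable
qed

section \<open>Weak equations tested with C^1 functions\<close>

lemma conv_commute:
  fixes a b :: "real ^ 'n::finite \<Rightarrow> real"
  assumes "continuous_on UNIV a" "continuous_on UNIV b"
  shows "conv a b = conv b a"
proof
  fix x
  have [measurable]: "a \<in> borel_measurable borel" "b \<in> borel_measurable borel"
    using assms by (auto intro: borel_measurable_continuous_onI)
  have "conv a b x = (\<integral>y. b y * a (x - y) \<partial>lborel)"
    unfolding conv_def by (rule integral_completion) measurable
  also have "\<dots> = (\<integral>y. b (x - y) * a (x - (x - y)) \<partial>lborel)"
    by (rule integral_lborel_reflect[symmetric]) measurable
  also have "\<dots> = conv b a x"
    unfolding conv_def by (subst integral_completion) (auto simp: mult.commute)
  finally show "conv a b x = conv b a x" .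
qed

text \<open>Commuting the factors makes the derivative fall on \<open>\<phi>\<close> instead of the
  kernel. The gradients of the mollifications therefore converge uniformly, like the mollifications
  themselves.\<close>

lemma C1_gradient_mollify:
  assumes m: "mollifier \<epsilon> \<rho>" and \<phi>: "C1_gradient \<phi> D" "\<And>x. norm x \<ge> r \<Longrightarrow> \<phi> x = 0"
  shows "C1_gradient (conv \<rho> \<phi>) (\<lambda>x. \<chi> i. conv \<rho> (\<lambda>y. D y $ i) x)"
proof -
  note c = C1_gradient_continuous[OF \<phi>(1)]
  have \<rho>1: "\<rho> \<in> Lp_loc 1"
    by (rule continuous_compact_support_Lp_loc[OF mollifierD(5)[OF m] mollifierD(3)[OF m]])
  have "(\<integral>y. \<rho> y *\<^sub>R D (x - y) \<partial>lebesgue) $ i = conv \<rho> (\<lambda>y. D y $ i) x" for x i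
    using C1_gradient_conv_nth[OF \<rho>1 \<phi>, where x=x and i=i]
      conv_commute[OF mollifierD(5)[OF m], of "\<lambda>y. D y $ i"] c(2)
    by (simp add: continuous_on_component)
  then have "(\<integral>y. \<rho> y *\<^sub>R D (x - y) \<partial>lebesgue) = (\<chi> i. conv \<rho> (\<lambda>y. D y $ i) x)" for x
    by (simp add: vec_eq_iff)
  then show ?thesis
    using C1_gradient_conv[OF \<rho>1 \<phi>] conv_commute[OF mollifierD(5)[OF m] c(1)] by simp
qed

lemma mollifier_exists_uniformly_close:
  fixes W :: "'i::finite \<Rightarrow> real ^ 'n::finite \<Rightarrow> real"
  assumes W: "\<And>i. continuous_on UNIV (W i)" "\<And>i x. norm x \<ge> r \<Longrightarrow> W i x = 0" and \<tau>: "\<tau> > 0"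
  shows "\<exists>\<epsilon> \<rho>. mollifier \<epsilon> \<rho> \<and> (\<forall>i x. \<bar>conv \<rho> (W i) x - W i x\<bar> \<le> \<tau>) \<and>
     (\<forall>i x. norm x \<ge> r + 1 \<longrightarrow> conv \<rho> (W i) x = 0)"
proof -
  define P where "P i e \<longleftrightarrow> e > 0 \<and> e \<le> 1 \<and> (\<forall>\<epsilon> \<rho>. \<epsilon> \<le> e \<longrightarrow> mollifier \<epsilon> \<rho> \<longrightarrow>
     (\<forall>x. \<bar>conv \<rho> (W i) x - W i x\<bar> \<le> \<tau>) \<and> (\<forall>x. norm x \<ge> r + 1 \<longrightarrow> conv \<rho> (W i) x = 0))" for i e
  have "\<exists>e. P i e" for i
    unfolding P_def by (intro mollify_uniform W \<tau>)
  then obtain e where "\<And>i. P i (e i)" by metis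
  then have e: "\<And>i. e i > 0"
    "\<And>i \<epsilon> \<rho> x. \<epsilon> \<le> e i \<Longrightarrow> mollifier \<epsilon> \<rho> \<Longrightarrow> \<bar>conv \<rho> (W i) x - W i x\<bar> \<le> \<tau>"
    "\<And>i \<epsilon> \<rho> x. \<epsilon> \<le> e i \<Longrightarrow> mollifier \<epsilon> \<rho> \<Longrightarrow> norm x \<ge> r + 1 \<Longrightarrow> conv \<rho> (W i) x = 0"
    unfolding P_def by blast+
  define \<epsilon> where "\<epsilon> = Min (range e)"
  have \<epsilon>: "\<epsilon> > 0" using e(1) by (auto simp: \<epsilon>_def)
  have le: "\<epsilon> \<le> e i" for i by (auto simp: \<epsilon>_def)
  obtain \<rho> :: "real ^ 'n \<Rightarrow> real" where "mollifier \<epsilon> \<rho>" using mollifier_exists[OF \<epsilon>] by blast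
  then show ?thesis using e(2,3)[OF le] by blast
qed

text \<open>The test functions used later are only C^1. Mollifying one gives smooth functions
  supported in one ball, converging uniformly together with their gradients; that suffices against
  locally integrable \<open>A\<close> and \<open>F\<close>.\<close>

proposition weak_equation_C1:
  fixes A :: "real ^ 'n::finite \<Rightarrow> real ^ 'n"
  assumes A: "A \<in> Lp_loc 1" and F: "F \<in> Lp_loc 1"
    and eq: "\<And>\<phi>. \<phi> \<in> Cc_infinity \<Longrightarrow> (\<integral>x. A x \<bullet> grad \<phi> x \<partial>lebesgue) = (\<integral>x. F x * \<phi> x \<partial>lebesgue)"
    and \<phi>: "C1_gradient \<phi> D" "\<And>x. norm x \<ge> r \<Longrightarrow> \<phi> x = 0"
  shows "(\<integral>x. A x \<bullet> D x \<partial>lebesgue) = (\<integral>x. F x * \<phi> x \<partial>lebesgue)"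
proof -
  define W where "W i = (case i of None \<Rightarrow> \<phi> | Some j \<Rightarrow> (\<lambda>y. D y $ j))" for i :: "'n option"
  note c = C1_gradient_continuous[OF \<phi>(1)]
  have D0: "D x = 0" if "norm x \<ge> r" for x by (rule C1_gradient_outside_support[OF \<phi> that])
  have W: "continuous_on UNIV (W i)" "\<And>x. norm x \<ge> r \<Longrightarrow> W i x = 0" for i
    using c D0 \<phi>(2) by (auto simp: W_def continuous_on_component split: option.split)
  define P where "P k \<epsilon> \<rho> \<longleftrightarrow> mollifier \<epsilon> \<rho> \<and> (\<forall>i x. \<bar>conv \<rho> (W i) x - W i x\<bar> \<le> 1 / real (Suc k)) \<and>
     (\<forall>i x. norm x \<ge> r + 1 \<longrightarrow> conv \<rho> (W i) x = 0)" for k \<epsilon> \<rho>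
  have "\<exists>\<epsilon> \<rho>. P k \<epsilon> \<rho>" for k
    unfolding P_def by (intro mollifier_exists_uniformly_close W) (simp_all add: divide_pos_pos)
  then obtain \<epsilon> \<rho> where "\<And>k. P k (\<epsilon> k) (\<rho> k)" by metis
  then have m: "\<And>k. mollifier (\<epsilon> k) (\<rho> k)" and
    close: "\<And>k i x. \<bar>conv (\<rho> k) (W i) x - W i x\<bar> \<le> 1 / real (Suc k)" and
    supp: "\<And>k i x. norm x \<ge> r + 1 \<Longrightarrow> conv (\<rho> k) (W i) x = 0" unfolding P_def by blast+
  define v where "v k = conv (\<rho> k) \<phi>" for k
  define Dv where "Dv k x = (\<chi> i. conv (\<rho> k) (\<lambda>y. D y $ i) x)" for k x
  have v: "C1_gradient (v k) (Dv k)" for k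
    unfolding v_def Dv_def by (rule C1_gradient_mollify[OF m \<phi>])
  have vCc: "v k \<in> Cc_infinity" for k
  proof -
    have "\<phi> \<in> Lp_loc 1" by (rule continuous_compact_support_Lp_loc[OF c(1) \<phi>(2)])
    then have "Ck_on j UNIV (v k)" for j
      unfolding v_def by (rule conv_Ck_on[OF _ mollifierD(1)[OF m]])
    moreover have "compact_support (v k)"
      using supp[of _ k None] unfolding compact_support_cball_iff by (auto simp: v_def W_def)
    ultimately show ?thesis by (simp add: Cc_infinity_def)
  qed
  have lim: "(\<lambda>k. conv (\<rho> k) (W i) x) \<longlonglongrightarrow> W i x" for i x
  proof (rule Lim_transform_bound[where g="\<lambda>k. 1 / real (Suc k)", THEN LIM_zero_cancel])
    show "\<forall>\<^sub>F k in sequentially. norm (conv (\<rho> k) (W i) x - W i x) \<le> norm (1 / real (Suc k))"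
      using close by auto
    show "(\<lambda>k. 1 / real (Suc k)) \<longlonglongrightarrow> 0"
      using LIMSEQ_inverse_real_of_nat by (simp add: inverse_eq_divide)
  qed
  have "\<exists>B. \<forall>k i x. \<bar>conv (\<rho> k) (W i) x\<bar> \<le> B"
  proof -
    have "\<forall>i. \<exists>B. \<forall>x. \<bar>W i x\<bar> \<le> B" using bounded_compact_support[OF W] by (metis real_norm_def)
    then obtain B where B: "\<And>i x. \<bar>W i x\<bar> \<le> B i" by metis
    have "\<bar>conv (\<rho> k) (W i) x\<bar> \<le> Max (range B) + 1" for k i x
    proof -
      have "1 / real (Suc k) \<le> 1" by simp
      moreover have "B i \<le> Max (range B)" by simp
      ultimately show ?thesis using B[of i x] close[of k i x] by linarith
    qed
    then show ?thesis by blast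
  qed
  then obtain B where B: "\<And>k i x. \<bar>conv (\<rho> k) (W i) x\<bar> \<le> B" by blast
  have B0: "B \<ge> 0" using B[of 0 None 0] abs_ge_zero order_trans by blast
  let ?J = "\<lambda>x :: real ^ 'n. indicator (cball 0 (r + 1)) x :: real"
  define N where "N = real CARD('n)"
  have DvB: "norm (Dv k x) \<le> N * B * ?J x" for k x
  proof (cases "norm x \<ge> r + 1")
    case True
    have "Dv k x = 0" using supp[OF True, of k "Some _"] by (simp add: Dv_def W_def vec_eq_iff)
    then show ?thesis using B0 by (simp add: N_def)
  next
    case False
    have "norm (Dv k x) \<le> (\<Sum>i\<in>(UNIV :: 'n set). B)"
      using B[of k "Some _" x] by (intro order_trans[OF norm_le_l1_cart] sum_mono) (simp add: Dv_def W_def)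
    then show ?thesis using False by (simp add: N_def)
  qed
  have vB: "\<bar>v k x\<bar> \<le> B * ?J x" for k x
    using B[of k None x] supp[of x k None] B0 by (auto simp: v_def W_def indicator_def)
  have [measurable]: "A \<in> borel_measurable lebesgue" "F \<in> borel_measurable lebesgue"
    using A F Lp_loc_measurable by blast+
  have [measurable]: "Dv k \<in> borel_measurable lebesgue" "v k \<in> borel_measurable lebesgue"
    "D \<in> borel_measurable lebesgue" "\<phi> \<in> borel_measurable lebesgue" for k
    using C1_gradient_continuous[OF v] c by (auto intro!: continuous_lebesgue_measurable)
  have 1: "(\<lambda>k. \<integral>x. A x \<bullet> Dv k x \<partial>lebesgue) \<longlonglongrightarrow> (\<integral>x. A x \<bullet> D x \<partial>lebesgue)"
  proof (rule integral_dominated_convergence[where w="\<lambda>x. N * B * norm (?J x *\<^sub>R A x)"])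
    show "integrable lebesgue (\<lambda>x. N * B * norm (?J x *\<^sub>R A x))"
      using Lp_loc_1_integrable[OF A compact_cball] by (intro integrable_mult_right integrable_norm)
    show "AE x in lebesgue. (\<lambda>k. A x \<bullet> Dv k x) \<longlonglongrightarrow> A x \<bullet> D x"
    proof (intro always_eventually allI tendsto_inner tendsto_const vec_tendstoI)
      show "(\<lambda>k. Dv k x $ i) \<longlonglongrightarrow> D x $ i" for x i
        using lim[of "Some i" x] by (simp add: Dv_def W_def)
    qed
    show "AE x in lebesgue. norm (A x \<bullet> Dv k x) \<le> N * B * norm (?J x *\<^sub>R A x)" for k
    proof (intro always_eventually allI)
      fix x
      have "norm (A x \<bullet> Dv k x) \<le> norm (A x) * norm (Dv k x)"
        using Cauchy_Schwarz_ineq2 by simp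
      also have "\<dots> \<le> norm (A x) * (N * B * ?J x)" by (intro mult_left_mono DvB) simp
      finally show "norm (A x \<bullet> Dv k x) \<le> N * B * norm (?J x *\<^sub>R A x)" by (simp add: algebra_simps)
    qed
  qed measurable
  have 2: "(\<lambda>k. \<integral>x. F x * v k x \<partial>lebesgue) \<longlonglongrightarrow> (\<integral>x. F x * \<phi> x \<partial>lebesgue)"
  proof (rule integral_dominated_convergence[where w="\<lambda>x. B * norm (?J x *\<^sub>R F x)"])
    show "integrable lebesgue (\<lambda>x. B * norm (?J x *\<^sub>R F x))"
      using Lp_loc_1_integrable[OF F compact_cball] by (intro integrable_mult_right integrable_norm)
    show "AE x in lebesgue. (\<lambda>k. F x * v k x) \<longlonglongrightarrow> F x * \<phi> x"
      using lim[of None] by (intro always_eventually allI tendsto_intros) (simp add: v_def W_def)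
    show "AE x in lebesgue. norm (F x * v k x) \<le> B * norm (?J x *\<^sub>R F x)" for k
    proof (intro always_eventually allI)
      fix x
      have "norm (F x * v k x) \<le> \<bar>F x\<bar> * (B * ?J x)"
        unfolding real_norm_def abs_mult by (intro mult_left_mono vB) simp
      then show "norm (F x * v k x) \<le> B * norm (?J x *\<^sub>R F x)" by (simp add: algebra_simps abs_mult)
    qed
  qed measurable
  have "(\<integral>x. A x \<bullet> Dv k x \<partial>lebesgue) = (\<integral>x. F x * v k x \<partial>lebesgue)" for k
    using eq[OF vCc[of k]] C1_gradient_grad[OF v[of k]] by simp
  with 1 2 show ?thesis using LIMSEQ_unique by simp
qed

section \<open>Homogeneous Hamiltonians\<close>

text \<open>Homogeneity is asked for away from 0 only, so that the lemma applies a second time to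
  the partial derivatives of \<open>E\<close>.\<close>

lemma homogeneous_derivative:
  fixes F :: "real ^ 'n::finite \<Rightarrow> real"
  assumes hom: "\<And>t \<xi>. t > 0 \<Longrightarrow> \<xi> \<noteq> 0 \<Longrightarrow> F (t *\<^sub>R \<xi>) = t powr d * F \<xi>"
    and F: "\<And>\<xi>. \<xi> \<noteq> 0 \<Longrightarrow> GDERIV F \<xi> :> D \<xi>" and "t > 0" "\<xi> \<noteq> 0"
  shows "D (t *\<^sub>R \<xi>) = t powr (d - 1) *\<^sub>R D \<xi>"
proof -
  have "((\<lambda>\<zeta>. t *\<^sub>R \<zeta>) has_derivative (\<lambda>h. t *\<^sub>R h)) (at \<xi>)"
    by (auto intro!: derivative_eq_intros)
  moreover have "(F has_derivative (\<lambda>h. h \<bullet> D (t *\<^sub>R \<xi>))) (at (t *\<^sub>R \<xi>))"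
    using F[of "t *\<^sub>R \<xi>"] assms by (simp add: gderiv_def)
  ultimately have "((\<lambda>\<zeta>. F (t *\<^sub>R \<zeta>)) has_derivative (\<lambda>h. (t *\<^sub>R h) \<bullet> D (t *\<^sub>R \<xi>))) (at \<xi>)"
    by (rule has_derivative_compose)
  then have "GDERIV (\<lambda>\<zeta>. F (t *\<^sub>R \<zeta>)) \<xi> :> t *\<^sub>R D (t *\<^sub>R \<xi>)" by (simp add: gderiv_def)
  moreover have "GDERIV (\<lambda>\<zeta>. F (t *\<^sub>R \<zeta>)) \<xi> :> t powr d *\<^sub>R D \<xi>"
  proof -
    have "GDERIV (\<lambda>\<zeta>. t powr d * F \<zeta>) \<xi> :> t powr d *\<^sub>R D \<xi>"
      using GDERIV_mult[OF GDERIV_const[of "t powr d" \<xi>] F] assms by simp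
    then show ?thesis
      unfolding gderiv_def
      by (rule has_derivative_transform_within_open[where s="- {0}"]) (use assms in auto)
  qed
  ultimately have "t *\<^sub>R D (t *\<^sub>R \<xi>) = t powr d *\<^sub>R D \<xi>" by (metis GDERIV_grad)
  then have "(1 / t) *\<^sub>R (t *\<^sub>R D (t *\<^sub>R \<xi>)) = (1 / t) *\<^sub>R (t powr d *\<^sub>R D \<xi>)" by simp
  then show ?thesis using \<open>t > 0\<close> by (simp add: powr_diff)
qed

lemma homogeneous_Euler:
  fixes F :: "real ^ 'n::finite \<Rightarrow> real"
  assumes hom: "\<And>t. t > 0 \<Longrightarrow> F (t *\<^sub>R \<xi>) = t powr d * F \<xi>" and F: "GDERIV F \<xi> :> D"
  shows "\<xi> \<bullet> D = d * F \<xi>"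
proof -
  have "((\<lambda>t. t *\<^sub>R \<xi>) has_derivative (\<lambda>h. h *\<^sub>R \<xi>)) (at 1)"
    by (auto intro!: derivative_eq_intros)
  moreover have "(F has_derivative (\<lambda>h. h \<bullet> D)) (at ((1::real) *\<^sub>R \<xi>))"
    using F by (simp add: gderiv_def)
  ultimately have "((\<lambda>t. F (t *\<^sub>R \<xi>)) has_derivative (\<lambda>h. (h *\<^sub>R \<xi>) \<bullet> D)) (at 1)"
    by (rule has_derivative_compose)
  then have "((\<lambda>t. F (t *\<^sub>R \<xi>)) has_real_derivative (\<xi> \<bullet> D)) (at 1)"
    by (simp add: has_field_derivative_def mult_commute_abs)
  moreover have "((\<lambda>t. F (t *\<^sub>R \<xi>)) has_real_derivative (d * F \<xi>)) (at 1)"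
  proof -
    have "((\<lambda>t. t powr d * F \<xi>) has_real_derivative (d * F \<xi>)) (at 1)"
      by (auto intro!: derivative_eq_intros)
    then show ?thesis
      by (rule has_field_derivative_transform_within_open[where S="{0<..}"]) (auto simp: hom)
  qed
  ultimately show ?thesis by (rule DERIV_unique)
qed

text \<open>Scaling reduces the bound to compactness of the unit sphere. The degree may be negative,
  which is used for the reciprocal of \<open>E\<close>.\<close>

lemma homogeneous_bound:
  fixes F :: "real ^ 'n::finite \<Rightarrow> real"
  assumes hom: "\<And>t \<xi>. t > 0 \<Longrightarrow> \<xi> \<noteq> 0 \<Longrightarrow> F (t *\<^sub>R \<xi>) = t powr d * F \<xi>"
    and F: "continuous_on (- {0}) F"
  obtains C where "C > 0" "\<And>\<xi>. \<xi> \<noteq> 0 \<Longrightarrow> \<bar>F \<xi>\<bar> \<le> C * norm \<xi> powr d"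
proof -
  have "compact (F ` sphere 0 1)"
    by (intro compact_continuous_image continuous_on_subset[OF F]) auto
  then obtain C where C: "C > 0" "\<And>y. y \<in> F ` sphere 0 1 \<Longrightarrow> norm y \<le> C"
    using compact_imp_bounded bounded_pos by metis
  have "\<bar>F \<xi>\<bar> \<le> C * norm \<xi> powr d" if "\<xi> \<noteq> 0" for \<xi>
  proof -
    have "F \<xi> = norm \<xi> powr d * F ((1 / norm \<xi>) *\<^sub>R \<xi>)"
      using hom[of "norm \<xi>" "(1 / norm \<xi>) *\<^sub>R \<xi>"] that by simp
    moreover have "\<bar>F ((1 / norm \<xi>) *\<^sub>R \<xi>)\<bar> \<le> C" using C(2)[of "F ((1 / norm \<xi>) *\<^sub>R \<xi>)"] that by simp
    moreover have "\<bar>norm \<xi> powr d * F ((1 / norm \<xi>) *\<^sub>R \<xi>)\<bar> = norm \<xi> powr d * \<bar>F ((1 / norm \<xi>) *\<^sub>R \<xi>)\<bar>"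
      by (simp add: abs_mult)
    ultimately show ?thesis using mult_left_mono[of _ C "norm \<xi> powr d"] by (simp only: mult.commute[of C]) simp
  qed
  with C(1) that show thesis by blast
qed

text \<open>The matrix \<open>Z\<close> is carried as a parameter because it is the value of the
  second derivatives wherever the weak gradient vanishes, possibly on a set of positive
  measure.\<close>

locale gauge =
  fixes H :: "real ^ 'n::finite \<Rightarrow> real" and p :: real and Z :: "real ^ 'n ^ 'n"
  assumes C2: "Ck_on 2 (- {0}) H"
    and zero: "H 0 = 0"
    and homogeneous: "\<And>t \<xi>. t > 0 \<Longrightarrow> H (t *\<^sub>R \<xi>) = t * H \<xi>"
    and pos_sphere: "\<And>\<xi>. norm \<xi> = 1 \<Longrightarrow> H \<xi> > 0"
    and p: "p \<ge> 2"
    and Z: "admissible_value_at_0 p H Z"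
begin

lemma pos: "\<xi> \<noteq> 0 \<Longrightarrow> H \<xi> > 0"
  using homogeneous[of "norm \<xi>" "(1 / norm \<xi>) *\<^sub>R \<xi>"] pos_sphere[of "(1 / norm \<xi>) *\<^sub>R \<xi>"]
  by simp

lemma nonneg: "H \<xi> \<ge> 0"
  using pos[of \<xi>] zero by (cases "\<xi> = 0") auto

definition E :: "real ^ 'n \<Rightarrow> real" where "E \<xi> = H \<xi> powr p"

lemma E_homogeneous: "t > 0 \<Longrightarrow> E (t *\<^sub>R \<xi>) = t powr p * E \<xi>"
  by (simp add: E_def homogeneous powr_mult nonneg)

section \<open>Derivatives of the power of the gauge\<close>

lemma H_GDERIV: "\<xi> \<noteq> 0 \<Longrightarrow> GDERIV H \<xi> :> grad H \<xi>"
  using C2 by (intro differentiable_GDERIV_grad) (simp add: numeral_2_eq_2)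

lemma pd_H_GDERIV: "\<xi> \<noteq> 0 \<Longrightarrow> GDERIV (pd j H) \<xi> :> grad (pd j H) \<xi>"
  using C2 by (intro differentiable_GDERIV_grad) (simp add: numeral_2_eq_2 pd_def[abs_def])

lemma pd_pd_H_continuous: "continuous_on (- {0}) (pd i (pd j H))"
  using C2 by (simp add: numeral_2_eq_2 pd_def[abs_def])

lemma GDERIV_isCont:
  assumes "GDERIV F \<xi> :> D"
  shows "isCont F \<xi>"
  using assms GDERIV_differentiable differentiable_imp_continuous_within by blast

lemma H_continuous: "continuous_on (- {0}) H"
  using GDERIV_isCont[OF H_GDERIV] by (auto intro!: continuous_at_imp_continuous_on)

lemma pd_H_continuous: "continuous_on (- {0}) (pd j H)"
  using GDERIV_isCont[OF pd_H_GDERIV] by (auto intro!: continuous_at_imp_continuous_on)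

lemma powr_H_GDERIV:
  assumes "\<xi> \<noteq> 0"
  shows "GDERIV (\<lambda>\<zeta>. H \<zeta> powr q) \<xi> :> (q * H \<xi> powr (q - 1)) *\<^sub>R grad H \<xi>"
  by (rule GDERIV_DERIV_compose[OF H_GDERIV[OF assms]])
     (use pos[OF assms] in \<open>auto intro!: derivative_eq_intros simp: powr_diff\<close>)

lemma E_GDERIV: "\<xi> \<noteq> 0 \<Longrightarrow> GDERIV E \<xi> :> grad E \<xi>"
  unfolding E_def[abs_def] by (intro differentiable_GDERIV_grad GDERIV_differentiable[OF powr_H_GDERIV])

lemma pd_E: "\<xi> \<noteq> 0 \<Longrightarrow> pd j E \<xi> = p * H \<xi> powr (p - 1) * pd j H \<xi>"
  unfolding E_def[abs_def] using GDERIV_pd[OF powr_H_GDERIV, of \<xi> j p] by (simp add: grad_def)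

lemma GDERIV_transform_punctured:
  assumes "GDERIV f \<xi> :> D" "\<xi> \<noteq> 0" "\<And>\<zeta>. \<zeta> \<noteq> 0 \<Longrightarrow> f \<zeta> = g \<zeta>"
  shows "GDERIV g \<xi> :> D"
  using assms(1) unfolding gderiv_def
  by (rule has_derivative_transform_within_open[where s="- {0}"]) (use assms in auto)

text \<open>The formula is written out because continuity of the second partial derivatives of
  \<open>E\<close> off the origin is read off from it.\<close>

lemma pd_E_GDERIV_explicit:
  assumes "\<xi> \<noteq> 0"
  shows "GDERIV (pd j E) \<xi> :> (p * H \<xi> powr (p - 1)) *\<^sub>R grad (pd j H) \<xi>
     + pd j H \<xi> *\<^sub>R (p * (p - 1) * H \<xi> powr (p - 2)) *\<^sub>R grad H \<xi>"
proof (rule GDERIV_transform_punctured[OF _ assms])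
  have "GDERIV (\<lambda>\<zeta>. p * H \<zeta> powr (p - 1)) \<xi> :> (p * (p - 1) * H \<xi> powr (p - 2)) *\<^sub>R grad H \<xi>"
    using GDERIV_mult[OF GDERIV_const[of p \<xi>] powr_H_GDERIV[OF assms, of "p - 1"]] by (simp add: algebra_simps)
  from GDERIV_mult[OF this pd_H_GDERIV[OF assms, of j]]
  show "GDERIV (\<lambda>\<zeta>. (p * H \<zeta> powr (p - 1)) * pd j H \<zeta>) \<xi> :> (p * H \<xi> powr (p - 1)) *\<^sub>R grad (pd j H) \<xi>
     + pd j H \<xi> *\<^sub>R (p * (p - 1) * H \<xi> powr (p - 2)) *\<^sub>R grad H \<xi>" .
qed (simp add: pd_E)

lemma pd_E_GDERIV: "\<xi> \<noteq> 0 \<Longrightarrow> GDERIV (pd j E) \<xi> :> grad (pd j E) \<xi>"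
  by (intro differentiable_GDERIV_grad GDERIV_differentiable[OF pd_E_GDERIV_explicit])

lemma pd_E_continuous: "continuous_on (- {0}) (pd j E)"
  using GDERIV_isCont[OF pd_E_GDERIV] by (auto intro!: continuous_at_imp_continuous_on)

lemma pd_pd_E_continuous: "continuous_on (- {0}) (pd i (pd j E))"
proof -
  have "continuous_on (- {0}) (\<lambda>\<xi>. p * H \<xi> powr (p - 1) * pd i (pd j H) \<xi>
      + pd j H \<xi> * (p * (p - 1) * H \<xi> powr (p - 2) * pd i H \<xi>))"
    using pos by (intro continuous_intros H_continuous pd_H_continuous pd_pd_H_continuous) force+
  then show ?thesis
    by (rule continuous_on_eq) (simp add: GDERIV_pd[OF pd_E_GDERIV_explicit] grad_def)
qed

lemma pd_E_homogeneous:
  assumes "t > 0" "\<xi> \<noteq> 0"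
  shows "pd j E (t *\<^sub>R \<xi>) = t powr (p - 1) * pd j E \<xi>"
  using homogeneous_derivative[OF E_homogeneous E_GDERIV assms]
  by (simp add: grad_def vec_eq_iff)

lemma pd_pd_E_homogeneous:
  assumes "t > 0" "\<xi> \<noteq> 0"
  shows "pd i (pd j E) (t *\<^sub>R \<xi>) = t powr (p - 2) * pd i (pd j E) \<xi>"
  using homogeneous_derivative[OF pd_E_homogeneous pd_E_GDERIV assms, of j]
  by (simp add: grad_def vec_eq_iff)

text \<open>The indices are ordered as in \<open>linearized_form\<close>. The two arguments are kept
  apart: the derivative taken last is contracted with \<open>\<eta>\<close>, the one taken first
  with \<open>\<zeta>\<close>.\<close>

definition hess_form :: "real ^ 'n \<Rightarrow> real ^ 'n \<Rightarrow> real ^ 'n \<Rightarrow> real" where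
  "hess_form \<xi> \<eta> \<zeta> = (\<Sum>i\<in>UNIV. \<Sum>j\<in>UNIV. (1 / p) * hessian_Hp p H Z \<xi> $ i $ j * \<eta> $ i * \<zeta> $ j)"

lemma hess_form_nonzero:
  assumes "\<xi> \<noteq> 0"
  shows "hess_form \<xi> \<eta> \<zeta> = (1 / p) * (\<Sum>j\<in>UNIV. (\<eta> \<bullet> grad (pd j E) \<xi>) * \<zeta> $ j)"
proof -
  have "hessian_Hp p H Z \<xi> $ i $ j = grad (pd j E) \<xi> $ i" for i j
    using assms by (simp add: hessian_Hp_def hessian_def grad_def E_def[abs_def])
  then have "hess_form \<xi> \<eta> \<zeta> = (\<Sum>j\<in>UNIV. \<Sum>i\<in>UNIV. (1 / p) * (\<eta> $ i * grad (pd j E) \<xi> $ i) * \<zeta> $ j)"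
    unfolding hess_form_def by (subst sum.swap) (simp add: mult_ac)
  also have "\<dots> = (1 / p) * (\<Sum>j\<in>UNIV. (\<eta> \<bullet> grad (pd j E) \<xi>) * \<zeta> $ j)"
    by (simp add: inner_vec_def sum_distrib_left sum_distrib_right mult.assoc)
  finally show ?thesis .
qed

lemma hess_form_linear_left:
  "hess_form \<xi> (a *\<^sub>R \<eta> + b *\<^sub>R \<eta>') \<zeta> = a * hess_form \<xi> \<eta> \<zeta> + b * hess_form \<xi> \<eta>' \<zeta>"
  by (simp add: hess_form_def sum.distrib sum_distrib_left algebra_simps add_divide_distrib)

lemma hess_form_linear_right:
  "hess_form \<xi> \<eta> (a *\<^sub>R \<zeta> + b *\<^sub>R \<zeta>') = a * hess_form \<xi> \<eta> \<zeta> + b * hess_form \<xi> \<eta> \<zeta>'"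
  by (simp add: hess_form_def sum.distrib sum_distrib_left algebra_simps add_divide_distrib)

lemma a_field_zero: "a_field p H 0 = 0"
  by (simp add: a_field_def)

lemma a_field_nonzero: "\<xi> \<noteq> 0 \<Longrightarrow> a_field p H \<xi> = (1 / p) *\<^sub>R grad E \<xi>"
  by (simp add: a_field_def E_def[abs_def])

text \<open>Contracting the outer derivative with \<open>\<xi>\<close> is Euler's identity for
  \<open>pd j E\<close>, which has degree \<open>p - 1\<close>. At the origin both sides vanish
  whatever \<open>Z\<close> is.\<close>

lemma hess_form_self_left: "hess_form \<xi> \<xi> \<zeta> = (p - 1) * (a_field p H \<xi> \<bullet> \<zeta>)"
proof (cases "\<xi> = 0")
  case True
  then show ?thesis by (simp add: hess_form_def a_field_def)
next
  case False
  have "\<xi> \<bullet> grad (pd j E) \<xi> = (p - 1) * pd j E \<xi>" for j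
    using pd_E_homogeneous[OF _ False] pd_E_GDERIV[OF False] by (rule homogeneous_Euler)
  then have "hess_form \<xi> \<xi> \<zeta> = (1 / p) * (\<Sum>j\<in>UNIV. (p - 1) * pd j E \<xi> * \<zeta> $ j)"
    by (simp only: hess_form_nonzero[OF False])
  then show ?thesis
    using False by (simp add: a_field_nonzero inner_vec_def grad_def sum_distrib_left mult_ac)
qed

text \<open>Differentiating Euler's identity \<open>\<nabla>E(\<zeta>) \<bullet> \<zeta> = p E(\<zeta>)\<close> in the
  direction \<open>\<eta>\<close> replaces an appeal to the symmetry of second derivatives.\<close>

lemma hess_form_self_right: "hess_form \<xi> \<eta> \<xi> = (p - 1) * (a_field p H \<xi> \<bullet> \<eta>)"
proof (cases "\<xi> = 0")
  case True
  then show ?thesis by (simp add: hess_form_def a_field_def)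
next
  case False
  have Euler: "\<zeta> \<bullet> grad E \<zeta> = p * E \<zeta>" if "\<zeta> \<noteq> 0" for \<zeta>
    using E_homogeneous E_GDERIV[OF that] by (rule homogeneous_Euler)
  have "((\<lambda>\<zeta>. \<zeta> \<bullet> grad E \<zeta>) has_derivative (\<lambda>h. \<Sum>j\<in>UNIV. h $ j * pd j E \<xi> + \<xi> $ j * (h \<bullet> grad (pd j E) \<xi>))) (at \<xi>)"
  proof -
    have "((\<lambda>\<zeta>. \<zeta> $ j * pd j E \<zeta>) has_derivative (\<lambda>h. h $ j * pd j E \<xi> + \<xi> $ j * (h \<bullet> grad (pd j E) \<xi>))) (at \<xi>)" for j
    proof -
      have "(pd j E has_derivative (\<lambda>h. h \<bullet> grad (pd j E) \<xi>)) (at \<xi>)"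
        using pd_E_GDERIV[OF False] by (simp add: gderiv_def)
      moreover have "((\<lambda>\<zeta>. \<zeta> $ j) has_derivative (\<lambda>h. h $ j)) (at \<xi>)"
        by (rule bounded_linear.has_derivative[OF bounded_linear_vec_nth]) auto
      ultimately show ?thesis using has_derivative_mult by (fastforce simp: algebra_simps)
    qed
    then have "((\<lambda>\<zeta>. \<Sum>j\<in>UNIV. \<zeta> $ j * pd j E \<zeta>) has_derivative (\<lambda>h. \<Sum>j\<in>UNIV. h $ j * pd j E \<xi> + \<xi> $ j * (h \<bullet> grad (pd j E) \<xi>))) (at \<xi>)"
      by (rule has_derivative_sum)
    then show ?thesis by (simp add: inner_vec_def grad_def)
  qed
  then have 1: "((\<lambda>\<zeta>. p * E \<zeta>) has_derivative (\<lambda>h. \<Sum>j\<in>UNIV. h $ j * pd j E \<xi> + \<xi> $ j * (h \<bullet> grad (pd j E) \<xi>))) (at \<xi>)"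
    by (rule has_derivative_transform_within_open[where s="- {0}"]) (use False Euler in auto)
  have 2: "((\<lambda>\<zeta>. p * E \<zeta>) has_derivative (\<lambda>h. p * (h \<bullet> grad E \<xi>))) (at \<xi>)"
    using E_GDERIV[OF False] unfolding gderiv_def by (rule has_derivative_mult_right)
  have "(\<Sum>j\<in>UNIV. \<eta> $ j * pd j E \<xi> + \<xi> $ j * (\<eta> \<bullet> grad (pd j E) \<xi>)) = p * (\<eta> \<bullet> grad E \<xi>)"
    using has_derivative_unique[OF 1 2] by (rule fun_cong)
  have "(\<Sum>j\<in>UNIV. (\<eta> \<bullet> grad (pd j E) \<xi>) * \<xi> $ j) = (p - 1) * (\<eta> \<bullet> grad E \<xi>)"
  proof -
    have "\<eta> \<bullet> grad E \<xi> = (\<Sum>j\<in>UNIV. \<eta> $ j * pd j E \<xi>)" by (simp add: inner_vec_def grad_def)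
    then show ?thesis
      using \<open>(\<Sum>j\<in>UNIV. \<eta> $ j * pd j E \<xi> + \<xi> $ j * (\<eta> \<bullet> grad (pd j E) \<xi>)) = p * (\<eta> \<bullet> grad E \<xi>)\<close>
      by (simp add: sum.distrib algebra_simps)
  qed
  then show ?thesis
    using False p by (simp add: hess_form_nonzero a_field_nonzero inner_commute)
qed

lemma a_field_self: "a_field p H \<xi> \<bullet> \<xi> = E \<xi>"
proof (cases "\<xi> = 0")
  case True
  then show ?thesis by (simp add: E_def zero)
next
  case False
  have "\<xi> \<bullet> grad E \<xi> = p * E \<xi>"
    using E_homogeneous E_GDERIV[OF False] by (rule homogeneous_Euler)
  then show ?thesis using False p by (simp add: a_field_nonzero inner_commute)
qed

text \<open>As soon as one argument is \<open>\<xi>\<close> the Hessian collapses to the flux.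
  Stability then produces the same two integrands as the weak equation, and second derivatives
  survive only in the term quadratic in \<open>\<zeta>\<close>.\<close>

lemma hess_form_expand:
  "hess_form \<xi> (a *\<^sub>R \<xi> + b *\<^sub>R \<zeta>) (a *\<^sub>R \<xi> + b *\<^sub>R \<zeta>) =
     a\<^sup>2 * (p - 1) * E \<xi> + 2 * a * b * (p - 1) * (a_field p H \<xi> \<bullet> \<zeta>) + b\<^sup>2 * hess_form \<xi> \<zeta> \<zeta>"
proof -
  have "hess_form \<xi> (a *\<^sub>R \<xi> + b *\<^sub>R \<zeta>) (a *\<^sub>R \<xi> + b *\<^sub>R \<zeta>)
    = a * (a * hess_form \<xi> \<xi> \<xi> + b * hess_form \<xi> \<xi> \<zeta>) + b * (a * hess_form \<xi> \<zeta> \<xi> + b * hess_form \<xi> \<zeta> \<zeta>)"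
    by (simp only: hess_form_linear_left hess_form_linear_right) (simp add: algebra_simps)
  also have "\<dots> = a * (a * ((p - 1) * E \<xi>) + b * ((p - 1) * (a_field p H \<xi> \<bullet> \<zeta>)))
      + b * (a * ((p - 1) * (a_field p H \<xi> \<bullet> \<zeta>)) + b * hess_form \<xi> \<zeta> \<zeta>)"
    by (simp only: hess_form_self_left hess_form_self_right a_field_self)
  finally show ?thesis by (simp add: algebra_simps power2_eq_square)
qed

text \<open>The upper bound for homogeneous functions is applied to the reciprocal of
  \<open>E\<close>, of degree \<open>- p\<close>.\<close>

lemma E_lower: obtains c where "c > 0" "\<And>\<xi>. E \<xi> \<ge> c * norm \<xi> powr p"
proof -
  have 1: "inverse (E (t *\<^sub>R \<xi>)) = t powr (- p) * inverse (E \<xi>)" if "t > 0" for t \<xi>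
    using that by (simp add: E_homogeneous powr_minus)
  have "continuous_on (- {0}) (\<lambda>\<xi>. inverse (E \<xi>))"
    unfolding E_def using pos by (intro continuous_intros H_continuous) (force simp: powr_eq_0_iff)+
  from homogeneous_bound[of "\<lambda>\<xi>. inverse (E \<xi>)", OF 1 this]
  obtain C where C: "C > 0" "\<And>\<xi>. \<xi> \<noteq> 0 \<Longrightarrow> \<bar>inverse (E \<xi>)\<bar> \<le> C * norm \<xi> powr (- p)" by blast
  have "E \<xi> \<ge> (1 / C) * norm \<xi> powr p" for \<xi>
  proof (cases "\<xi> = 0")
    case False
    then have "E \<xi> > 0" using pos by (force simp: E_def)
    moreover have "norm \<xi> powr p > 0" using False by simp
    moreover have "inverse (E \<xi>) \<le> C / norm \<xi> powr p"
      using order_trans[OF abs_ge_self C(2)[OF False]] by (simp add: powr_minus divide_inverse)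
    ultimately show ?thesis using C(1) by (simp add: field_simps)
  qed (simp add: E_def zero)
  then show thesis using that[of "1 / C"] C(1) by simp
qed

lemma a_field_upper: obtains C where "C > 0" "\<And>\<xi>. norm (a_field p H \<xi>) \<le> C * norm \<xi> powr (p - 1)"
proof -
  have "\<forall>j. \<exists>C. C > 0 \<and> (\<forall>\<xi>. \<xi> \<noteq> 0 \<longrightarrow> \<bar>pd j E \<xi>\<bar> \<le> C * norm \<xi> powr (p - 1))"
    using homogeneous_bound[OF pd_E_homogeneous pd_E_continuous] by metis
  then obtain C where C: "\<And>j. C j > 0" "\<And>j \<xi>. \<xi> \<noteq> 0 \<Longrightarrow> \<bar>pd j E \<xi>\<bar> \<le> C j * norm \<xi> powr (p - 1)"
    by metis
  have "norm (a_field p H \<xi>) \<le> (\<Sum>j\<in>UNIV. C j) * norm \<xi> powr (p - 1)" for \<xi>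
  proof (cases "\<xi> = 0")
    case False
    have "norm (a_field p H \<xi>) \<le> 1 * norm (grad E \<xi>)"
      unfolding a_field_nonzero[OF False] norm_scaleR using p by (intro mult_right_mono) auto
    also have "1 * norm (grad E \<xi>) \<le> (\<Sum>j\<in>UNIV. \<bar>pd j E \<xi>\<bar>)"
      using norm_le_l1_cart[of "grad E \<xi>"] by (simp add: grad_def)
    also have "\<dots> \<le> (\<Sum>j\<in>UNIV. C j * norm \<xi> powr (p - 1))" by (intro sum_mono C(2) False)
    finally show ?thesis by (simp add: sum_distrib_right)
  qed (simp add: a_field_def)
  moreover have "(\<Sum>j\<in>UNIV. C j) > 0" using C(1) by (intro sum_pos) auto
  ultimately show thesis using that by blast
qed

lemma E_upper: obtains C where "C > 0" "\<And>\<xi>. E \<xi> \<le> C * norm \<xi> powr p"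
proof -
  have "continuous_on (- {0}) E"
    using GDERIV_isCont[OF E_GDERIV] by (auto intro!: continuous_at_imp_continuous_on)
  from homogeneous_bound[OF E_homogeneous this]
  obtain C where C: "C > 0" "\<And>\<xi>. \<xi> \<noteq> 0 \<Longrightarrow> \<bar>E \<xi>\<bar> \<le> C * norm \<xi> powr p" by blast
  have "E \<xi> \<le> C * norm \<xi> powr p" for \<xi>
    using C(2)[of \<xi>] by (cases "\<xi> = 0") (auto simp: E_def zero)
  with C(1) that show thesis by blast
qed

text \<open>The case distinction is needed for \<open>p = 2\<close> because \<open>0 powr 0 = 0\<close>.\<close>

lemma hess_form_upper:
  obtains C where "C > 0"
    "\<And>\<xi> \<eta> \<zeta>. \<bar>hess_form \<xi> \<eta> \<zeta>\<bar> \<le> C * (if p = 2 then 1 else norm \<xi> powr (p - 2)) * norm \<eta> * norm \<zeta>"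
proof -
  define k where "k \<xi> = (if p = 2 then 1 else norm \<xi> powr (p - 2))" for \<xi> :: "real ^ 'n"
  have k0: "k \<xi> \<ge> 0" for \<xi> by (simp add: k_def)
  have "\<exists>C. \<forall>\<xi>. \<bar>hessian_Hp p H Z \<xi> $ i $ j\<bar> \<le> C * k \<xi>" for i j
  proof -
    obtain C where C: "C > 0" "\<And>\<xi>. \<xi> \<noteq> 0 \<Longrightarrow> \<bar>pd i (pd j E) \<xi>\<bar> \<le> C * norm \<xi> powr (p - 2)"
      using homogeneous_bound[OF pd_pd_E_homogeneous pd_pd_E_continuous] by metis
    \<comment> \<open>The summand with \<open>Z\<close> covers the origin when \<open>p = 2\<close>;
      for \<open>p > 2\<close> the matrix \<open>Z\<close> is 0.\<close>
    have "\<bar>hessian_Hp p H Z \<xi> $ i $ j\<bar> \<le> (C + \<bar>Z $ i $ j\<bar>) * k \<xi>" for \<xi>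
    proof (cases "\<xi> = 0")
      case True
      show ?thesis
      proof (cases "p = 2")
        case False
        then have "Z = 0" using Z p by (simp add: admissible_value_at_0_def)
        then show ?thesis using True False by (simp add: hessian_Hp_def k_def)
      qed (use True C(1) in \<open>simp add: hessian_Hp_def k_def\<close>)
    next
      case False
      have "\<bar>hessian_Hp p H Z \<xi> $ i $ j\<bar> = \<bar>pd i (pd j E) \<xi>\<bar>"
        using False by (simp add: hessian_Hp_def hessian_def E_def[abs_def])
      also have "\<dots> \<le> C * norm \<xi> powr (p - 2)" by (rule C(2)[OF False])
      also have "C * norm \<xi> powr (p - 2) = C * k \<xi>" using False by (simp add: k_def)
      also have "\<dots> \<le> (C + \<bar>Z $ i $ j\<bar>) * k \<xi>" using k0 by (intro mult_right_mono) auto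
      finally show ?thesis .
    qed
    then show ?thesis by blast
  qed
  then obtain C where C: "\<And>i j \<xi>. \<bar>hessian_Hp p H Z \<xi> $ i $ j\<bar> \<le> C i j * k \<xi>" by metis
  define K where "K = (\<Sum>i\<in>UNIV. \<Sum>j\<in>UNIV. \<bar>C i j\<bar>)"
  have "\<bar>hess_form \<xi> \<eta> \<zeta>\<bar> \<le> (K + 1) * k \<xi> * norm \<eta> * norm \<zeta>" for \<xi> \<eta> \<zeta>
  proof -
    have "\<bar>(1 / p) * hessian_Hp p H Z \<xi> $ i $ j * \<eta> $ i * \<zeta> $ j\<bar> \<le> (\<bar>C i j\<bar> * k \<xi>) * norm \<eta> * norm \<zeta>" for i j
    proof -
      have "\<bar>(1 / p) * hessian_Hp p H Z \<xi> $ i $ j\<bar> \<le> 1 * \<bar>hessian_Hp p H Z \<xi> $ i $ j\<bar>"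
        unfolding abs_mult using p by (intro mult_right_mono) auto
      also have "\<dots> \<le> \<bar>C i j\<bar> * k \<xi>"
        using C[of \<xi> i j] mult_right_mono[OF abs_ge_self[of "C i j"] k0[of \<xi>]] by simp
      finally show ?thesis
        unfolding abs_mult[of _ "\<zeta> $ j"] abs_mult[of _ "\<eta> $ i"]
        by (intro mult_mono component_le_norm_cart mult_nonneg_nonneg k0) auto
    qed
    then have "\<bar>hess_form \<xi> \<eta> \<zeta>\<bar> \<le> (\<Sum>i\<in>UNIV. \<Sum>j\<in>UNIV. (\<bar>C i j\<bar> * k \<xi>) * norm \<eta> * norm \<zeta>)"
      unfolding hess_form_def by (intro order_trans[OF sum_abs] sum_mono)
    also have "\<dots> = K * (k \<xi> * norm \<eta> * norm \<zeta>)"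
      by (simp add: K_def sum_distrib_right mult.assoc)
    also have "\<dots> \<le> (K + 1) * (k \<xi> * norm \<eta> * norm \<zeta>)"
      using k0 by (intro mult_right_mono) auto
    finally show ?thesis by (simp add: mult.assoc)
  qed
  moreover have "K + 1 > 0" unfolding K_def by (intro add_nonneg_pos sum_nonneg) auto
  ultimately show thesis using that unfolding k_def by blast
qed

section \<open>Measurability of flux and Hessian\<close>

lemma measurable_punctured:
  fixes g :: "real ^ 'n \<Rightarrow> real"
  assumes "continuous_on (- {0}) g"
  shows "(\<lambda>\<xi>. if \<xi> = 0 then z else g \<xi>) \<in> borel_measurable borel"
proof -
  have "(\<lambda>\<xi>. if \<xi> \<in> {0} then z else g \<xi>) \<in> borel_measurable borel"
    by (rule borel_measurable_continuous_on_if) (use assms in auto)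
  then show ?thesis by simp
qed

lemma hessian_Hp_measurable [measurable]: "(\<lambda>\<xi>. hessian_Hp p H Z \<xi> $ i $ j) \<in> borel_measurable borel"
proof -
  have "(\<lambda>\<xi>. hessian_Hp p H Z \<xi> $ i $ j) = (\<lambda>\<xi>. if \<xi> = 0 then Z $ i $ j else pd i (pd j E) \<xi>)"
    by (auto simp: hessian_Hp_def hessian_def E_def[abs_def])
  then show ?thesis using measurable_punctured[OF pd_pd_E_continuous] by simp
qed

lemma a_field_measurable [measurable]: "a_field p H \<in> borel_measurable borel"
proof -
  have "(\<lambda>\<xi>. a_field p H \<xi> \<bullet> b) \<in> borel_measurable borel" for b
  proof -
    have "continuous_on (- {0}) (\<lambda>\<xi>. ((1 / p) *\<^sub>R (\<chi> j. pd j E \<xi>)) \<bullet> b)"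
      by (intro continuous_intros continuous_on_vec_lambda pd_E_continuous)
    moreover have "(\<lambda>\<xi>. a_field p H \<xi> \<bullet> b) = (\<lambda>\<xi>. if \<xi> = 0 then 0 else ((1 / p) *\<^sub>R (\<chi> j. pd j E \<xi>)) \<bullet> b)"
      by (rule ext) (simp add: a_field_zero a_field_nonzero grad_def)
    ultimately show ?thesis using measurable_punctured by simp
  qed
  then show ?thesis by (simp add: borel_measurable_euclidean_space[of "a_field p H"])
qed

lemma E_measurable [measurable]: "E \<in> borel_measurable borel"
  by (subst a_field_self[symmetric, abs_def]) measurable

end

section \<open>Real inequalities and cutoff functions\<close>

lemma continuous_on_abs_powr:
  fixes q :: real
  assumes "q > 0"
  shows "continuous_on UNIV (\<lambda>s::real. \<bar>s\<bar> powr q)"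
  using assms by (intro continuous_on_powr' continuous_intros) auto

lemma DERIV_signed_powr:
  fixes q s :: real
  assumes q: "q > 1"
  shows "DERIV (\<lambda>s. \<bar>s\<bar> powr (q - 1) * s) s :> q * \<bar>s\<bar> powr (q - 1)"
proof (cases s "0::real" rule: linorder_cases)
  case less
  have "DERIV (\<lambda>s. - ((- s) powr q)) s :> q * \<bar>s\<bar> powr (q - 1)"
    using less by (auto intro!: derivative_eq_intros simp: powr_diff)
  then show ?thesis
    by (rule has_field_derivative_transform_within_open[where S="{..<0}"])
       (use less in \<open>auto simp: powr_diff\<close>)
next
  case equal
  have "isCont (\<lambda>h::real. \<bar>h\<bar> powr (q - 1)) 0"
    using continuous_on_abs_powr[of "q - 1"] q by (simp add: continuous_on_eq_continuous_at)
  then have "((\<lambda>h::real. \<bar>h\<bar> powr (q - 1)) \<longlongrightarrow> \<bar>0\<bar> powr (q - 1)) (at 0)" by (rule isContD)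
  then have *: "((\<lambda>h::real. \<bar>h\<bar> powr (q - 1)) \<longlongrightarrow> 0) (at 0)" by simp
  \<comment> \<open>The factor \<open>h\<close> cancels and leaves
    \<open>\<bar>h\<bar> powr (q - 1)\<close>, which tends to 0 because
    \<open>q > 1\<close>.\<close>
  have "((\<lambda>h. (\<bar>0 + h\<bar> powr (q - 1) * (0 + h) - \<bar>0\<bar> powr (q - 1) * 0) / h) \<longlongrightarrow> 0) (at 0)"
    by (rule Lim_transform_eventually[OF *]) (auto simp: eventually_at_filter)
  then show ?thesis using equal by (simp add: DERIV_def)
next
  case greater
  have "DERIV (\<lambda>s. s powr q) s :> q * \<bar>s\<bar> powr (q - 1)"
    using greater by (auto intro!: derivative_eq_intros simp: powr_diff)
  then show ?thesis
    by (rule has_field_derivative_transform_within_open[where S="{0<..}"])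
       (use greater in \<open>auto simp: powr_diff\<close>)
qed

text \<open>The differential inequality says that \<open>f s * s powr (- \<alpha>)\<close> has a
  nonnegative derivative for \<open>s > 0\<close>.\<close>

lemma superlinear_growth:
  fixes f :: "real \<Rightarrow> real"
  assumes f: "\<And>s. DERIV f s :> f' s" and le: "\<And>s. s\<^sup>2 * f' s \<ge> \<alpha> * (s * f s)"
    and s: "0 < s\<^sub>0" "s\<^sub>0 \<le> s"
  shows "f s\<^sub>0 * s\<^sub>0 powr (- \<alpha>) * s powr \<alpha> \<le> f s"
proof -
  have "f s\<^sub>0 * s\<^sub>0 powr (- \<alpha>) \<le> f s * s powr (- \<alpha>)"
  proof (rule DERIV_nonneg_imp_nondecreasing[OF s(2)])
    fix x assume "s\<^sub>0 \<le> x" "x \<le> s"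
    then have x: "x > 0" using s by simp
    have "DERIV (\<lambda>s. f s * s powr (- \<alpha>)) x :> (x\<^sup>2 * f' x - \<alpha> * (x * f x)) * x powr (- \<alpha> - 2)"
      using x by (auto intro!: derivative_eq_intros f simp: powr_diff field_simps power2_eq_square)
    moreover have "(x\<^sup>2 * f' x - \<alpha> * (x * f x)) * x powr (- \<alpha> - 2) \<ge> 0"
      using le[of x] by (intro mult_nonneg_nonneg) auto
    ultimately show "\<exists>y. DERIV (\<lambda>s. f s * s powr (- \<alpha>)) x :> y \<and> 0 \<le> y" by blast
  qed
  then have "f s\<^sub>0 * s\<^sub>0 powr (- \<alpha>) * s powr \<alpha> \<le> f s * s powr (- \<alpha>) * s powr \<alpha>"
    by (rule mult_right_mono) simp
  also have "\<dots> = f s" using s by (simp add: powr_minus)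
  finally show ?thesis .
qed

text \<open>Below \<open>M\<close> the power of \<open>\<beta>\<close> is given, beyond
  \<open>M\<close> monotonicity yields only the power of \<open>\<alpha>\<close>. Neither bound need
  hold on the whole line, hence the disjunction.\<close>

lemma superlinear_lower_bound:
  fixes f :: "real \<Rightarrow> real"
  assumes f: "\<And>s. DERIV f s :> f' s" and sign: "\<And>s. s \<noteq> 0 \<Longrightarrow> s * f s > 0"
    and le: "\<And>s. s\<^sup>2 * f' s \<ge> \<alpha> * (s * f s)"
    and low: "\<exists>c>0. \<exists>M>0. \<forall>s. \<bar>s\<bar> < M \<longrightarrow> s * f s \<ge> c * \<bar>s\<bar> powr (\<beta> + 1)"
  obtains c where "c > 0" "\<And>s. s * f s \<ge> c * \<bar>s\<bar> powr (\<beta> + 1) \<or> s * f s \<ge> c * \<bar>s\<bar> powr (\<alpha> + 1)"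
proof -
  obtain c M where c: "c > 0" "M > 0" "\<And>s. \<bar>s\<bar> < M \<Longrightarrow> s * f s \<ge> c * \<bar>s\<bar> powr (\<beta> + 1)"
    using low by blast
  define k where "k = f M * M powr (- \<alpha>)"
  define k' where "k' = - f (- M) * M powr (- \<alpha>)"
  have k: "k > 0" "k' > 0"
    using sign[of M] sign[of "- M"] c(2)
    by (auto simp: k_def k'_def zero_less_mult_iff mult_less_0_iff)
  have 1: "k * \<bar>s\<bar> powr (\<alpha> + 1) \<le> s * f s" if "s \<ge> M" for s
    using mult_left_mono[OF superlinear_growth[OF f le c(2) that], of s] that c(2)
    by (simp add: k_def powr_add mult_ac)
  \<comment> \<open>The odd reflection of \<open>f\<close> satisfies the same differential
    inequality and supplies the bound at negative arguments.\<close>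
  have f2: "DERIV (\<lambda>s. - f (- s)) s :> f' (- s)" for s
  proof -
    have "DERIV (\<lambda>s. f (- s)) s :> f' (- s) * (- 1)"
      by (rule DERIV_chain2[where g=uminus, OF f]) (auto intro!: derivative_eq_intros)
    from DERIV_minus[OF this] show ?thesis by simp
  qed
  have le2: "s\<^sup>2 * f' (- s) \<ge> \<alpha> * (s * - f (- s))" for s using le[of "- s"] by simp
  have 2: "k' * s powr (\<alpha> + 1) \<le> s * - f (- s)" if "s \<ge> M" for s
    using mult_left_mono[OF superlinear_growth[OF f2 le2 c(2) that], of s] that c(2)
    by (simp add: k'_def powr_add mult_ac)
  have 3: "k' * \<bar>s\<bar> powr (\<alpha> + 1) \<le> s * f s" if "s \<le> - M" for s
    using 2[of "- s"] that c(2) by simp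
  define C where "C = min c (min k k')"
  have C: "C > 0" "C \<le> c" "C \<le> k" "C \<le> k'" using c(1) k by (auto simp: C_def)
  have "s * f s \<ge> C * \<bar>s\<bar> powr (\<beta> + 1) \<or> s * f s \<ge> C * \<bar>s\<bar> powr (\<alpha> + 1)" for s
  proof -
    consider "\<bar>s\<bar> < M" | "s \<ge> M" | "s \<le> - M" by linarith
    then show ?thesis
    proof cases
      case 1
      have "C * \<bar>s\<bar> powr (\<beta> + 1) \<le> c * \<bar>s\<bar> powr (\<beta> + 1)" using C(2) by (rule mult_right_mono) simp
      then show ?thesis using c(3)[OF 1] by linarith
    next
      case s: 2
      have "C * \<bar>s\<bar> powr (\<alpha> + 1) \<le> k * \<bar>s\<bar> powr (\<alpha> + 1)" using C(3) by (rule mult_right_mono) simp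
      then show ?thesis using 1[OF s] by linarith
    next
      case s: 3
      have "C * \<bar>s\<bar> powr (\<alpha> + 1) \<le> k' * \<bar>s\<bar> powr (\<alpha> + 1)" using C(4) by (rule mult_right_mono) simp
      then show ?thesis using 3[OF s] by linarith
    qed
  qed
  with C(1) that show thesis by blast
qed

section \<open>Interpolation by Young's inequality\<close>

text \<open>Every base is at most the total and the exponents add up to 1. The constant is cruder
  than in the weighted mean inequality, but vanishing exponents need no separate case.\<close>

lemma powr_product_le_sum:
  fixes x y w :: real
  assumes "x \<ge> 0" "y \<ge> 0" "w \<ge> 0" "a \<ge> 0" "b \<ge> 0" "c \<ge> 0" "a + b + c = 1"
  shows "x powr a * y powr b * w powr c \<le> x + y + w"
proof -
  let ?T = "x + y + w"
  have "x powr a * y powr b * w powr c \<le> ?T powr a * ?T powr b * ?T powr c"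
    using assms by (intro mult_mono powr_mono2 mult_nonneg_nonneg) auto
  also have "\<dots> = ?T powr (a + b + c)" by (simp add: powr_add)
  finally show ?thesis using assms by simp
qed

text \<open>The powers of \<open>g\<close> and \<open>L\<close> determine two of the three weights,
  \<open>a\<close> and \<open>c\<close>; for this \<open>\<kappa>\<close> the remaining weight
  \<open>b'\<close> reproduces the power of \<open>s\<close> exactly. For \<open>z\<close> an
  inequality between exponents is enough since \<open>z \<le> 1\<close>, and this is where
  \<open>2 * real m \<ge> \<kappa>\<close> enters.\<close>

lemma Young_interpolation_pos:
  fixes p \<gamma> b \<epsilon> :: real and j m :: nat
  defines "\<kappa> \<equiv> p * (\<gamma> + b) / (b - p + 1)"
  assumes p: "p \<ge> 2" and \<gamma>: "\<gamma> > 1" and b: "b > p - 1" and j: "j = 1 \<or> j = 2" and m: "2 * real m \<ge> \<kappa>"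
    and \<epsilon>: "\<epsilon> > 0"
  shows "\<exists>K\<ge>0. \<forall>s g z L. s > 0 \<longrightarrow> g > 0 \<longrightarrow> 0 < z \<longrightarrow> z \<le> 1 \<longrightarrow> L > 0 \<longrightarrow>
     s powr (\<gamma> - 1 + j) * g powr (p - j) * z ^ (2 * m - j) * L ^ j
       \<le> \<epsilon> * (s powr (\<gamma> - 1) * g powr p * z ^ (2 * m)) + \<epsilon> * (s powr (\<gamma> + b) * z ^ (2 * m)) + K * L powr \<kappa>"
proof -
  have kp: "\<kappa> > p"
  proof -
    have "p * (b - p + 1) < p * (\<gamma> + b)" using p \<gamma> b by (intro mult_strict_left_mono) auto
    then show ?thesis using b by (simp add: \<kappa>_def less_divide_eq)
  qed
  define a where "a = (p - j) / p"
  define c where "c = j / \<kappa>"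
  define b' where "b' = 1 - a - c"
  have b'eq: "b' = j * (1 / p - 1 / \<kappa>)" using p by (simp add: b'_def a_def c_def field_simps)
  have c0: "c > 0" using j kp p by (auto simp: c_def)
  have a0: "a \<ge> 0" using j p by (auto simp: a_def)
  have b0: "b' \<ge> 0"
    unfolding b'eq using kp p by (intro mult_nonneg_nonneg) (auto simp: frac_le)
  have sum1: "a + b' + c = 1" by (simp add: b'_def)
  have es: "(\<gamma> - 1) * a + (\<gamma> + b) * b' = \<gamma> - 1 + j"
  proof -
    have "(\<gamma> + b) * (1 / \<kappa>) = (b - p + 1) / p" using p \<gamma> b by (simp add: \<kappa>_def)
    have "(\<gamma> + b) * b' = j * ((\<gamma> + b) * (1 / p) - (\<gamma> + b) * (1 / \<kappa>))"
      unfolding b'eq by (simp only: right_diff_distrib mult.left_commute)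
    also have "\<dots> = j * ((\<gamma> + b) / p - (b - p + 1) / p)"
      by (subst \<open>(\<gamma> + b) * (1 / \<kappa>) = (b - p + 1) / p\<close>) simp
    also have "\<dots> = j * ((\<gamma> + p - 1) / p)" by (simp add: diff_divide_distrib[symmetric])
    finally show ?thesis using p by (simp add: a_def field_simps)
  qed
  have jm: "j \<le> 2 * m" using m kp p j by linarith
  have ez: "2 * real m * (a + b') \<le> real (2 * m - j)"
  proof -
    have "a + b' = 1 - c" by (simp add: b'_def)
    moreover have "2 * real m * c \<ge> j"
    proof -
      have "2 * real m * c = j * (2 * real m / \<kappa>)" by (simp add: c_def)
      also have "\<dots> \<ge> real j * 1" using m kp p by (intro mult_left_mono) auto
      finally show ?thesis by simp
    qed
    moreover have "real (2 * m - j) = 2 * real m - j" using jm by (simp add: of_nat_diff)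
    ultimately show ?thesis by (simp only: right_diff_distrib)
  qed
  \<comment> \<open>Chosen so that the powers of \<open>\<epsilon>\<close> cancel in the product of
    the three factors.\<close>
  define K where "K = \<epsilon> powr (- (a + b') / c)"
  have "s powr (\<gamma> - 1 + j) * g powr (p - j) * z ^ (2 * m - j) * L ^ j
       \<le> \<epsilon> * (s powr (\<gamma> - 1) * g powr p * z ^ (2 * m)) + \<epsilon> * (s powr (\<gamma> + b) * z ^ (2 * m)) + K * L powr \<kappa>"
    if pos: "s > 0" "g > 0" "0 < z" "z \<le> 1" "L > 0" for s g z L
  proof -
    let ?x = "\<epsilon> * (s powr (\<gamma> - 1) * g powr p * z ^ (2 * m))"
    let ?y = "\<epsilon> * (s powr (\<gamma> + b) * z ^ (2 * m))"
    let ?w = "K * L powr \<kappa>"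
    have px: "?x powr a = \<epsilon> powr a * (s powr ((\<gamma> - 1) * a) * g powr (p * a) * z powr (2 * real m * a))"
      using pos \<epsilon> by (simp add: powr_mult powr_powr powr_realpow[symmetric])
    have py: "?y powr b' = \<epsilon> powr b' * (s powr ((\<gamma> + b) * b') * z powr (2 * real m * b'))"
      using pos \<epsilon> by (simp add: powr_mult powr_powr powr_realpow[symmetric])
    have pw: "?w powr c = \<epsilon> powr (- (a + b')) * L powr (\<kappa> * c)"
      using pos \<epsilon> c0 by (simp add: powr_mult powr_powr K_def)
    have kc: "\<kappa> * c = j" using kp p by (simp add: c_def)
    have pa: "p * a = p - j" using p by (simp add: a_def)
    have "?x powr a * ?y powr b' * ?w powr c
      = (\<epsilon> powr a * \<epsilon> powr b' * \<epsilon> powr (- (a + b'))) * (s powr ((\<gamma> - 1) * a) * s powr ((\<gamma> + b) * b')) * g powr (p - j)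
         * (z powr (2 * real m * a) * z powr (2 * real m * b')) * L powr j"
      unfolding px py pw kc pa by (simp add: mult_ac)
    also have "\<epsilon> powr a * \<epsilon> powr b' * \<epsilon> powr (- (a + b')) = 1"
      using \<epsilon> by (simp add: powr_add[symmetric])
    also have "s powr ((\<gamma> - 1) * a) * s powr ((\<gamma> + b) * b') = s powr (\<gamma> - 1 + j)"
      by (simp add: powr_add[symmetric] es)
    also have "z powr (2 * real m * a) * z powr (2 * real m * b') = z powr (2 * real m * (a + b'))"
      by (simp add: powr_add[symmetric] distrib_left)
    finally have eq: "?x powr a * ?y powr b' * ?w powr c
      = s powr (\<gamma> - 1 + j) * g powr (p - j) * z powr (2 * real m * (a + b')) * L powr j" by simp
    have "z ^ (2 * m - j) = z powr real (2 * m - j)" using pos by (simp add: powr_realpow)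
    also have "\<dots> \<le> z powr (2 * real m * (a + b'))" using ez pos by (intro powr_mono') auto
    finally have "s powr (\<gamma> - 1 + j) * g powr (p - j) * z ^ (2 * m - j) * L ^ j
      \<le> s powr (\<gamma> - 1 + j) * g powr (p - j) * z powr (2 * real m * (a + b')) * L ^ j"
      using pos by (intro mult_right_mono mult_left_mono) auto
    also have "L ^ j = L powr j" using pos by (simp add: powr_realpow)
    finally have "s powr (\<gamma> - 1 + j) * g powr (p - j) * z ^ (2 * m - j) * L ^ j \<le> ?x powr a * ?y powr b' * ?w powr c"
      using eq pos by (simp add: powr_realpow)
    also have "\<dots> \<le> ?x + ?y + ?w"
      using pos \<epsilon> a0 b0 c0 sum1 by (intro powr_product_le_sum) (auto simp: K_def)
    finally show ?thesis .
  qed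
  moreover have "K \<ge> 0" by (simp add: K_def)
  ultimately show ?thesis by blast
qed

text \<open>The number \<open>j\<close> counts derivatives that fall on the cutoff:
  \<open>j = 1\<close> belongs to the flux term and \<open>j = 2\<close> to the Hessian term. In the
  application \<open>s\<close>, \<open>g\<close>, \<open>z\<close>, \<open>L\<close> are the moduli
  of the solution and its gradient, the cutoff, and the norm of the gradient of the cutoff.\<close>

definition young_term :: "real \<Rightarrow> real \<Rightarrow> nat \<Rightarrow> nat \<Rightarrow> real \<Rightarrow> real \<Rightarrow> real \<Rightarrow> real \<Rightarrow> real" where
  "young_term p \<gamma> m j s g z L = s powr (\<gamma> - 1 + j) * (if p = j then 1 else g powr (p - j)) * z ^ (2 * m - j) * L ^ j"

text \<open>For \<open>p = j = 2\<close> the factor \<open>g\<^sup>p\<^sup>-\<^sup>j\<close> means \<open>1\<close> even at \<open>g = 0\<close>; there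
  the previous lemma is applied with \<open>g\<^sup>p = s\<^sup>b\<^sup>+\<^sup>1\<close>, which costs the factor \<open>2\<close>.\<close>

lemma Young_interpolation:
  fixes p \<gamma> b \<epsilon> :: real and j m :: nat
  defines "\<kappa> \<equiv> p * (\<gamma> + b) / (b - p + 1)"
  assumes p: "p \<ge> 2" and \<gamma>: "\<gamma> > 1" and b: "b > p - 1" and j: "j = 1 \<or> j = 2" and m: "2 * real m \<ge> \<kappa>"
    and \<epsilon>: "\<epsilon> > 0"
  shows "\<exists>K\<ge>0. \<forall>s g z L. s \<ge> 0 \<longrightarrow> g \<ge> 0 \<longrightarrow> 0 \<le> z \<longrightarrow> z \<le> 1 \<longrightarrow> L \<ge> 0 \<longrightarrow>
     young_term p \<gamma> m j s g z L
       \<le> \<epsilon> * (s powr (\<gamma> - 1) * g powr p * z ^ (2 * m)) + 2 * \<epsilon> * (s powr (\<gamma> + b) * z ^ (2 * m)) + K * L powr \<kappa>"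
proof -
  have "p * (b - p + 1) < p * (\<gamma> + b)" using p \<gamma> b by (intro mult_strict_left_mono) auto
  then have "\<kappa> > p" using b by (simp add: \<kappa>_def less_divide_eq)
  \<comment> \<open>A positive exponent of \<open>z\<close> makes the left side vanish at
    \<open>z = 0\<close>; with exponent 0 it would be 1 there.\<close>
  then have jm: "2 * m - j > 0" using m p j by linarith
  obtain K where K: "K \<ge> 0" and Y: "\<And>s g z L. s > 0 \<Longrightarrow> g > 0 \<Longrightarrow> 0 < z \<Longrightarrow> z \<le> 1 \<Longrightarrow> L > 0 \<Longrightarrow>
     s powr (\<gamma> - 1 + j) * g powr (p - j) * z ^ (2 * m - j) * L ^ j
       \<le> \<epsilon> * (s powr (\<gamma> - 1) * g powr p * z ^ (2 * m)) + \<epsilon> * (s powr (\<gamma> + b) * z ^ (2 * m)) + K * L powr \<kappa>"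
    using Young_interpolation_pos[OF p \<gamma> b j m[unfolded \<kappa>_def] \<epsilon>] unfolding \<kappa>_def by blast
  have "s powr (\<gamma> - 1 + j) * (if p = j then 1 else g powr (p - j)) * z ^ (2 * m - j) * L ^ j
       \<le> \<epsilon> * (s powr (\<gamma> - 1) * g powr p * z ^ (2 * m)) + 2 * \<epsilon> * (s powr (\<gamma> + b) * z ^ (2 * m)) + K * L powr \<kappa>"
    (is "?l \<le> ?A + 2 * \<epsilon> * ?B + ?W")
    if nn: "s \<ge> 0" "g \<ge> 0" "0 \<le> z" "z \<le> 1" "L \<ge> 0" for s g z L
  proof -
    have B0: "\<epsilon> * ?B \<ge> 0" and A0: "?A \<ge> 0" and W0: "?W \<ge> 0" using nn \<epsilon> K by auto
    consider "s = 0 \<or> z = 0 \<or> L = 0 \<or> (g = 0 \<and> p \<noteq> j)" | "s > 0" "z > 0" "L > 0" "g > 0"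
      | "s > 0" "z > 0" "L > 0" "g = 0" "p = j"
      using nn by linarith
    then show ?thesis
    proof cases
      case 1
      then have "?l = 0" using jm j by (auto simp: power_0_left)
      then show ?thesis using A0 B0 W0 by linarith
    next
      case 2
      then have "?l = s powr (\<gamma> - 1 + j) * g powr (p - j) * z ^ (2 * m - j) * L ^ j" by auto
      then show ?thesis using Y[OF 2(1,4,2) nn(4) 2(3)] B0 by linarith
    next
      case 3
      let ?g = "s powr ((b + 1) / p)"
      have "?g powr p = s powr (b + 1)" using p by (simp add: powr_powr)
      then have "s powr (\<gamma> - 1) * ?g powr p = s powr (\<gamma> + b)" by (simp add: powr_add[symmetric])
      then have eq: "\<epsilon> * (s powr (\<gamma> - 1) * ?g powr p * z ^ (2 * m)) = \<epsilon> * ?B" by simp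
      have "?g powr (p - j) = 1" using 3 by simp
      then have "?l = s powr (\<gamma> - 1 + j) * ?g powr (p - j) * z ^ (2 * m - j) * L ^ j" using 3 by simp
      moreover have "?g > 0" using 3(1) by simp
      ultimately show ?thesis using Y[OF 3(1) \<open>?g > 0\<close> 3(2) nn(4) 3(3), unfolded eq] A0 by linarith
    qed
  qed
  with K show ?thesis unfolding young_term_def by blast
qed

text \<open>Written as \<open>p + p * (\<gamma> + p - 1) / (b - p + 1)\<close>, the exponent
  \<kappa> decreases in \<open>b\<close>. Hence \<open>\<alpha>\<close> makes the strongest demand
  on \<open>m\<close>, and for \<open>R \<ge> 1\<close> the decay at \<open>\<beta>\<close> is the
  slowest, so it bounds both cases. The number 16 is the gradient bound of the cutoff.\<close>

lemma Young_two_powers: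
  fixes p \<gamma> \<alpha> \<beta> \<epsilon> c :: real and j m :: nat
  assumes p: "p \<ge> 2" and \<gamma>: "\<gamma> > 1" and \<alpha>: "\<alpha> > p - 1" and \<beta>: "\<beta> \<ge> \<alpha>" and j: "j = 1 \<or> j = 2"
    and m: "2 * real m \<ge> p * (\<gamma> + \<alpha>) / (\<alpha> - p + 1)" and \<epsilon>: "\<epsilon> > 0" and c: "c > 0"
  shows "\<exists>K\<ge>0. \<forall>s g z L R F. R \<ge> 1 \<longrightarrow> s \<ge> 0 \<longrightarrow> g \<ge> 0 \<longrightarrow> 0 \<le> z \<longrightarrow> z \<le> 1 \<longrightarrow> 0 \<le> L \<longrightarrow> L \<le> 16 / R \<longrightarrow>
     c * s powr (\<gamma> + \<beta>) \<le> F \<or> c * s powr (\<gamma> + \<alpha>) \<le> F \<longrightarrow>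
     young_term p \<gamma> m j s g z L
       \<le> \<epsilon> * (s powr (\<gamma> - 1) * g powr p * z ^ (2 * m) + F * z ^ (2 * m)) + K * R powr (- (p * (\<gamma> + \<beta>) / (\<beta> - p + 1)))"
proof -
  \<comment> \<open>The second entry turns \<open>2 * \<epsilon>' * s powr (\<gamma> + b)\<close>
    into at most \<open>\<epsilon> * F\<close>, using
    \<open>c * s powr (\<gamma> + b) \<le> F\<close>.\<close>
  define \<epsilon>' where "\<epsilon>' = min \<epsilon> (\<epsilon> * c / 2)"
  have \<epsilon>': "\<epsilon>' > 0" using \<epsilon> c by (simp add: \<epsilon>'_def)
  have \<epsilon>'1: "\<epsilon>' \<le> \<epsilon>" unfolding \<epsilon>'_def by (rule min.cobounded1)
  have "\<epsilon>' \<le> \<epsilon> * c / 2" unfolding \<epsilon>'_def by (rule min.cobounded2)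
  then have \<epsilon>'2: "2 * \<epsilon>' \<le> \<epsilon> * c" by simp
  define \<kappa> where "\<kappa> b = p * (\<gamma> + b) / (b - p + 1)" for b
  have \<kappa>eq: "\<kappa> b = p + p * (\<gamma> + p - 1) / (b - p + 1)" if "b > p - 1" for b
    using that by (simp add: \<kappa>_def field_simps)
  have \<kappa>mono: "\<kappa> \<beta> \<le> \<kappa> b \<and> \<kappa> b \<le> \<kappa> \<alpha>" if "\<alpha> \<le> b" "b \<le> \<beta>" for b
    using that \<alpha> p \<gamma> by (auto simp: \<kappa>eq intro!: frac_le)
  have \<kappa>0: "\<kappa> b \<ge> 0" if "b > p - 1" for b
    using that p \<gamma> unfolding \<kappa>_def by (intro divide_nonneg_pos mult_nonneg_nonneg) auto
  have single: "\<exists>K\<ge>0. \<forall>s g z L R F. R \<ge> 1 \<longrightarrow> s \<ge> 0 \<longrightarrow> g \<ge> 0 \<longrightarrow> 0 \<le> z \<longrightarrow> z \<le> 1 \<longrightarrow> 0 \<le> L \<longrightarrow> L \<le> 16 / R \<longrightarrow>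
     c * s powr (\<gamma> + b) \<le> F \<longrightarrow>
     young_term p \<gamma> m j s g z L
       \<le> \<epsilon> * (s powr (\<gamma> - 1) * g powr p * z ^ (2 * m) + F * z ^ (2 * m)) + K * R powr (- \<kappa> \<beta>)"
    if b: "\<alpha> \<le> b" "b \<le> \<beta>" for b
  proof -
    have bp: "b > p - 1" using b \<alpha> by simp
    have mb: "2 * real m \<ge> p * (\<gamma> + b) / (b - p + 1)" using m \<kappa>mono[OF b] by (simp add: \<kappa>_def)
    obtain K where K: "K \<ge> 0" and Y: "\<And>s g z L. s \<ge> 0 \<Longrightarrow> g \<ge> 0 \<Longrightarrow> 0 \<le> z \<Longrightarrow> z \<le> 1 \<Longrightarrow> L \<ge> 0 \<Longrightarrow>
       young_term p \<gamma> m j s g z L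
       \<le> \<epsilon>' * (s powr (\<gamma> - 1) * g powr p * z ^ (2 * m)) + 2 * \<epsilon>' * (s powr (\<gamma> + b) * z ^ (2 * m)) + K * L powr \<kappa> b"
      using Young_interpolation[OF p \<gamma> bp j mb \<epsilon>'] unfolding \<kappa>_def by blast
    have "young_term p \<gamma> m j s g z L
       \<le> \<epsilon> * (s powr (\<gamma> - 1) * g powr p * z ^ (2 * m) + F * z ^ (2 * m)) + (K * 16 powr \<kappa> b) * R powr (- \<kappa> \<beta>)"
      if h: "R \<ge> 1" "s \<ge> 0" "g \<ge> 0" "0 \<le> z" "z \<le> 1" "0 \<le> L" "L \<le> 16 / R" "c * s powr (\<gamma> + b) \<le> F" for s g z L R F
    proof -
      have 1: "\<epsilon>' * (s powr (\<gamma> - 1) * g powr p * z ^ (2 * m)) \<le> \<epsilon> * (s powr (\<gamma> - 1) * g powr p * z ^ (2 * m))"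
        using \<epsilon>'1 h by (intro mult_right_mono) auto
      have "2 * \<epsilon>' * (s powr (\<gamma> + b) * z ^ (2 * m)) \<le> \<epsilon> * c * (s powr (\<gamma> + b) * z ^ (2 * m))"
        using \<epsilon>'2 h by (intro mult_right_mono) auto
      also have "\<dots> = \<epsilon> * (c * s powr (\<gamma> + b) * z ^ (2 * m))" by simp
      also have "\<dots> \<le> \<epsilon> * (F * z ^ (2 * m))"
        using h \<epsilon> by (intro mult_left_mono mult_right_mono) auto
      finally have 2: "2 * \<epsilon>' * (s powr (\<gamma> + b) * z ^ (2 * m)) \<le> \<epsilon> * (F * z ^ (2 * m))" .
      have "L powr \<kappa> b \<le> (16 / R) powr \<kappa> b" using h \<kappa>0[OF bp] by (intro powr_mono2) auto
      also have "\<dots> = 16 powr \<kappa> b * R powr (- \<kappa> b)" using h by (simp add: powr_divide powr_minus_divide)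
      also have "\<dots> \<le> 16 powr \<kappa> b * R powr (- \<kappa> \<beta>)"
        using h \<kappa>mono[OF b] by (intro mult_left_mono powr_mono) auto
      finally have "K * L powr \<kappa> b \<le> K * (16 powr \<kappa> b * R powr (- \<kappa> \<beta>))" using K by (rule mult_left_mono)
      then have 3: "K * L powr \<kappa> b \<le> (K * 16 powr \<kappa> b) * R powr (- \<kappa> \<beta>)" by simp
      show ?thesis using Y[OF h(2-6)] 1 2 3 by argo
    qed
    moreover have "K * 16 powr \<kappa> b \<ge> 0" using K by simp
    ultimately show ?thesis by blast
  qed
  obtain K1 where K1: "K1 \<ge> 0" "\<And>s g z L R F. R \<ge> 1 \<Longrightarrow> s \<ge> 0 \<Longrightarrow> g \<ge> 0 \<Longrightarrow> 0 \<le> z \<Longrightarrow> z \<le> 1 \<Longrightarrow> 0 \<le> L \<Longrightarrow> L \<le> 16 / R \<Longrightarrow>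
     c * s powr (\<gamma> + \<alpha>) \<le> F \<Longrightarrow>
     young_term p \<gamma> m j s g z L
       \<le> \<epsilon> * (s powr (\<gamma> - 1) * g powr p * z ^ (2 * m) + F * z ^ (2 * m)) + K1 * R powr (- \<kappa> \<beta>)"
    using single[of \<alpha>] \<beta> by blast
  obtain K2 where K2: "K2 \<ge> 0" "\<And>s g z L R F. R \<ge> 1 \<Longrightarrow> s \<ge> 0 \<Longrightarrow> g \<ge> 0 \<Longrightarrow> 0 \<le> z \<Longrightarrow> z \<le> 1 \<Longrightarrow> 0 \<le> L \<Longrightarrow> L \<le> 16 / R \<Longrightarrow>
     c * s powr (\<gamma> + \<beta>) \<le> F \<Longrightarrow>
     young_term p \<gamma> m j s g z L
       \<le> \<epsilon> * (s powr (\<gamma> - 1) * g powr p * z ^ (2 * m) + F * z ^ (2 * m)) + K2 * R powr (- \<kappa> \<beta>)"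
    using single[of \<beta>] \<beta> by blast
  have "young_term p \<gamma> m j s g z L
       \<le> \<epsilon> * (s powr (\<gamma> - 1) * g powr p * z ^ (2 * m) + F * z ^ (2 * m)) + (K1 + K2) * R powr (- \<kappa> \<beta>)"
    if h: "R \<ge> 1" "s \<ge> 0" "g \<ge> 0" "0 \<le> z" "z \<le> 1" "0 \<le> L" "L \<le> 16 / R"
      "c * s powr (\<gamma> + \<beta>) \<le> F \<or> c * s powr (\<gamma> + \<alpha>) \<le> F" for s g z L R F
  proof -
    have "K1 * R powr (- \<kappa> \<beta>) \<ge> 0" "K2 * R powr (- \<kappa> \<beta>) \<ge> 0" using K1(1) K2(1) by auto
    then show ?thesis
      using h(8) K1(2)[OF h(1-7), of F] K2(2)[OF h(1-7), of F] by (simp only: distrib_right) linarith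
  qed
  moreover have "K1 + K2 \<ge> 0" using K1(1) K2(1) by simp
  ultimately show ?thesis unfolding \<kappa>_def by blast
qed

lemma exponent_choice:
  fixes p \<alpha> \<beta> :: real and n :: nat
  assumes p: "p \<ge> 2"
    and ex: "(p < real n \<and> p - 1 < \<alpha> \<and> \<alpha> \<le> \<beta> \<and> \<beta> < h_exponent n p \<alpha>)
       \<or> (p \<ge> real n \<and> p - 1 < \<alpha> \<and> \<alpha> \<le> \<beta>)"
  obtains \<gamma> where "\<gamma> > 1" "(p - 1) * (\<gamma> + 1)\<^sup>2 < 4 * \<alpha> * \<gamma>" "p * (\<gamma> + \<beta>) / (\<beta> - p + 1) > n"
proof -
  have \<alpha>: "\<alpha> > p - 1" and \<beta>: "\<beta> \<ge> \<alpha>" using ex by auto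
  define r where "r = sqrt (\<alpha> * (\<alpha> - (p - 1)))"
  \<comment> \<open>The larger root of
    \<open>(p - 1) * (\<gamma> + 1)\<^sup>2 = 4 * \<alpha> * \<gamma>\<close>.\<close>
  define \<gamma>\<^sub>0 where "\<gamma>\<^sub>0 = (2 * \<alpha> - (p - 1) + 2 * r) / (p - 1)"
  have rr: "r * r = \<alpha> * (\<alpha> - (p - 1))" and r0: "r > 0"
    using \<alpha> p by (auto simp: r_def)
  have \<gamma>\<^sub>0: "\<gamma>\<^sub>0 > 1" using \<alpha> p r0 by (simp add: \<gamma>\<^sub>0_def less_divide_eq)
  \<comment> \<open>At \<open>\<gamma> = x\<close> the decay exponent equals the dimension; larger
    values of \<open>\<gamma>\<close> exceed it.\<close>
  define x where "x = ((real n - p) * \<beta> - real n * (p - 1)) / p"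
  have x: "x < \<gamma>\<^sub>0"
  proof (cases "p < real n")
    case True
    then have "\<beta> < real n * (p - 1) / (real n - p) + p / (real n - p) * \<gamma>\<^sub>0"
      using ex by (auto simp: h_exponent_def \<gamma>\<^sub>0_def r_def)
    then have "\<beta> < (real n * (p - 1) + p * \<gamma>\<^sub>0) / (real n - p)"
      by (simp add: add_divide_distrib)
    then have "\<beta> * (real n - p) < real n * (p - 1) + p * \<gamma>\<^sub>0"
      using True by (simp add: pos_less_divide_eq)
    then have "(real n - p) * \<beta> - real n * (p - 1) < p * \<gamma>\<^sub>0" by (simp add: mult.commute)
    then show ?thesis using p by (simp add: x_def divide_less_eq mult.commute)
  next
    case False
    then have "(real n - p) * \<beta> \<le> 0" using \<alpha> \<beta> p by (intro mult_nonpos_nonneg) auto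
    moreover have "real n * (p - 1) \<ge> 0" using p by simp
    ultimately have "(real n - p) * \<beta> - real n * (p - 1) \<le> 0" by linarith
    then have "x \<le> 0" unfolding x_def using p by (intro divide_nonpos_pos) auto
    then show ?thesis using \<gamma>\<^sub>0 by simp
  qed
  \<comment> \<open>The midpoint keeps all three inequalities strict.\<close>
  define \<gamma> where "\<gamma> = (max 1 x + \<gamma>\<^sub>0) / 2"
  have \<gamma>: "\<gamma> > 1" "\<gamma> > x" "\<gamma> < \<gamma>\<^sub>0" using x \<gamma>\<^sub>0 by (auto simp: \<gamma>_def max_def)
  have "(p - 1) * (\<gamma> + 1)\<^sup>2 < 4 * \<alpha> * \<gamma>"
  proof -
    let ?d = "2 * r"
    have lt: "(p - 1) * \<gamma> - (2 * \<alpha> - (p - 1)) < ?d"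
      using \<gamma>(3) p by (simp add: \<gamma>\<^sub>0_def less_divide_eq algebra_simps)
    \<comment> \<open>This places \<open>\<gamma>\<close> above the smaller root, which lies below
      1. With \<open>lt\<close> it bounds the square obtained by completing the square in the
      quadratic condition.\<close>
    have gt: "(p - 1) * \<gamma> - (2 * \<alpha> - (p - 1)) > - ?d"
    proof -
      have "r * r > (\<alpha> - (p - 1)) * (\<alpha> - (p - 1))"
        unfolding rr using \<alpha> p by (intro mult_strict_right_mono) auto
      then have "r > \<alpha> - (p - 1)"
        using r0 \<alpha> by (meson mult_mono not_less less_imp_le order_le_less_trans order_less_irrefl diff_gt_0_iff_gt)
      moreover have "(p - 1) * \<gamma> > (p - 1) * 1" using \<gamma>(1) p by (intro mult_strict_left_mono) auto
      then have "p - 1 < (p - 1) * \<gamma>" by simp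
      with \<open>r > \<alpha> - (p - 1)\<close> show ?thesis by argo
    qed
    have "((p - 1) * \<gamma> - (2 * \<alpha> - (p - 1)))\<^sup>2 < ?d\<^sup>2"
      using power_strict_mono[of "\<bar>(p - 1) * \<gamma> - (2 * \<alpha> - (p - 1))\<bar>" ?d 2] lt gt
      by (simp only: power2_abs)
    also have "?d\<^sup>2 = 4 * (\<alpha> * (\<alpha> - (p - 1)))" by (simp add: power2_eq_square rr[symmetric])
    finally have "(p - 1) * ((p - 1) * (\<gamma> + 1)\<^sup>2) < (p - 1) * (4 * \<alpha> * \<gamma>)"
      by (simp add: power2_eq_square algebra_simps)
    then show ?thesis using p by (simp add: mult_less_cancel_left_pos)
  qed
  moreover have "p * (\<gamma> + \<beta>) / (\<beta> - p + 1) > n"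
  proof -
    have "(real n - p) * \<beta> - real n * (p - 1) < p * \<gamma>"
      using \<gamma>(2) p by (simp add: x_def divide_less_eq mult.commute)
    then have "n * (\<beta> - p + 1) < p * (\<gamma> + \<beta>)" by (simp add: algebra_simps)
    then show ?thesis using \<alpha> \<beta> by (simp add: less_divide_eq)
  qed
  ultimately show thesis using \<gamma>(1) that by blast
qed

section \<open>Cutoff functions\<close>

text \<open>Squares of positive parts are continuously differentiable, so a piecewise polynomial
  suffices. The value is 1 up to \<open>t = 1\<close> and 0 from \<open>t = 2\<close> on.\<close>

definition cutoff :: "real \<Rightarrow> real" where
  "cutoff t = (max 0 (1 - (max 0 (t - 1))\<^sup>2))\<^sup>2"

definition cutoff' :: "real \<Rightarrow> real" where
  "cutoff' t = - 4 * max 0 (1 - (max 0 (t - 1))\<^sup>2) * max 0 (t - 1)"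

lemma DERIV_max0_squared: "DERIV (\<lambda>s::real. (max 0 s)\<^sup>2) s :> 2 * max 0 s"
proof (cases s "0::real" rule: linorder_cases)
  case less
  have "DERIV (\<lambda>s. 0) s :> 2 * max 0 s" using less by simp
  then show ?thesis
    by (rule has_field_derivative_transform_within_open[where S="{..<0}"]) (use less in auto)
next
  case equal
  have "((\<lambda>h::real. max 0 h) \<longlongrightarrow> max 0 0) (at 0)" by (intro tendsto_intros)
  then have *: "((\<lambda>h::real. max 0 h) \<longlongrightarrow> 0) (at 0)" by simp
  have "((\<lambda>h::real. ((max 0 (0 + h))\<^sup>2 - (max 0 0)\<^sup>2) / h) \<longlongrightarrow> 0) (at 0)"
    by (rule Lim_transform_eventually[OF *])
       (auto simp: eventually_at_filter max_def power2_eq_square)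
  then show ?thesis using equal by (simp add: DERIV_def)
next
  case greater
  have "DERIV (\<lambda>s. s\<^sup>2) s :> 2 * max 0 s" using greater by (auto intro!: derivative_eq_intros)
  then show ?thesis
    by (rule has_field_derivative_transform_within_open[where S="{0<..}"]) (use greater in auto)
qed

lemma DERIV_cutoff: "DERIV cutoff t :> cutoff' t"
proof -
  have "DERIV (\<lambda>t::real. t - 1) t :> 1" by (auto intro!: derivative_eq_intros)
  from DERIV_diff[OF DERIV_const[of 1] DERIV_chain2[OF DERIV_max0_squared this]]
  have "DERIV (\<lambda>t. 1 - (max 0 (t - 1))\<^sup>2) t :> - (2 * max 0 (t - 1))"
    by simp
  from DERIV_chain2[OF DERIV_max0_squared this] show ?thesis
    by (simp add: cutoff_def[abs_def] cutoff'_def mult_ac)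
qed

lemma cutoff_eq_1: "t \<le> 1 \<Longrightarrow> cutoff t = 1"
  by (simp add: cutoff_def)

lemma cutoff_eq_0:
  assumes "t \<ge> 2"
  shows "cutoff t = 0" "cutoff' t = 0"
proof -
  have "1 * 1 \<le> (t - 1) * (t - 1)" using assms by (intro mult_mono) auto
  then have "max 0 (1 - (max 0 (t - 1))\<^sup>2) = 0" using assms by (simp add: power2_eq_square max_def)
  then show "cutoff t = 0" "cutoff' t = 0" by (simp_all add: cutoff_def cutoff'_def)
qed

lemma cutoff_bounds: "0 \<le> cutoff t" "cutoff t \<le> 1" "\<bar>cutoff' t\<bar> \<le> 4"
proof -
  define y where "y = max 0 (1 - (max 0 (t - 1))\<^sup>2)"
  have y: "0 \<le> y" "y \<le> 1" by (auto simp: y_def)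
  show "0 \<le> cutoff t" by (simp add: cutoff_def)
  show "cutoff t \<le> 1" unfolding cutoff_def y_def[symmetric] using y by (simp add: power_le_one)
  show "\<bar>cutoff' t\<bar> \<le> 4"
  proof (cases "t \<ge> 2")
    case False
    then have "\<bar>y\<bar> * \<bar>max 0 (t - 1)\<bar> \<le> 1 * 1" using y by (intro mult_mono) auto
    then show ?thesis unfolding cutoff'_def y_def[symmetric] by (simp add: abs_mult)
  qed (simp add: cutoff_eq_0)
qed

text \<open>Using \<open>x \<bullet> x\<close> instead of the norm keeps the inner function smooth
  at the origin. The cutoff already vanishes where \<open>x \<bullet> x \<ge> 2 * R\<^sup>2\<close>,
  in particular outside the ball of radius \<open>2 * R\<close>.\<close>

definition cutoff_ball :: "real \<Rightarrow> 'a::real_inner \<Rightarrow> real" where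
  "cutoff_ball R x = cutoff (x \<bullet> x / R\<^sup>2)"

definition grad_cutoff_ball :: "real \<Rightarrow> 'a::real_inner \<Rightarrow> 'a" where
  "grad_cutoff_ball R x = (2 * cutoff' (x \<bullet> x / R\<^sup>2) / R\<^sup>2) *\<^sub>R x"

lemma C1_gradient_cutoff_ball:
  shows "C1_gradient (cutoff_ball R) (grad_cutoff_ball R :: 'a::real_inner \<Rightarrow> 'a)"
proof -
  have "GDERIV (cutoff_ball R) x :> grad_cutoff_ball R x" for x :: 'a
  proof -
    have "GDERIV (\<lambda>x. x \<bullet> x / R\<^sup>2) x :> (2 / R\<^sup>2) *\<^sub>R x"
      unfolding gderiv_def by (auto intro!: derivative_eq_intros simp: inner_commute divide_inverse)
    from GDERIV_DERIV_compose[OF this DERIV_cutoff]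
    show ?thesis by (simp add: cutoff_ball_def[abs_def] grad_cutoff_ball_def mult.commute)
  qed
  moreover have "continuous_on UNIV (grad_cutoff_ball R :: 'a \<Rightarrow> 'a)"
    unfolding grad_cutoff_ball_def cutoff'_def divide_inverse by (intro continuous_intros)
  ultimately show ?thesis by (simp add: C1_gradient_def)
qed

lemma cutoff_ball_bounds: "0 \<le> cutoff_ball R x" "cutoff_ball R x \<le> 1"
  by (simp_all add: cutoff_ball_def cutoff_bounds)

lemma cutoff_ball_eq_1:
  assumes "R > 0" "norm x \<le> R"
  shows "cutoff_ball R x = 1"
proof -
  have "x \<bullet> x \<le> R\<^sup>2" using power_mono[OF assms(2), of 2] by (simp add: power2_norm_eq_inner)
  then show ?thesis using assms(1) by (simp add: cutoff_ball_def cutoff_eq_1)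
qed

lemma cutoff_ball_eq_0:
  assumes "R > 0" "norm x \<ge> 2 * R"
  shows "cutoff_ball R x = 0" "grad_cutoff_ball R x = 0"
proof -
  have "(2 * R)\<^sup>2 \<le> x \<bullet> x" using power_mono[OF assms(2), of 2] assms(1) by (simp add: power2_norm_eq_inner)
  then have "2 * R\<^sup>2 \<le> x \<bullet> x" by (simp add: power_mult_distrib add_increasing2) (smt (verit) zero_le_power2)
  then have "2 \<le> x \<bullet> x / R\<^sup>2" using assms(1) by (simp add: le_divide_eq)
  then show "cutoff_ball R x = 0" "grad_cutoff_ball R x = 0"
    by (simp_all add: cutoff_ball_def grad_cutoff_ball_def cutoff_eq_0)
qed

lemma norm_grad_cutoff_ball:
  assumes "R > 0"
  shows "norm (grad_cutoff_ball R x) \<le> 16 / R"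
proof (cases "norm x \<ge> 2 * R")
  case False
  have "norm (grad_cutoff_ball R x) = 2 * \<bar>cutoff' (x \<bullet> x / R\<^sup>2)\<bar> / R\<^sup>2 * norm x"
    using assms by (simp add: grad_cutoff_ball_def abs_mult)
  \<comment> \<open>The constant 16 collects 2 from differentiating the square, 4 from
    \<open>cutoff'\<close>, and 2 from the radius of the support.\<close>
  also have "\<dots> \<le> (2 * 4 / R\<^sup>2) * (2 * R)"
    using False cutoff_bounds(3) assms by (intro mult_mono divide_right_mono) auto
  also have "\<dots> = 16 / R" using assms by (simp add: power2_eq_square)
  finally show ?thesis .
next
  case True
  then show ?thesis using cutoff_ball_eq_0(2)[OF assms True] assms by simp
qed

text \<open>The equation expresses \<open>I1\<close> through \<open>I2\<close> and \<open>X\<close>.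
  Inserted into stability it leaves \<open>\<alpha> - A\<close> in front of \<open>I2\<close>, which
  is positive exactly by the quadratic condition on \<open>\<gamma>\<close>; the error terms are
  absorbed there.\<close>

lemma energy_absorption:
  fixes \<gamma> p \<alpha> :: real
  assumes \<gamma>: "\<gamma> > 1" and p: "p \<ge> 2" and lt: "(p - 1) * (\<gamma> + 1)\<^sup>2 < 4 * \<alpha> * \<gamma>"
  obtains \<epsilon> C where "\<epsilon> > 0" "C > 0"
    "\<And>I1 I2 X Y E. I1 \<ge> 0 \<Longrightarrow> I2 \<ge> 0 \<Longrightarrow> E \<ge> 0 \<Longrightarrow> \<gamma> * I1 + 2 * X = I2 \<Longrightarrow>
      \<alpha> * I2 \<le> ((\<gamma> + 1) / 2)\<^sup>2 * (p - 1) * I1 + (\<gamma> + 1) * (p - 1) * X + Y \<Longrightarrow>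
      \<bar>X\<bar> \<le> \<epsilon> * (I1 + I2) + E \<Longrightarrow> \<bar>Y\<bar> \<le> \<epsilon> * (I1 + I2) + E \<Longrightarrow> I2 \<le> C * E"
proof -
  define A where "A = ((\<gamma> + 1) / 2)\<^sup>2 * (p - 1) / \<gamma>"
  define B where "B = 2 * A + (\<gamma> + 1) * (p - 1)"
  define \<delta> where "\<delta> = \<alpha> - A"
  have A0: "A > 0" using \<gamma> p by (simp add: A_def)
  then have B0: "B > 0" using \<gamma> p by (simp add: B_def add_pos_nonneg)
  have "A * (4 * \<gamma>) = (p - 1) * (\<gamma> + 1)\<^sup>2" using \<gamma> by (simp add: A_def power_divide)
  then have "A * (4 * \<gamma>) < \<alpha> * (4 * \<gamma>)" using lt by (simp add: mult_ac)
  then have \<delta>: "\<delta> > 0" using \<gamma> by (simp add: \<delta>_def)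
  define \<epsilon> where "\<epsilon> = min (1 / 4) (\<delta> / (8 * (B + 1)))"
  define C where "C = 1 + 2 * (B + 1) / \<delta>"
  have \<epsilon>: "\<epsilon> > 0" "\<epsilon> \<le> 1 / 4" "8 * (B + 1) * \<epsilon> \<le> \<delta>"
  proof -
    show "\<epsilon> > 0" using \<delta> B0 by (simp add: \<epsilon>_def)
    show "\<epsilon> \<le> 1 / 4" unfolding \<epsilon>_def by (rule min.cobounded1)
    have "\<epsilon> \<le> \<delta> / (8 * (B + 1))" unfolding \<epsilon>_def by (rule min.cobounded2)
    then show "8 * (B + 1) * \<epsilon> \<le> \<delta>" using B0 by (simp add: le_divide_eq mult_ac)
  qed
  have C0: "C > 0" using \<delta> B0 by (simp add: C_def add_pos_pos)
  have "I2 \<le> C * E"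
    if I: "I1 \<ge> 0" "I2 \<ge> 0" "E \<ge> 0" and eq: "\<gamma> * I1 + 2 * X = I2"
      and st: "\<alpha> * I2 \<le> ((\<gamma> + 1) / 2)\<^sup>2 * (p - 1) * I1 + (\<gamma> + 1) * (p - 1) * X + Y"
      and X: "\<bar>X\<bar> \<le> \<epsilon> * (I1 + I2) + E" and Y: "\<bar>Y\<bar> \<le> \<epsilon> * (I1 + I2) + E" for I1 I2 X Y E
  proof -
    have "((\<gamma> + 1) / 2)\<^sup>2 * (p - 1) * I1 = A * (\<gamma> * I1)" using \<gamma> by (simp add: A_def)
    also have "\<dots> = A * (I2 - 2 * X)" by (simp add: eq[symmetric])
    finally have "\<delta> * I2 \<le> ((\<gamma> + 1) * (p - 1) - 2 * A) * X + Y"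
      using st by (simp add: \<delta>_def algebra_simps)
    also have "\<dots> \<le> B * \<bar>X\<bar> + \<bar>Y\<bar>"
    proof -
      have "((\<gamma> + 1) * (p - 1) - 2 * A) * X \<le> \<bar>(\<gamma> + 1) * (p - 1) - 2 * A\<bar> * \<bar>X\<bar>"
        by (metis abs_ge_self abs_mult)
      also have "\<dots> \<le> B * \<bar>X\<bar>" using A0 \<gamma> p by (intro mult_right_mono) (auto simp: B_def abs_le_iff)
      finally show ?thesis by simp
    qed
    also have "\<dots> \<le> B * (\<epsilon> * (I1 + I2) + E) + (\<epsilon> * (I1 + I2) + E)"
      using X Y B0 by (intro add_mono mult_left_mono) auto
    also have "\<dots> = (B + 1) * (\<epsilon> * (I1 + I2)) + (B + 1) * E" by (simp add: algebra_simps)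
    finally have 1: "\<delta> * I2 \<le> (B + 1) * (\<epsilon> * (I1 + I2)) + (B + 1) * E" .
    \<comment> \<open>Stability was used up for \<open>I2\<close>; the sum \<open>I1 + I2\<close> in
      the error is estimated by the equation and the bound on \<open>X\<close>.\<close>
    have "I1 \<le> \<gamma> * I1" using I \<gamma> by (simp add: mult_right_le_one_le mult_le_cancel_right1)
    moreover have "\<epsilon> * (I1 + I2) \<le> (1 / 4) * (I1 + I2)" using I \<epsilon> by (intro mult_right_mono) auto
    ultimately have "I1 + I2 \<le> 4 * I2 + 4 * E" using X eq abs_ge_minus_self[of X] by argo
    then have "(B + 1) * \<epsilon> * (I1 + I2) \<le> (B + 1) * \<epsilon> * (4 * I2 + 4 * E)"
      using B0 \<epsilon> by (intro mult_left_mono) auto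
    also have "\<dots> = 8 * (B + 1) * \<epsilon> * ((I2 + E) / 2)" by (simp add: field_simps)
    also have "\<dots> \<le> \<delta> * ((I2 + E) / 2)" using \<epsilon>(3) I by (intro mult_right_mono) auto
    finally have "\<delta> * I2 \<le> \<delta> * ((I2 + E) / 2) + (B + 1) * E" using 1 by argo
    then have "\<delta> * I2 \<le> \<delta> * E + 2 * (B + 1) * E" by argo
    also have "\<dots> = \<delta> * (C * E)" using \<delta> by (simp add: C_def field_simps)
    finally show ?thesis using \<delta> by (simp add: mult_le_cancel_left_pos)
  qed
  with \<epsilon>(1) C0 that show thesis by blast
qed

section \<open>Test functions built from the solution\<close>

lemma C1_real:
  fixes f :: "real \<Rightarrow> real"
  assumes "Ck_on 1 UNIV f"
  shows "DERIV f s :> deriv f s" "continuous_on UNIV (deriv f)" "continuous_on UNIV f"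
proof -
  have d: "f differentiable (at s)" for s using assms by simp
  then show D: "DERIV f s :> deriv f s" for s
    by (simp add: DERIV_deriv_iff_real_differentiable)
  have "frechet_derivative f (at s) 1 = deriv f s" for s
    using GDERIV_frechet_derivative[of f s "deriv f s" 1] D[of s] by simp
  moreover have "continuous_on UNIV (\<lambda>s. frechet_derivative f (at s) 1)" using assms by simp
  ultimately show "continuous_on UNIV (deriv f)" by simp
  show "continuous_on UNIV f"
    using D DERIV_isCont by (auto intro!: continuous_at_imp_continuous_on)
qed

lemma measurable_vec_nth [measurable (raw)]:
  fixes F :: "'a \<Rightarrow> real ^ 'n::finite"
  assumes "F \<in> borel_measurable M"
  shows "(\<lambda>x. F x $ i) \<in> borel_measurable M"
  by (rule measurable_compose[OF assms]) (simp add: borel_measurable_continuous_onI continuous_on_component)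

lemma Linf_loc_compose_Lp_loc:
  fixes f :: "real \<Rightarrow> real"
  assumes u: "u \<in> Linf_loc" and f: "continuous_on UNIV f"
  shows "(\<lambda>x. f (u x)) \<in> Lp_loc 1"
proof -
  have um[measurable]: "u \<in> borel_measurable lebesgue" using u by (simp add: Linf_loc_def)
  have [measurable]: "f \<in> borel_measurable borel" using f by (rule borel_measurable_continuous_onI)
  have "set_integrable lebesgue K (\<lambda>x. norm (f (u x)) powr 1)" if K: "compact K" for K
  proof -
    obtain B where B: "AE x in lebesgue. x \<in> K \<longrightarrow> \<bar>u x\<bar> \<le> B" using u K by (auto simp: Linf_loc_def)
    have "compact (f ` {- B..B})" by (intro compact_continuous_image continuous_on_subset[OF f]) auto
    then obtain C where C: "C > 0" "\<And>y. y \<in> f ` {- B..B} \<Longrightarrow> norm y \<le> C"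
      using compact_imp_bounded bounded_pos by metis
    have [measurable]: "K \<in> sets lebesgue" using K by (simp add: borel_compact)
    have i: "integrable lebesgue (\<lambda>x. C * indicator K x :: real)"
      using fmeasurableD2[OF lmeasurable_compact[OF K]]
      by (intro integrable_mult_right integrable_real_indicator) (auto simp: less_top)
    show ?thesis unfolding set_integrable_def
    proof (rule Bochner_Integration.integrable_bound[OF i])
      show "AE x in lebesgue. norm (indicator K x *\<^sub>R norm (f (u x)) powr 1) \<le> norm (C * indicator K x :: real)"
        using B
      proof eventually_elim
        case (elim x)
        show ?case
        proof (cases "x \<in> K")
          case True
          then have "u x \<in> {- B..B}" using elim by (auto simp: abs_le_iff)
          then show ?thesis using C(2)[of "f (u x)"] True C(1) by simp
        qed simp
      qed
    qed measurable
  qed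
  then show ?thesis by (simp add: Lp_loc_def)
qed

context gauge
begin

lemma a_field_Lp_loc:
  assumes G: "G \<in> Lp_loc p"
  shows "(\<lambda>x. a_field p H (G x)) \<in> Lp_loc 1"
proof -
  obtain C where C: "C > 0" "\<And>\<xi>. norm (a_field p H \<xi>) \<le> C * norm \<xi> powr (p - 1)"
    using a_field_upper by blast
  have [measurable]: "G \<in> borel_measurable lebesgue" using G by (simp add: Lp_loc_def)
  have G': "G \<in> Lp_loc (p - 1)" using Lp_loc_mono[OF G] p by simp
  have "set_integrable lebesgue K (\<lambda>x. norm (a_field p H (G x)) powr 1)" if K: "compact K" for K
  proof -
    have [measurable]: "K \<in> sets lebesgue" using K by (simp add: borel_compact)
    have i: "integrable lebesgue (\<lambda>x. C * (indicator K x *\<^sub>R norm (G x) powr (p - 1)))"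
      using G' K by (simp add: Lp_loc_def set_integrable_def)
    show ?thesis unfolding set_integrable_def
      by (rule Bochner_Integration.integrable_bound[OF i])
         (use C in \<open>auto simp: indicator_def abs_mult\<close>)
  qed
  then show ?thesis by (simp add: Lp_loc_def)
qed

end

lemma majorized_integrable:
  fixes g w :: "'a \<Rightarrow> real"
  assumes "integrable M w" "g \<in> borel_measurable M" "AE x in M. \<bar>g x\<bar> \<le> C * w x"
  shows "integrable M g"
  by (rule Bochner_Integration.integrable_bound[where f="\<lambda>x. C * w x"])
     (use assms in \<open>auto elim!: eventually_mono\<close>)

text \<open>The data shared by the two test-function computations: \<open>v\<^sub>k \<rightarrow> u\<close> and \<open>D\<^sub>k \<rightarrow> G\<close>
  almost everywhere on the support of the cutoff \<open>\<theta>\<close>, with the majorant \<open>S\<close> in \<open>L\<^sup>p\<close>.\<close>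

locale test_data = gauge H p Z
  for H :: "real ^ 'n::finite \<Rightarrow> real" and p :: real and Z :: "real ^ 'n ^ 'n" +
  fixes u :: "real ^ 'n \<Rightarrow> real" and G :: "real ^ 'n \<Rightarrow> real ^ 'n"
    and \<theta> :: "real ^ 'n \<Rightarrow> real" and \<theta>' :: "real ^ 'n \<Rightarrow> real ^ 'n" and r B T :: real
    and v :: "nat \<Rightarrow> real ^ 'n \<Rightarrow> real" and D :: "nat \<Rightarrow> real ^ 'n \<Rightarrow> real ^ 'n" and S :: "real ^ 'n \<Rightarrow> real"
  assumes um [measurable]: "u \<in> borel_measurable lebesgue" and Gm [measurable]: "G \<in> borel_measurable lebesgue"
    and Sm [measurable]: "S \<in> borel_measurable lebesgue"
    and \<theta>: "C1_gradient \<theta> \<theta>'" "\<And>x. norm x \<ge> r \<Longrightarrow> \<theta> x = 0"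
    and T: "\<And>x. \<bar>\<theta> x\<bar> \<le> T" "\<And>x. norm (\<theta>' x) \<le> T"
    and uB: "AE x in lebesgue. norm x \<le> r \<longrightarrow> \<bar>u x\<bar> \<le> B"
    and v: "\<And>k. C1_gradient (v k) (D k)" and vB: "\<And>k x. norm x \<le> r \<Longrightarrow> \<bar>v k x\<bar> \<le> B"
    and S1: "\<And>x. S x \<ge> 1" and SI: "integrable lebesgue (\<lambda>x. indicator (cball 0 r) x * S x powr p)"
    and lim: "AE x in lebesgue. norm x \<le> r \<longrightarrow> (\<lambda>k. v k x) \<longlonglongrightarrow> u x \<and> (\<lambda>k. D k x) \<longlonglongrightarrow> G x \<and>
       norm (G x) \<le> S x \<and> (\<forall>k. norm (D k x) \<le> S x)"
begin

abbreviation \<Omega> :: "real ^ 'n \<Rightarrow> real" where "\<Omega> x \<equiv> indicator (cball 0 r) x * S x powr p"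

lemma \<theta>'0: "norm x \<ge> r \<Longrightarrow> \<theta>' x = 0"
  by (rule C1_gradient_outside_support[OF \<theta>])

lemma T0: "T \<ge> 0"
  using T(1) abs_ge_zero order_trans by blast

lemma C1_measurable [measurable]:
  "v k \<in> borel_measurable lebesgue" "D k \<in> borel_measurable lebesgue"
  "\<theta> \<in> borel_measurable lebesgue" "\<theta>' \<in> borel_measurable lebesgue"
  using C1_gradient_continuous[OF v] C1_gradient_continuous[OF \<theta>(1)]
  by (auto intro!: continuous_lebesgue_measurable)

lemma S_powr_ge_1: "S x powr p \<ge> 1"
  using S1[of x] p by (simp add: ge_one_powr_ge_zero)

lemma hess_form_measurable [measurable]:
  assumes [measurable]: "V \<in> borel_measurable lebesgue" "W \<in> borel_measurable lebesgue"
  shows "(\<lambda>x. hess_form (G x) (V x) (W x)) \<in> borel_measurable lebesgue"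
proof -
  have [measurable]: "(\<lambda>x. hessian_Hp p H Z (G x) $ i $ j) \<in> borel_measurable lebesgue" for i j
    by (rule measurable_compose[OF Gm hessian_Hp_measurable])
  show ?thesis unfolding hess_form_def by measurable
qed

section \<open>Signed powers of the approximations as test functions\<close>

lemma test_function:
  assumes q: "q > 1"
  shows "C1_gradient (\<lambda>x. \<bar>v k x\<bar> powr (q - 1) * v k x * \<theta> x)
     (\<lambda>x. (q * \<bar>v k x\<bar> powr (q - 1) * \<theta> x) *\<^sub>R D k x + (\<bar>v k x\<bar> powr (q - 1) * v k x) *\<^sub>R \<theta>' x)"
proof -
  note c = C1_gradient_continuous[OF v[of k]] C1_gradient_continuous[OF \<theta>(1)]
  have cp: "continuous_on UNIV (\<lambda>x. \<bar>v k x\<bar> powr (q - 1))"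
    using continuous_on_compose2[OF continuous_on_abs_powr c(1), of "q - 1"] q by simp
  have "continuous_on UNIV (\<lambda>x. (q * \<bar>v k x\<bar> powr (q - 1) * \<theta> x) *\<^sub>R D k x + (\<bar>v k x\<bar> powr (q - 1) * v k x) *\<^sub>R \<theta>' x)"
    by (intro continuous_on_add continuous_on_scaleR continuous_on_mult continuous_on_const cp c)
  moreover have "GDERIV (\<lambda>x. \<bar>v k x\<bar> powr (q - 1) * v k x * \<theta> x) x
      :> (q * \<bar>v k x\<bar> powr (q - 1) * \<theta> x) *\<^sub>R D k x + (\<bar>v k x\<bar> powr (q - 1) * v k x) *\<^sub>R \<theta>' x" for x
  proof -
    have "GDERIV (v k) x :> D k x" using v[of k] unfolding C1_gradient_def by blast
    from GDERIV_DERIV_compose[OF this DERIV_signed_powr[OF q]]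
    have "GDERIV (\<lambda>x. \<bar>v k x\<bar> powr (q - 1) * v k x) x :> (q * \<bar>v k x\<bar> powr (q - 1)) *\<^sub>R D k x" .
    from GDERIV_mult[OF this] \<theta>(1) show ?thesis
      by (auto simp: C1_gradient_def add.commute mult.commute)
  qed
  ultimately show ?thesis by (simp add: C1_gradient_def)
qed

lemma test_gradient_bound:
  assumes q: "q > 1" and x: "norm x \<le> r" and s: "\<bar>s\<bar> \<le> B" and d: "norm d \<le> S x"
  shows "norm ((q * \<bar>s\<bar> powr (q - 1) * \<theta> x) *\<^sub>R d + (\<bar>s\<bar> powr (q - 1) * s) *\<^sub>R \<theta>' x)
     \<le> (q * B powr (q - 1) * T + B powr (q - 1) * B * T) * S x"
proof -
  have B0: "B \<ge> 0" using s by simp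
  have sp: "\<bar>s\<bar> powr (q - 1) \<le> B powr (q - 1)" using s q by (intro powr_mono2) auto
  have "norm ((q * \<bar>s\<bar> powr (q - 1) * \<theta> x) *\<^sub>R d) \<le> (q * B powr (q - 1) * T) * S x"
    unfolding norm_scaleR abs_mult using q sp T d B0 T0 by (intro mult_mono) auto
  moreover have "norm ((\<bar>s\<bar> powr (q - 1) * s) *\<^sub>R \<theta>' x) \<le> (B powr (q - 1) * B) * T"
    unfolding norm_scaleR abs_mult using s sp T B0 by (intro mult_mono) auto
  \<comment> \<open>The term without a gradient is bounded by a constant, and
    \<open>S \<ge> 1\<close> puts it under the same majorant.\<close>
  moreover have "(B powr (q - 1) * B) * T \<le> (B powr (q - 1) * B * T) * S x"
    using S1[of x] B0 T0 mult_left_mono[of 1 "S x" "B powr (q - 1) * B * T"] by simp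
  ultimately have "norm ((q * \<bar>s\<bar> powr (q - 1) * \<theta> x) *\<^sub>R d + (\<bar>s\<bar> powr (q - 1) * s) *\<^sub>R \<theta>' x)
    \<le> (q * B powr (q - 1) * T) * S x + (B powr (q - 1) * B * T) * S x"
    by (intro order_trans[OF norm_triangle_ineq]) linarith
  then show ?thesis by (simp only: distrib_right)
qed

lemma test_gradient_tendsto:
  assumes q: "q > 1" and s: "(\<lambda>k. s k) \<longlonglongrightarrow> t" and d: "(\<lambda>k. d k) \<longlonglongrightarrow> e"
  shows "(\<lambda>k. \<bar>s k\<bar> powr (q - 1) * s k) \<longlonglongrightarrow> \<bar>t\<bar> powr (q - 1) * t"
    "(\<lambda>k. (q * \<bar>s k\<bar> powr (q - 1) * \<theta> x) *\<^sub>R d k + (\<bar>s k\<bar> powr (q - 1) * s k) *\<^sub>R \<theta>' x)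
      \<longlonglongrightarrow> (q * \<bar>t\<bar> powr (q - 1) * \<theta> x) *\<^sub>R e + (\<bar>t\<bar> powr (q - 1) * t) *\<^sub>R \<theta>' x"
proof -
  have *: "(\<lambda>k. \<bar>s k\<bar> powr (q - 1)) \<longlonglongrightarrow> \<bar>t\<bar> powr (q - 1)"
    using q by (intro tendsto_powr' tendsto_rabs s) auto
  show "(\<lambda>k. \<bar>s k\<bar> powr (q - 1) * s k) \<longlonglongrightarrow> \<bar>t\<bar> powr (q - 1) * t"
    "(\<lambda>k. (q * \<bar>s k\<bar> powr (q - 1) * \<theta> x) *\<^sub>R d k + (\<bar>s k\<bar> powr (q - 1) * s k) *\<^sub>R \<theta>' x)
      \<longlonglongrightarrow> (q * \<bar>t\<bar> powr (q - 1) * \<theta> x) *\<^sub>R e + (\<bar>t\<bar> powr (q - 1) * t) *\<^sub>R \<theta>' x"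
    by (intro tendsto_add tendsto_scaleR tendsto_mult tendsto_const * s d)+
qed

abbreviation limit_gradient :: "real \<Rightarrow> real ^ 'n \<Rightarrow> real ^ 'n" where
  "limit_gradient q x \<equiv> (q * \<bar>u x\<bar> powr (q - 1) * \<theta> x) *\<^sub>R G x + (\<bar>u x\<bar> powr (q - 1) * u x) *\<^sub>R \<theta>' x"

lemma S_powr_split: "S x powr a * S x powr b = S x powr (a + b)"
  by (simp add: powr_add)

text \<open>Only the test function depends on \<open>k\<close>, while the flux stays at
  \<open>G\<close>. Its growth \<open>p - 1\<close> and the linear growth of the test gradient
  combine to the integrable majorant \<open>S powr p\<close>.\<close>

lemma weak_equation_limit:
  assumes q: "q > 1" and F: "F \<in> Lp_loc 1" and GA: "G \<in> Lp_loc p"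
    and eq: "\<And>\<phi>. \<phi> \<in> Cc_infinity \<Longrightarrow>
       (\<integral>x. a_field p H (G x) \<bullet> grad \<phi> x \<partial>lebesgue) = (\<integral>x. F x * \<phi> x \<partial>lebesgue)"
  shows "(\<integral>x. a_field p H (G x) \<bullet> limit_gradient q x \<partial>lebesgue)
      = (\<integral>x. F x * (\<bar>u x\<bar> powr (q - 1) * u x * \<theta> x) \<partial>lebesgue)"
proof -
  define \<phi> where "\<phi> k x = \<bar>v k x\<bar> powr (q - 1) * v k x * \<theta> x" for k x
  define d\<phi> where "d\<phi> k x = (q * \<bar>v k x\<bar> powr (q - 1) * \<theta> x) *\<^sub>R D k x + (\<bar>v k x\<bar> powr (q - 1) * v k x) *\<^sub>R \<theta>' x" for k x
  have \<phi>: "C1_gradient (\<phi> k) (d\<phi> k)" for k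
    unfolding \<phi>_def[abs_def] d\<phi>_def[abs_def] by (rule test_function[OF q])
  have id: "(\<integral>x. a_field p H (G x) \<bullet> d\<phi> k x \<partial>lebesgue) = (\<integral>x. F x * \<phi> k x \<partial>lebesgue)" for k
    by (rule weak_equation_C1[OF a_field_Lp_loc[OF GA] F eq \<phi>, where r=r])
       (use \<theta>(2) in \<open>auto simp: \<phi>_def\<close>)
  obtain Ca where Ca: "Ca > 0" "\<And>\<xi>. norm (a_field p H \<xi>) \<le> Ca * norm \<xi> powr (p - 1)"
    using a_field_upper by blast
  have [measurable]: "F \<in> borel_measurable lebesgue" using F by (simp add: Lp_loc_def)
  have [measurable]: "(\<lambda>x. a_field p H (G x)) \<in> borel_measurable lebesgue"
    by (rule measurable_compose[OF Gm a_field_measurable])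
  define C where "C = q * B powr (q - 1) * T + B powr (q - 1) * B * T"
  have 1: "(\<lambda>k. \<integral>x. a_field p H (G x) \<bullet> d\<phi> k x \<partial>lebesgue) \<longlonglongrightarrow> (\<integral>x. a_field p H (G x) \<bullet> limit_gradient q x \<partial>lebesgue)"
  proof (rule integral_dominated_convergence[where w="\<lambda>x. Ca * C * \<Omega> x"])
    show "integrable lebesgue (\<lambda>x. Ca * C * \<Omega> x)" using SI by simp
    show "AE x in lebesgue. (\<lambda>k. a_field p H (G x) \<bullet> d\<phi> k x) \<longlonglongrightarrow> a_field p H (G x) \<bullet> limit_gradient q x"
      using lim
    proof eventually_elim
      case (elim x)
      show ?case
      proof (cases "norm x \<le> r")
        case True
        then show ?thesis
          using elim unfolding d\<phi>_def by (intro tendsto_inner tendsto_const test_gradient_tendsto(2) q) auto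
      next
        case False
        then show ?thesis using \<theta>(2)[of x] \<theta>'0[of x] by (simp add: d\<phi>_def)
      qed
    qed
    show "AE x in lebesgue. norm (a_field p H (G x) \<bullet> d\<phi> k x) \<le> Ca * C * \<Omega> x" for k
      using lim
    proof eventually_elim
      case (elim x)
      show ?case
      proof (cases "norm x \<le> r")
        case True
        have "norm (a_field p H (G x) \<bullet> d\<phi> k x) \<le> norm (a_field p H (G x)) * norm (d\<phi> k x)"
          using Cauchy_Schwarz_ineq2 by simp
        also have "\<dots> \<le> (Ca * S x powr (p - 1)) * (C * S x)"
        proof (intro mult_mono)
          have "norm (G x) powr (p - 1) \<le> S x powr (p - 1)" using elim True p by (intro powr_mono2) auto
          then show "norm (a_field p H (G x)) \<le> Ca * S x powr (p - 1)"
            using Ca(2)[of "G x"] mult_left_mono[of _ _ Ca] Ca(1) by (meson less_imp_le order_trans)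
          show "norm (d\<phi> k x) \<le> C * S x"
            unfolding d\<phi>_def C_def using elim True vB by (intro test_gradient_bound q) auto
        qed (use Ca in auto)
        also have "\<dots> = Ca * C * (S x powr (p - 1) * S x powr 1)" using S1[of x] by simp
        also have "\<dots> = Ca * C * \<Omega> x" using True by (simp only: S_powr_split) simp
        finally show ?thesis .
      next
        case False
        then show ?thesis using \<theta>(2)[of x] \<theta>'0[of x] by (simp add: d\<phi>_def)
      qed
    qed
  qed (unfold d\<phi>_def, measurable)
  have 2: "(\<lambda>k. \<integral>x. F x * \<phi> k x \<partial>lebesgue) \<longlonglongrightarrow> (\<integral>x. F x * (\<bar>u x\<bar> powr (q - 1) * u x * \<theta> x) \<partial>lebesgue)"
  proof (rule integral_dominated_convergence[where w="\<lambda>x. (B powr (q - 1) * B * T) * norm (indicator (cball 0 r) x *\<^sub>R F x)"])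
    show "integrable lebesgue (\<lambda>x. (B powr (q - 1) * B * T) * norm (indicator (cball 0 r) x *\<^sub>R F x))"
      using Lp_loc_1_integrable[OF F compact_cball] by (intro integrable_mult_right integrable_norm)
    show "AE x in lebesgue. (\<lambda>k. F x * \<phi> k x) \<longlonglongrightarrow> F x * (\<bar>u x\<bar> powr (q - 1) * u x * \<theta> x)"
      using lim
    proof eventually_elim
      case (elim x)
      show ?case
      proof (cases "norm x \<le> r")
        case True
        then show ?thesis
          using elim unfolding \<phi>_def by (intro tendsto_mult tendsto_const test_gradient_tendsto(1) q) auto
      next
        case False
        then show ?thesis using \<theta>(2)[of x] by (simp add: \<phi>_def)
      qed
    qed
    show "AE x in lebesgue. norm (F x * \<phi> k x) \<le> (B powr (q - 1) * B * T) * norm (indicator (cball 0 r) x *\<^sub>R F x)" for k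
    proof (intro always_eventually allI)
      fix x
      show "norm (F x * \<phi> k x) \<le> (B powr (q - 1) * B * T) * norm (indicator (cball 0 r) x *\<^sub>R F x)"
      proof (cases "norm x \<le> r")
        case True
        have "\<bar>v k x\<bar> powr (q - 1) \<le> B powr (q - 1)" using vB[OF True] q by (intro powr_mono2) auto
        then have "\<bar>\<phi> k x\<bar> \<le> B powr (q - 1) * B * T"
          unfolding \<phi>_def abs_mult using vB[OF True, of k] order_trans[OF abs_ge_zero vB[OF True, of k]] T
          by (intro mult_mono) auto
        then have "\<bar>F x\<bar> * \<bar>\<phi> k x\<bar> \<le> \<bar>F x\<bar> * (B powr (q - 1) * B * T)" by (intro mult_left_mono) auto
        then show ?thesis using True by (simp add: abs_mult mult_ac)
      next
        case False
        then show ?thesis using \<theta>(2)[of x] by (simp add: \<phi>_def)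
      qed
    qed
  qed (unfold \<phi>_def, measurable)
  show ?thesis using LIMSEQ_unique[OF 1] 2 by (simp add: id)
qed

text \<open>The Hessian stays at \<open>G\<close> and grows with the power \<open>p - 2\<close>,
  while the test gradients enter quadratically, so \<open>S powr p\<close> is again a majorant.
  Pointwise convergence holds because the form is a finite sum with fixed coefficients.\<close>

lemma stability_limit:
  assumes q: "q > 1" and F: "F \<in> Lp_loc 1"
    and st: "\<And>\<psi> \<psi>'. C1_gradient \<psi> \<psi>' \<Longrightarrow> (\<And>x. norm x \<ge> r \<Longrightarrow> \<psi> x = 0) \<Longrightarrow>
       (\<integral>x. F x * \<psi> x * \<psi> x \<partial>lebesgue) \<le> (\<integral>x. hess_form (G x) (\<psi>' x) (\<psi>' x) \<partial>lebesgue)"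
  shows "(\<integral>x. F x * (\<bar>u x\<bar> powr (q - 1) * u x * \<theta> x)\<^sup>2 \<partial>lebesgue)
      \<le> (\<integral>x. hess_form (G x) (limit_gradient q x) (limit_gradient q x) \<partial>lebesgue)"
proof -
  define \<phi> where "\<phi> k x = \<bar>v k x\<bar> powr (q - 1) * v k x * \<theta> x" for k x
  define d\<phi> where "d\<phi> k x = (q * \<bar>v k x\<bar> powr (q - 1) * \<theta> x) *\<^sub>R D k x + (\<bar>v k x\<bar> powr (q - 1) * v k x) *\<^sub>R \<theta>' x" for k x
  have \<phi>: "C1_gradient (\<phi> k) (d\<phi> k)" for k
    unfolding \<phi>_def[abs_def] d\<phi>_def[abs_def] by (rule test_function[OF q])
  have id: "(\<integral>x. F x * \<phi> k x * \<phi> k x \<partial>lebesgue) \<le> (\<integral>x. hess_form (G x) (d\<phi> k x) (d\<phi> k x) \<partial>lebesgue)" for k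
    by (rule st[OF \<phi>]) (use \<theta>(2) in \<open>auto simp: \<phi>_def\<close>)
  obtain Ch where Ch: "Ch > 0"
    "\<And>\<xi> \<eta> \<zeta>. \<bar>hess_form \<xi> \<eta> \<zeta>\<bar> \<le> Ch * (if p = 2 then 1 else norm \<xi> powr (p - 2)) * norm \<eta> * norm \<zeta>"
    using hess_form_upper by blast
  have [measurable]: "F \<in> borel_measurable lebesgue" using F by (simp add: Lp_loc_def)
  have [measurable]: "\<phi> k \<in> borel_measurable lebesgue" "d\<phi> k \<in> borel_measurable lebesgue" for k
    unfolding \<phi>_def[abs_def] d\<phi>_def[abs_def] by measurable
  define C where "C = q * B powr (q - 1) * T + B powr (q - 1) * B * T"
  have 1: "(\<lambda>k. \<integral>x. hess_form (G x) (d\<phi> k x) (d\<phi> k x) \<partial>lebesgue)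
    \<longlonglongrightarrow> (\<integral>x. hess_form (G x) (limit_gradient q x) (limit_gradient q x) \<partial>lebesgue)"
  proof (rule integral_dominated_convergence[where w="\<lambda>x. Ch * C * C * \<Omega> x"])
    show "integrable lebesgue (\<lambda>x. Ch * C * C * \<Omega> x)" using SI by simp
    show "AE x in lebesgue. (\<lambda>k. hess_form (G x) (d\<phi> k x) (d\<phi> k x)) \<longlonglongrightarrow> hess_form (G x) (limit_gradient q x) (limit_gradient q x)"
      using lim
    proof eventually_elim
      case (elim x)
      show ?case
      proof (cases "norm x \<le> r")
        case True
        have "(\<lambda>k. d\<phi> k x) \<longlonglongrightarrow> limit_gradient q x"
          unfolding d\<phi>_def using elim True by (intro test_gradient_tendsto(2) q) auto
        then have "(\<lambda>k. d\<phi> k x $ i) \<longlonglongrightarrow> limit_gradient q x $ i" for i by (rule tendsto_vec_nth)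
        then show ?thesis unfolding hess_form_def by (intro tendsto_sum tendsto_mult tendsto_const)
      next
        case False
        then show ?thesis using \<theta>(2)[of x] \<theta>'0[of x] by (simp add: d\<phi>_def)
      qed
    qed
    show "AE x in lebesgue. norm (hess_form (G x) (d\<phi> k x) (d\<phi> k x)) \<le> Ch * C * C * \<Omega> x" for k
      using lim
    proof eventually_elim
      case (elim x)
      show ?case
      proof (cases "norm x \<le> r")
        case True
        have "norm (hess_form (G x) (d\<phi> k x) (d\<phi> k x))
          \<le> Ch * (if p = 2 then 1 else norm (G x) powr (p - 2)) * norm (d\<phi> k x) * norm (d\<phi> k x)"
          using Ch(2) by simp
        also have "\<dots> \<le> (Ch * S x powr (p - 2)) * (C * S x) * (C * S x)"
        proof -
          have "norm (G x) powr (p - 2) \<le> S x powr (p - 2)" using elim True p by (intro powr_mono2) auto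
          \<comment> \<open>For \<open>p = 2\<close> the point is that \<open>S \<ge> 1\<close>
            gives \<open>S powr 0 = 1\<close>.\<close>
          then have 1: "Ch * (if p = 2 then 1 else norm (G x) powr (p - 2)) \<le> Ch * S x powr (p - 2)"
            using Ch(1) S1[of x] by (intro mult_left_mono) auto
          have 2: "norm (d\<phi> k x) \<le> C * S x"
            unfolding d\<phi>_def C_def using elim True vB by (intro test_gradient_bound q) auto
          show ?thesis using Ch(1) order_trans[OF norm_ge_zero 2] by (intro mult_mono 1 2) auto
        qed
        also have "\<dots> = Ch * C * C * (S x powr (p - 2) * S x powr 2)"
          using S1[of x] by (simp add: powr_numeral power2_eq_square)
        also have "\<dots> = Ch * C * C * \<Omega> x" using True by (simp only: S_powr_split) simp
        finally show ?thesis .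
      next
        case False
        then show ?thesis using \<theta>(2)[of x] \<theta>'0[of x] by (simp add: d\<phi>_def hess_form_def)
      qed
    qed
  qed measurable
  have 2: "(\<lambda>k. \<integral>x. F x * \<phi> k x * \<phi> k x \<partial>lebesgue) \<longlonglongrightarrow> (\<integral>x. F x * (\<bar>u x\<bar> powr (q - 1) * u x * \<theta> x)\<^sup>2 \<partial>lebesgue)"
  proof (rule integral_dominated_convergence[where w="\<lambda>x. (B powr (q - 1) * B * T)\<^sup>2 * norm (indicator (cball 0 r) x *\<^sub>R F x)"])
    show "integrable lebesgue (\<lambda>x. (B powr (q - 1) * B * T)\<^sup>2 * norm (indicator (cball 0 r) x *\<^sub>R F x))"
      using Lp_loc_1_integrable[OF F compact_cball] by (intro integrable_mult_right integrable_norm)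
    show "AE x in lebesgue. (\<lambda>k. F x * \<phi> k x * \<phi> k x) \<longlonglongrightarrow> F x * (\<bar>u x\<bar> powr (q - 1) * u x * \<theta> x)\<^sup>2"
      using lim
    proof eventually_elim
      case (elim x)
      show ?case
      proof (cases "norm x \<le> r")
        case True
        then have "(\<lambda>k. \<phi> k x) \<longlonglongrightarrow> \<bar>u x\<bar> powr (q - 1) * u x * \<theta> x"
          using elim unfolding \<phi>_def by (intro tendsto_mult tendsto_const test_gradient_tendsto(1) q) auto
        then have "(\<lambda>k. F x * (\<phi> k x * \<phi> k x)) \<longlonglongrightarrow> F x * ((\<bar>u x\<bar> powr (q - 1) * u x * \<theta> x) * (\<bar>u x\<bar> powr (q - 1) * u x * \<theta> x))"
          by (intro tendsto_mult tendsto_const)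
        then show ?thesis by (simp only: power2_eq_square mult.assoc)
      next
        case False
        then show ?thesis using \<theta>(2)[of x] by (simp add: \<phi>_def)
      qed
    qed
    show "AE x in lebesgue. norm (F x * \<phi> k x * \<phi> k x) \<le> (B powr (q - 1) * B * T)\<^sup>2 * norm (indicator (cball 0 r) x *\<^sub>R F x)" for k
    proof (intro always_eventually allI)
      fix x
      show "norm (F x * \<phi> k x * \<phi> k x) \<le> (B powr (q - 1) * B * T)\<^sup>2 * norm (indicator (cball 0 r) x *\<^sub>R F x)"
      proof (cases "norm x \<le> r")
        case True
        have "\<bar>v k x\<bar> powr (q - 1) \<le> B powr (q - 1)" using vB[OF True] q by (intro powr_mono2) auto
        then have "\<bar>\<phi> k x\<bar> \<le> B powr (q - 1) * B * T"
          unfolding \<phi>_def abs_mult using vB[OF True, of k] order_trans[OF abs_ge_zero vB[OF True, of k]] T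
          by (intro mult_mono) auto
        from power_mono[OF this, of 2] have "(\<phi> k x)\<^sup>2 \<le> (B powr (q - 1) * B * T)\<^sup>2" by simp
        then have "\<bar>F x\<bar> * (\<phi> k x)\<^sup>2 \<le> \<bar>F x\<bar> * (B powr (q - 1) * B * T)\<^sup>2" by (intro mult_left_mono) auto
        then show ?thesis using True by (simp add: abs_mult power2_eq_square mult_ac)
      next
        case False
        then show ?thesis using \<theta>(2)[of x] by (simp add: \<phi>_def)
      qed
    qed
  qed measurable
  show ?thesis by (rule LIMSEQ_le[OF 2 1]) (use id in auto)
qed

end

context test_data
begin

section \<open>Integrability and the two energy relations\<close>

text \<open>The integrands grow like the powers \<open>p\<close>, \<open>p - 1\<close> and
  \<open>p - 2\<close> of the gradient. Because \<open>S \<ge> 1\<close>, one majorant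
  \<open>S powr p\<close> serves all three.\<close>

lemma power_weight_integrable:
  assumes \<gamma>: "\<gamma> > 1"
  shows "integrable lebesgue (\<lambda>x. \<bar>u x\<bar> powr (\<gamma> - 1) * E (G x) * (\<theta> x)\<^sup>2)" (is ?A)
    "integrable lebesgue (\<lambda>x. \<bar>u x\<bar> powr (\<gamma> - 1) * u x * \<theta> x * (a_field p H (G x) \<bullet> \<theta>' x))" (is ?B)
    "integrable lebesgue (\<lambda>x. \<bar>u x\<bar> powr (\<gamma> + 1) * hess_form (G x) (\<theta>' x) (\<theta>' x))" (is ?C)
proof -
  have [measurable]: "(\<lambda>x. a_field p H (G x)) \<in> borel_measurable lebesgue" "(\<lambda>x. E (G x)) \<in> borel_measurable lebesgue"
    by (rule measurable_compose[OF Gm a_field_measurable], rule measurable_compose[OF Gm E_measurable])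
  obtain CE where CE: "CE > 0" "\<And>\<xi>. E \<xi> \<le> CE * norm \<xi> powr p" using E_upper by blast
  obtain Ca where Ca: "Ca > 0" "\<And>\<xi>. norm (a_field p H \<xi>) \<le> Ca * norm \<xi> powr (p - 1)"
    using a_field_upper by blast
  obtain Ch where Ch: "Ch > 0"
    "\<And>\<xi> \<eta> \<zeta>. \<bar>hess_form \<xi> \<eta> \<zeta>\<bar> \<le> Ch * (if p = 2 then 1 else norm \<xi> powr (p - 2)) * norm \<eta> * norm \<zeta>"
    using hess_form_upper by blast
  have E0: "E \<xi> \<ge> 0" for \<xi> by (simp add: E_def)
  have ae: "AE x in lebesgue. norm x \<le> r \<longrightarrow> \<bar>u x\<bar> \<le> B \<and> norm (G x) \<le> S x"
    using lim uB by eventually_elim blast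
  have Sle: "S x powr a \<le> S x powr p" if "a \<le> p" for a x
    using that S1 by (intro powr_mono) auto
  have "AE x in lebesgue. \<bar>\<bar>u x\<bar> powr (\<gamma> - 1) * E (G x) * (\<theta> x)\<^sup>2\<bar> \<le> (B powr (\<gamma> - 1) * CE * T\<^sup>2) * \<Omega> x"
    using ae
  proof eventually_elim
    case (elim x)
    show ?case
    proof (cases "norm x \<le> r")
      case True
      have 1: "\<bar>u x\<bar> powr (\<gamma> - 1) \<le> B powr (\<gamma> - 1)" using elim True \<gamma> by (intro powr_mono2) auto
      have "norm (G x) powr p \<le> S x powr p" using elim True p by (intro powr_mono2) auto
      then have 2: "E (G x) \<le> CE * S x powr p"
        using CE(2)[of "G x"] mult_left_mono[of _ _ CE] CE(1) by (meson less_imp_le order_trans)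
      have 3: "(\<theta> x)\<^sup>2 \<le> T\<^sup>2" using power_mono[OF T(1)[of x], of 2] by simp
      have "\<bar>u x\<bar> powr (\<gamma> - 1) * E (G x) * (\<theta> x)\<^sup>2 \<le> B powr (\<gamma> - 1) * (CE * S x powr p) * T\<^sup>2"
        using E0 CE(1) by (intro mult_mono 1 2 3 mult_nonneg_nonneg) auto
      then show ?thesis using True E0 by (simp add: mult_ac)
    next
      case False
      then show ?thesis using \<theta>(2)[of x] by simp
    qed
  qed
  then show ?A by (rule majorized_integrable[OF SI, rotated]) measurable
  have "AE x in lebesgue. \<bar>\<bar>u x\<bar> powr (\<gamma> - 1) * u x * \<theta> x * (a_field p H (G x) \<bullet> \<theta>' x)\<bar>
      \<le> (B powr (\<gamma> - 1) * B * T * (Ca * T)) * \<Omega> x"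
    using ae
  proof eventually_elim
    case (elim x)
    show ?case
    proof (cases "norm x \<le> r")
      case True
      have 1: "\<bar>u x\<bar> powr (\<gamma> - 1) \<le> B powr (\<gamma> - 1)" using elim True \<gamma> by (intro powr_mono2) auto
      have "norm (G x) powr (p - 1) \<le> S x powr (p - 1)" using elim True p by (intro powr_mono2) auto
      also have "\<dots> \<le> S x powr p" by (rule Sle) simp
      finally have "norm (a_field p H (G x)) \<le> Ca * S x powr p"
        using Ca(2)[of "G x"] mult_left_mono[of _ _ Ca] Ca(1) by (meson less_imp_le order_trans)
      then have "norm (a_field p H (G x)) * norm (\<theta>' x) \<le> (Ca * S x powr p) * T"
        using T Ca(1) by (intro mult_mono) auto
      then have 2: "\<bar>a_field p H (G x) \<bullet> \<theta>' x\<bar> \<le> (Ca * S x powr p) * T"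
        using Cauchy_Schwarz_ineq2 order_trans by blast
      have B0: "B \<ge> 0" using elim True by auto
      have "\<bar>\<bar>u x\<bar> powr (\<gamma> - 1) * u x * \<theta> x * (a_field p H (G x) \<bullet> \<theta>' x)\<bar>
        \<le> B powr (\<gamma> - 1) * B * T * ((Ca * S x powr p) * T)"
        unfolding abs_mult using elim True T T0 B0 1 by (intro mult_mono 2 mult_nonneg_nonneg) auto
      then show ?thesis using True by (simp add: mult_ac)
    next
      case False
      then show ?thesis using \<theta>(2)[of x] by simp
    qed
  qed
  then show ?B by (rule majorized_integrable[OF SI, rotated]) measurable
  have "AE x in lebesgue. \<bar>\<bar>u x\<bar> powr (\<gamma> + 1) * hess_form (G x) (\<theta>' x) (\<theta>' x)\<bar>
      \<le> (B powr (\<gamma> + 1) * (Ch * T * T)) * \<Omega> x"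
    using ae
  proof eventually_elim
    case (elim x)
    show ?case
    proof (cases "norm x \<le> r")
      case True
      have 1: "\<bar>u x\<bar> powr (\<gamma> + 1) \<le> B powr (\<gamma> + 1)" using elim True \<gamma> by (intro powr_mono2) auto
      have "norm (G x) powr (p - 2) \<le> S x powr (p - 2)" using elim True p by (intro powr_mono2) auto
      also have "\<dots> \<le> S x powr p" by (rule Sle) simp
      finally have k: "(if p = 2 then 1 else norm (G x) powr (p - 2)) \<le> S x powr p"
        using S_powr_ge_1[of x] by auto
      have "Ch * (if p = 2 then 1 else norm (G x) powr (p - 2)) * norm (\<theta>' x) * norm (\<theta>' x) \<le> Ch * S x powr p * T * T"
        using T T0 Ch(1) k by (intro mult_mono mult_nonneg_nonneg) auto
      then have 2: "\<bar>hess_form (G x) (\<theta>' x) (\<theta>' x)\<bar> \<le> Ch * S x powr p * T * T"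
        using Ch(2) order_trans by blast
      have "\<bar>\<bar>u x\<bar> powr (\<gamma> + 1) * hess_form (G x) (\<theta>' x) (\<theta>' x)\<bar> \<le> B powr (\<gamma> + 1) * (Ch * S x powr p * T * T)"
        unfolding abs_mult using 1 by (intro mult_mono 2) auto
      then show ?thesis using True by (simp add: mult_ac)
    next
      case False
      then show ?thesis using \<theta>'0[of x] by (simp add: hess_form_def)
    qed
  qed
  then show ?C by (rule majorized_integrable[OF SI, rotated]) measurable
qed

text \<open>Needed twice: with \<open>j = 1\<close> and \<open>f (u x)\<close> for the equation,
  with \<open>j = 2\<close> and \<open>deriv f (u x)\<close> for stability.\<close>

lemma source_integrable:
  assumes \<gamma>: "\<gamma> > 1" and F: "F \<in> Lp_loc 1"
  shows "integrable lebesgue (\<lambda>x. F x * u x ^ j * \<bar>u x\<bar> powr (\<gamma> - 1) * (\<theta> x)\<^sup>2)"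
proof -
  have [measurable]: "F \<in> borel_measurable lebesgue" using F by (simp add: Lp_loc_def)
  have i: "integrable lebesgue (\<lambda>x. norm (indicator (cball 0 r) x *\<^sub>R F x))"
    using Lp_loc_1_integrable[OF F compact_cball] by (intro integrable_norm)
  have "AE x in lebesgue. \<bar>F x * u x ^ j * \<bar>u x\<bar> powr (\<gamma> - 1) * (\<theta> x)\<^sup>2\<bar>
     \<le> (B ^ j * B powr (\<gamma> - 1) * T\<^sup>2) * norm (indicator (cball 0 r) x *\<^sub>R F x)"
    using uB
  proof eventually_elim
    case (elim x)
    show ?case
    proof (cases "norm x \<le> r")
      case True
      have B0: "B \<ge> 0" using elim True by auto
      have 1: "\<bar>u x\<bar> powr (\<gamma> - 1) \<le> B powr (\<gamma> - 1)" using elim True \<gamma> by (intro powr_mono2) auto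
      have 2: "\<bar>u x ^ j\<bar> \<le> B ^ j" using elim True by (simp add: power_abs power_mono)
      have 3: "\<bar>(\<theta> x)\<^sup>2\<bar> \<le> T\<^sup>2" using power_mono[OF T(1)[of x], of 2] by simp
      have "\<bar>F x * u x ^ j * \<bar>u x\<bar> powr (\<gamma> - 1) * (\<theta> x)\<^sup>2\<bar> \<le> \<bar>F x\<bar> * B ^ j * B powr (\<gamma> - 1) * T\<^sup>2"
        unfolding abs_mult using 1 2 3 B0 by (intro mult_mono mult_nonneg_nonneg) auto
      then show ?thesis using True by (simp add: mult_ac)
    next
      case False
      then show ?thesis using \<theta>(2)[of x] by simp
    qed
  qed
  then show ?thesis by (rule majorized_integrable[OF i, rotated]) measurable
qed

end

lemma (in gauge) test_data_exists:
  assumes sol: "u \<in> W1p_loc p" "u \<in> Linf_loc"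
    and \<theta>: "C1_gradient \<theta> \<theta>'" "\<And>x. norm x \<ge> r \<Longrightarrow> \<theta> x = 0"
  shows "\<exists>B T v D S. test_data H p Z u (weak_grad u) \<theta> \<theta>' r B T v D S"
proof -
  note wg = W1p_loc_weak_grad[OF sol(1)]
  have u: "u \<in> Lp_loc p" using sol(1) by (simp add: W1p_loc_def)
  \<comment> \<open>The bound is taken one unit beyond \<open>r\<close> because mollification at
    points of the ball looks that far.\<close>
  obtain B where B: "AE x in lebesgue. x \<in> cball 0 (r + 1) \<longrightarrow> \<bar>u x\<bar> \<le> B"
    using sol(2) compact_cball unfolding Linf_loc_def by blast
  note c = C1_gradient_continuous[OF \<theta>(1)]
  obtain T1 where T1: "\<And>x. norm (\<theta> x) \<le> T1" using bounded_compact_support[OF c(1) \<theta>(2)] by blast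
  have \<theta>'0: "\<theta>' x = 0" if "norm x \<ge> r" for x by (rule C1_gradient_outside_support[OF \<theta> that])
  obtain T2 where T2: "\<And>x. norm (\<theta>' x) \<le> T2" using bounded_compact_support[OF c(2) \<theta>'0] by blast
  have "p \<ge> 1" using p by simp
  then obtain v D S where a: "\<And>k. C1_gradient (v k) (D k)" "\<And>k x. norm x \<le> r \<Longrightarrow> \<bar>v k x\<bar> \<le> B"
    "S \<in> borel_measurable lebesgue" "\<And>x. S x \<ge> 1"
    "integrable lebesgue (\<lambda>x. indicator (cball 0 r) x * S x powr p)"
    "AE x in lebesgue. norm x \<le> r \<longrightarrow> (\<lambda>k::nat. v k x) \<longlonglongrightarrow> u x \<and> (\<lambda>k. D k x) \<longlonglongrightarrow> weak_grad u x \<and>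
       norm (weak_grad u x) \<le> S x \<and> (\<forall>k. norm (D k x) \<le> S x)"
    using Sobolev_approximation[OF _ u wg(2,1) B] by blast
  have "test_data H p Z u (weak_grad u) \<theta> \<theta>' r B (max T1 T2) v D S"
  proof
    show "u \<in> borel_measurable lebesgue" "weak_grad u \<in> borel_measurable lebesgue"
      using u wg by (auto simp: Lp_loc_def)
    show "AE x in lebesgue. norm x \<le> r \<longrightarrow> \<bar>u x\<bar> \<le> B" using B by (auto elim: eventually_mono)
    show "\<bar>\<theta> x\<bar> \<le> max T1 T2" "norm (\<theta>' x) \<le> max T1 T2" for x
      using T1[of x] T2[of x] by auto
  qed (use a \<theta> in auto)
  then show ?thesis by blast
qed

text \<open>The equation is linear in its test function, stability quadratic. Halving the power and
  taking \<open>\<theta>\<close> in place of its square therefore makes both produce the same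
  integrals of \<open>i1\<close>, \<open>i2\<close> and \<open>iX\<close>; differentiating the
  square of \<open>\<theta>\<close> accounts for the factor 2 before \<open>iX\<close>.\<close>

lemma (in gauge) energy_identities:
  assumes sol: "weak_solution p H f u" and stab: "stable p H Z f u" and f: "Ck_on 1 UNIV f"
    and le: "\<And>s. s\<^sup>2 * deriv f s \<ge> \<alpha> * (s * f s)" and \<gamma>: "\<gamma> > 1"
    and \<theta>: "C1_gradient \<theta> \<theta>'" "\<And>x. norm x \<ge> r \<Longrightarrow> \<theta> x = 0"
  defines "G \<equiv> weak_grad u"
  defines "i1 \<equiv> \<lambda>x. \<bar>u x\<bar> powr (\<gamma> - 1) * E (G x) * (\<theta> x)\<^sup>2"
    and "i2 \<equiv> \<lambda>x. f (u x) * u x * \<bar>u x\<bar> powr (\<gamma> - 1) * (\<theta> x)\<^sup>2"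
    and "iX \<equiv> \<lambda>x. \<bar>u x\<bar> powr (\<gamma> - 1) * u x * \<theta> x * (a_field p H (G x) \<bullet> \<theta>' x)"
    and "iY \<equiv> \<lambda>x. \<bar>u x\<bar> powr (\<gamma> + 1) * hess_form (G x) (\<theta>' x) (\<theta>' x)"
  shows "integrable lebesgue i1" "integrable lebesgue i2" "integrable lebesgue iX" "integrable lebesgue iY"
    "\<gamma> * (\<integral>x. i1 x \<partial>lebesgue) + 2 * (\<integral>x. iX x \<partial>lebesgue) = (\<integral>x. i2 x \<partial>lebesgue)"
    "\<alpha> * (\<integral>x. i2 x \<partial>lebesgue) \<le> ((\<gamma> + 1) / 2)\<^sup>2 * (p - 1) * (\<integral>x. i1 x \<partial>lebesgue)
       + (\<gamma> + 1) * (p - 1) * (\<integral>x. iX x \<partial>lebesgue) + (\<integral>x. iY x \<partial>lebesgue)"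
proof -
  have W: "u \<in> W1p_loc p" "u \<in> Linf_loc" using sol by (auto simp: weak_solution_def)
  note C1f = C1_real[OF f]
  have F: "(\<lambda>x. f (u x)) \<in> Lp_loc 1" "(\<lambda>x. deriv f (u x)) \<in> Lp_loc 1"
    using Linf_loc_compose_Lp_loc[OF W(2)] C1f by auto
  note GL = W1p_loc_weak_grad(2)[OF W(1), folded G_def]
  obtain B T v D S where "test_data H p Z u G \<theta> \<theta>' r B T v D S"
    using test_data_exists[OF W \<theta>] unfolding G_def by blast
  then interpret td: test_data H p Z u G \<theta> \<theta>' r B T v D S .
  show I1: "integrable lebesgue i1" and IX: "integrable lebesgue iX" and IY: "integrable lebesgue iY"
    unfolding i1_def iX_def iY_def by (rule td.power_weight_integrable[OF \<gamma>])+
  show I2: "integrable lebesgue i2"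
    using td.source_integrable[OF \<gamma> F(1), of 1] unfolding i2_def by simp
  have \<theta>2: "C1_gradient (\<lambda>x. (\<theta> x)\<^sup>2) (\<lambda>x. (2 * \<theta> x) *\<^sub>R \<theta>' x)"
  proof -
    have "continuous_on UNIV (\<lambda>x. (2 * \<theta> x) *\<^sub>R \<theta>' x)"
      using C1_gradient_continuous[OF \<theta>(1)] by (intro continuous_intros)
    moreover have "GDERIV (\<lambda>x. (\<theta> x)\<^sup>2) x :> (2 * \<theta> x) *\<^sub>R \<theta>' x" for x
    proof -
      have "GDERIV \<theta> x :> \<theta>' x" using \<theta>(1) unfolding C1_gradient_def by blast
      from GDERIV_mult[OF this this] show ?thesis
        by (simp add: power2_eq_square scaleR_add_left[symmetric])
    qed
    ultimately show ?thesis by (simp add: C1_gradient_def)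
  qed
  \<comment> \<open>The approximation data are set up a second time, now for the squared cutoff
    required by the equation.\<close>
  obtain B' T' v' D' S' where "test_data H p Z u G (\<lambda>x. (\<theta> x)\<^sup>2) (\<lambda>x. (2 * \<theta> x) *\<^sub>R \<theta>' x) r B' T' v' D' S'"
    using test_data_exists[OF W \<theta>2, of r] \<theta>(2) unfolding G_def by auto
  then interpret td2: test_data H p Z u G "\<lambda>x. (\<theta> x)\<^sup>2" "\<lambda>x. (2 * \<theta> x) *\<^sub>R \<theta>' x" r B' T' v' D' S' .
  have "(\<integral>x. a_field p H (G x) \<bullet> td2.limit_gradient \<gamma> x \<partial>lebesgue)
      = (\<integral>x. f (u x) * (\<bar>u x\<bar> powr (\<gamma> - 1) * u x * (\<theta> x)\<^sup>2) \<partial>lebesgue)"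
    using sol by (intro td2.weak_equation_limit \<gamma> F(1) GL) (auto simp: weak_solution_def G_def)
  moreover have "a_field p H (G x) \<bullet> td2.limit_gradient \<gamma> x = \<gamma> * i1 x + 2 * iX x" for x
    by (simp add: inner_add_right a_field_self i1_def iX_def)
  moreover have "f (u x) * (\<bar>u x\<bar> powr (\<gamma> - 1) * u x * (\<theta> x)\<^sup>2) = i2 x" for x
    by (simp add: i2_def)
  ultimately have "(\<integral>x. \<gamma> * i1 x + 2 * iX x \<partial>lebesgue) = (\<integral>x. i2 x \<partial>lebesgue)" by simp
  then show "\<gamma> * (\<integral>x. i1 x \<partial>lebesgue) + 2 * (\<integral>x. iX x \<partial>lebesgue) = (\<integral>x. i2 x \<partial>lebesgue)"
    using I1 IX by simp
  \<comment> \<open>With this \<open>q\<close> the power \<open>\<bar>s\<bar> powr (q - 1)\<close>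
    squares to \<open>\<bar>s\<bar> powr (\<gamma> - 1)\<close>.\<close>
  define q where "q = (\<gamma> + 1) / 2"
  have q: "q > 1" using \<gamma> by (simp add: q_def)
  have pw: "\<bar>s\<bar> powr (q - 1) * \<bar>s\<bar> powr (q - 1) = \<bar>s\<bar> powr (\<gamma> - 1)" for s :: real
    by (simp add: powr_add[symmetric] q_def)
  have st: "(\<integral>x. deriv f (u x) * (\<bar>u x\<bar> powr (q - 1) * u x * \<theta> x)\<^sup>2 \<partial>lebesgue)
      \<le> (\<integral>x. hess_form (G x) (td.limit_gradient q x) (td.limit_gradient q x) \<partial>lebesgue)"
  proof (rule td.stability_limit[OF q F(2)])
    fix \<psi> :: "real ^ 'n \<Rightarrow> real" and \<psi>' assume \<psi>: "C1_gradient \<psi> \<psi>'" "\<And>x. norm x \<ge> r \<Longrightarrow> \<psi> x = 0"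
    then have "\<psi> \<in> Cc1"
      using C1_gradient_imp_Ck_on_1 by (auto simp: Cc1_def compact_support_cball_iff simp del: Ck_on.simps)
    then have "0 \<le> linearized_form p H Z f u \<psi> \<psi>" using stab by (auto simp: stable_def)
    then show "(\<integral>x. deriv f (u x) * \<psi> x * \<psi> x \<partial>lebesgue) \<le> (\<integral>x. hess_form (G x) (\<psi>' x) (\<psi>' x) \<partial>lebesgue)"
      by (simp add: linearized_form_def hess_form_def G_def C1_gradient_pd[OF \<psi>(1)])
  qed
  have eqh: "hess_form (G x) (td.limit_gradient q x) (td.limit_gradient q x)
      = q\<^sup>2 * (p - 1) * i1 x + 2 * q * (p - 1) * iX x + iY x" for x
  proof -
    have "(\<bar>u x\<bar> powr (q - 1) * u x)\<^sup>2 = \<bar>u x\<bar> powr (\<gamma> - 1) * \<bar>u x\<bar> powr 2"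
      by (simp add: power2_eq_square pw[symmetric] powr_numeral mult_ac)
    also have "\<dots> = \<bar>u x\<bar> powr (\<gamma> + 1)" by (simp only: powr_add[symmetric]) (simp add: add.commute)
    finally have b2: "(\<bar>u x\<bar> powr (q - 1) * u x)\<^sup>2 = \<bar>u x\<bar> powr (\<gamma> + 1)" .
    have a2: "(q * \<bar>u x\<bar> powr (q - 1) * \<theta> x)\<^sup>2 = q\<^sup>2 * \<bar>u x\<bar> powr (\<gamma> - 1) * (\<theta> x)\<^sup>2"
      by (simp add: power2_eq_square pw[symmetric] mult_ac)
    have ab: "2 * (q * \<bar>u x\<bar> powr (q - 1) * \<theta> x) * (\<bar>u x\<bar> powr (q - 1) * u x) = 2 * q * (\<bar>u x\<bar> powr (\<gamma> - 1) * u x * \<theta> x)"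
      by (simp add: pw[symmetric] mult_ac)
    show ?thesis
      unfolding hess_form_expand a2 b2 ab by (simp add: i1_def iX_def iY_def mult_ac)
  qed
  have eqd: "deriv f (u x) * (\<bar>u x\<bar> powr (q - 1) * u x * \<theta> x)\<^sup>2 = deriv f (u x) * u x ^ 2 * \<bar>u x\<bar> powr (\<gamma> - 1) * (\<theta> x)\<^sup>2" for x
    by (simp add: power2_eq_square pw[symmetric] mult_ac)
  have "\<alpha> * (\<integral>x. i2 x \<partial>lebesgue) = (\<integral>x. \<alpha> * i2 x \<partial>lebesgue)" by simp
  \<comment> \<open>The hypothesis on \<open>deriv f\<close>, multiplied by a nonnegative weight,
    compares the source integral of the equation with the zeroth order term of stability.\<close>
  also have "\<dots> \<le> (\<integral>x. deriv f (u x) * u x ^ 2 * \<bar>u x\<bar> powr (\<gamma> - 1) * (\<theta> x)\<^sup>2 \<partial>lebesgue)"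
  proof (rule integral_mono[OF _ td.source_integrable[OF \<gamma> F(2), of 2]])
    show "integrable lebesgue (\<lambda>x. \<alpha> * i2 x)" using I2 by simp
    fix x
    have "(\<alpha> * (u x * f (u x))) * (\<bar>u x\<bar> powr (\<gamma> - 1) * (\<theta> x)\<^sup>2)
      \<le> ((u x)\<^sup>2 * deriv f (u x)) * (\<bar>u x\<bar> powr (\<gamma> - 1) * (\<theta> x)\<^sup>2)"
      using le[of "u x"] by (intro mult_right_mono) auto
    then show "\<alpha> * i2 x \<le> deriv f (u x) * u x ^ 2 * \<bar>u x\<bar> powr (\<gamma> - 1) * (\<theta> x)\<^sup>2"
      by (simp add: i2_def mult_ac)
  qed
  also have "\<dots> \<le> (\<integral>x. q\<^sup>2 * (p - 1) * i1 x + 2 * q * (p - 1) * iX x + iY x \<partial>lebesgue)"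
    using st by (simp only: eqd eqh)
  also have "\<dots> = q\<^sup>2 * (p - 1) * (\<integral>x. i1 x \<partial>lebesgue) + 2 * q * (p - 1) * (\<integral>x. iX x \<partial>lebesgue) + (\<integral>x. iY x \<partial>lebesgue)"
    using I1 IX IY by simp
  also have "2 * q = \<gamma> + 1" by (simp add: q_def)
  finally show "\<alpha> * (\<integral>x. i2 x \<partial>lebesgue) \<le> ((\<gamma> + 1) / 2)\<^sup>2 * (p - 1) * (\<integral>x. i1 x \<partial>lebesgue)
       + (\<gamma> + 1) * (p - 1) * (\<integral>x. iX x \<partial>lebesgue) + (\<integral>x. iY x \<partial>lebesgue)"
    by (simp only: q_def)
qed

section \<open>The Liouville theorem\<close>

lemma content_cball_power:
  "measure lborel (cball (0 :: 'a::euclidean_space) r) = r ^ DIM('a) * measure lborel (ball (0 :: 'a) 1)" if "r \<ge> 0"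
  using content_ball_conv_unit_ball[OF that, of "0 :: 'a"] by (simp add: content_cball_conv_ball)

text \<open>Young's inequality in the quantities of the energy estimate: \<open>E\<close> replaces
  the p-th power of the norm by its lower bound, and \<open>M\<close> stands for the growth constant
  of the flux or the Hessian times a power of the cutoff exponent.\<close>

lemma (in gauge) interpolated_integrand_bound:
  assumes \<gamma>: "\<gamma> > 1" and \<alpha>: "\<alpha> > p - 1" and \<beta>: "\<beta> \<ge> \<alpha>" and j: "j = 1 \<or> j = (2::nat)"
    and m: "2 * real m \<ge> p * (\<gamma> + \<alpha>) / (\<alpha> - p + 1)" and \<epsilon>: "\<epsilon> > 0" and c: "c > 0" and M: "M > 0"
  shows "\<exists>K\<ge>0. \<forall>s \<xi> z L R F. R \<ge> 1 \<longrightarrow> s \<ge> 0 \<longrightarrow> 0 \<le> z \<longrightarrow> z \<le> 1 \<longrightarrow> 0 \<le> L \<longrightarrow> L \<le> 16 / R \<longrightarrow>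
     c * s powr (\<gamma> + \<beta>) \<le> F \<or> c * s powr (\<gamma> + \<alpha>) \<le> F \<longrightarrow>
     M * young_term p \<gamma> m j s (norm \<xi>) z L
       \<le> \<epsilon> * (s powr (\<gamma> - 1) * E \<xi> * z ^ (2 * m) + F * z ^ (2 * m)) + K * R powr (- (p * (\<gamma> + \<beta>) / (\<beta> - p + 1)))"
proof -
  obtain cE where cE: "cE > 0" "\<And>\<xi>. E \<xi> \<ge> cE * norm \<xi> powr p" using E_lower by blast
  \<comment> \<open>The minimum with 1 is needed because both the energy term, which loses the
    factor \<open>cE\<close>, and the source term, which loses nothing, must end with the
    coefficient \<open>\<epsilon>\<close>.\<close>
  define \<epsilon>' where "\<epsilon>' = \<epsilon> * min 1 cE / M"
  have \<epsilon>': "\<epsilon>' > 0" using \<epsilon> cE M by (simp add: \<epsilon>'_def)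
  obtain K where K: "K \<ge> 0" and Y: "\<And>s g z L R F. R \<ge> 1 \<Longrightarrow> s \<ge> 0 \<Longrightarrow> g \<ge> 0 \<Longrightarrow> 0 \<le> z \<Longrightarrow> z \<le> 1 \<Longrightarrow> 0 \<le> L \<Longrightarrow> L \<le> 16 / R \<Longrightarrow>
     c * s powr (\<gamma> + \<beta>) \<le> F \<or> c * s powr (\<gamma> + \<alpha>) \<le> F \<Longrightarrow>
     young_term p \<gamma> m j s g z L
       \<le> \<epsilon>' * (s powr (\<gamma> - 1) * g powr p * z ^ (2 * m) + F * z ^ (2 * m)) + K * R powr (- (p * (\<gamma> + \<beta>) / (\<beta> - p + 1)))"
    using Young_two_powers[OF p \<gamma> \<alpha> \<beta> j m \<epsilon>' c] by blast
  have "M * young_term p \<gamma> m j s (norm \<xi>) z L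
       \<le> \<epsilon> * (s powr (\<gamma> - 1) * E \<xi> * z ^ (2 * m) + F * z ^ (2 * m)) + (M * K) * R powr (- (p * (\<gamma> + \<beta>) / (\<beta> - p + 1)))"
    if h: "R \<ge> 1" "s \<ge> 0" "0 \<le> z" "z \<le> 1" "0 \<le> L" "L \<le> 16 / R"
      "c * s powr (\<gamma> + \<beta>) \<le> F \<or> c * s powr (\<gamma> + \<alpha>) \<le> F" for s \<xi> z L R F
  proof -
    have F0: "F \<ge> 0"
    proof -
      have "c * s powr (\<gamma> + \<beta>) \<ge> 0" "c * s powr (\<gamma> + \<alpha>) \<ge> 0" using c by auto
      with h(7) show ?thesis by linarith
    qed
    let ?A = "s powr (\<gamma> - 1) * norm \<xi> powr p * z ^ (2 * m)" and ?F = "F * z ^ (2 * m)"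
    have A0: "?A \<ge> 0" and F0': "?F \<ge> 0" using h F0 by auto
    have "M * \<epsilon>' * (?A + ?F) = \<epsilon> * (min 1 cE * ?A) + \<epsilon> * (min 1 cE * ?F)"
      using M by (simp add: \<epsilon>'_def algebra_simps)
    also have "\<dots> \<le> \<epsilon> * (s powr (\<gamma> - 1) * E \<xi> * z ^ (2 * m)) + \<epsilon> * ?F"
    proof (intro add_mono mult_left_mono)
      have "min 1 cE * ?A \<le> cE * ?A" using A0 by (intro mult_right_mono) auto
      also have "\<dots> = s powr (\<gamma> - 1) * (cE * norm \<xi> powr p) * z ^ (2 * m)" by simp
      also have "\<dots> \<le> s powr (\<gamma> - 1) * E \<xi> * z ^ (2 * m)"
        using h cE(2) by (intro mult_right_mono mult_left_mono) auto
      finally show "min 1 cE * ?A \<le> s powr (\<gamma> - 1) * E \<xi> * z ^ (2 * m)" .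
      have "min 1 cE * ?F \<le> 1 * ?F" using F0' by (intro mult_right_mono) auto
      then show "min 1 cE * ?F \<le> ?F" by simp
    qed (use \<epsilon> in auto)
    finally have 1: "M * \<epsilon>' * (?A + ?F) \<le> \<epsilon> * (s powr (\<gamma> - 1) * E \<xi> * z ^ (2 * m) + ?F)"
      by (simp only: distrib_left)
    have "M * young_term p \<gamma> m j s (norm \<xi>) z L
      \<le> M * (\<epsilon>' * (?A + ?F) + K * R powr (- (p * (\<gamma> + \<beta>) / (\<beta> - p + 1))))"
      using M by (intro mult_left_mono Y h) auto
    also have "\<dots> = M * \<epsilon>' * (?A + ?F) + (M * K) * R powr (- (p * (\<gamma> + \<beta>) / (\<beta> - p + 1)))"
      by (simp only: distrib_left mult.assoc)
    finally show ?thesis using 1 by linarith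
  qed
  moreover have "M * K \<ge> 0" using M K by simp
  ultimately show ?thesis by blast
qed

lemma C1_gradient_power:
  assumes "C1_gradient \<zeta> \<zeta>'"
  shows "C1_gradient (\<lambda>x. \<zeta> x ^ m) (\<lambda>x. (real m * \<zeta> x ^ (m - 1)) *\<^sub>R \<zeta>' x)"
proof -
  note c = C1_gradient_continuous[OF assms]
  have "GDERIV (\<lambda>x. \<zeta> x ^ m) x :> (real m * \<zeta> x ^ (m - 1)) *\<^sub>R \<zeta>' x" for x
  proof -
    have "GDERIV \<zeta> x :> \<zeta>' x" using assms unfolding C1_gradient_def by blast
    moreover have "DERIV (\<lambda>t. t ^ m) (\<zeta> x) :> real m * \<zeta> x ^ (m - 1)"
      by (auto intro!: derivative_eq_intros)
    ultimately show ?thesis by (rule GDERIV_DERIV_compose)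
  qed
  moreover have "continuous_on UNIV (\<lambda>x. (real m * \<zeta> x ^ (m - 1)) *\<^sub>R \<zeta>' x)"
    using c by (intro continuous_intros)
  ultimately show ?thesis by (simp add: C1_gradient_def)
qed

theorem theorem1p7:
  fixes H :: "real ^ 'n::finite \<Rightarrow> real"
    and Z :: "real ^ 'n ^ 'n"
    and f :: "real \<Rightarrow> real"
    and p \<alpha>\<^sub>0 \<beta>\<^sub>0 :: real
    and u :: "real ^ 'n \<Rightarrow> real"
  assumes H_cont: "continuous_on UNIV H"
    and H_C2: "Ck_on 2 (- {0}) H"
    and H_zero: "H 0 = 0"
    and H_homogeneous: "\<And>t \<xi>. t > 0 \<Longrightarrow> H (t *\<^sub>R \<xi>) = t * H \<xi>"
    and H_pos: "\<And>\<xi>. norm \<xi> = 1 \<Longrightarrow> H \<xi> > 0"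
    and H_convex: "uniformly_convex H"
    and Z: "admissible_value_at_0 p H Z"
    and n: "CARD('n) \<ge> 2"
    and p: "p \<ge> 2"
    and f_C1: "Ck_on 1 UNIV f"
    and f_sign: "\<And>s. s \<noteq> 0 \<Longrightarrow> s * f s > 0"
    and exponents:
      "(p < real CARD('n) \<and> p - 1 < \<alpha>\<^sub>0 \<and> \<alpha>\<^sub>0 \<le> \<beta>\<^sub>0 \<and> \<beta>\<^sub>0 < h_exponent CARD('n) p \<alpha>\<^sub>0)
       \<or> (p \<ge> real CARD('n) \<and> p - 1 < \<alpha>\<^sub>0 \<and> \<alpha>\<^sub>0 \<le> \<beta>\<^sub>0)"
    and f_deriv: "\<And>s. s\<^sup>2 * deriv f s \<ge> \<alpha>\<^sub>0 * (s * f s)"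
    and f_lower: "\<exists>c>0. \<exists>M>0. \<forall>s. \<bar>s\<bar> < M \<longrightarrow> s * f s \<ge> c * \<bar>s\<bar> powr (\<beta>\<^sub>0 + 1)"
    and solution: "weak_solution p H f u"
    and stable: "stable p H Z f u"
  shows "AE x in lebesgue. u x = 0"
proof -
  interpret gauge H p Z
    by unfold_locales (fact H_C2 H_zero H_homogeneous H_pos p Z)+
  have \<alpha>: "\<alpha>\<^sub>0 > p - 1" and \<beta>: "\<beta>\<^sub>0 \<ge> \<alpha>\<^sub>0" using exponents by auto
  define \<kappa> where "\<kappa> \<gamma> = p * (\<gamma> + \<beta>\<^sub>0) / (\<beta>\<^sub>0 - p + 1)" for \<gamma>
  obtain \<gamma> where \<gamma>: "\<gamma> > 1" "(p - 1) * (\<gamma> + 1)\<^sup>2 < 4 * \<alpha>\<^sub>0 * \<gamma>" and \<kappa>n: "\<kappa> \<gamma> > CARD('n)"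
    using exponent_choice[OF p exponents] unfolding \<kappa>_def by blast
  obtain cf where cf: "cf > 0"
    "\<And>s. s * f s \<ge> cf * \<bar>s\<bar> powr (\<beta>\<^sub>0 + 1) \<or> s * f s \<ge> cf * \<bar>s\<bar> powr (\<alpha>\<^sub>0 + 1)"
    using superlinear_lower_bound[OF C1_real(1)[OF f_C1] f_sign f_deriv f_lower] by blast
  define F where "F s = f s * s * \<bar>s\<bar> powr (\<gamma> - 1)" for s
  have F: "cf * \<bar>s\<bar> powr (\<gamma> + \<beta>\<^sub>0) \<le> F s \<or> cf * \<bar>s\<bar> powr (\<gamma> + \<alpha>\<^sub>0) \<le> F s" for s
  proof -
    have "cf * \<bar>s\<bar> powr (\<gamma> + b) \<le> F s" if "s * f s \<ge> cf * \<bar>s\<bar> powr (b + 1)" for b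
    proof -
      have "cf * \<bar>s\<bar> powr (\<gamma> + b) = cf * \<bar>s\<bar> powr (b + 1) * \<bar>s\<bar> powr (\<gamma> - 1)"
        by (simp add: powr_add[symmetric] add.commute)
      also have "\<dots> \<le> (s * f s) * \<bar>s\<bar> powr (\<gamma> - 1)" using that by (rule mult_right_mono) simp
      finally show ?thesis by (simp add: F_def mult.commute)
    qed
    with cf(2)[of s] show ?thesis by blast
  qed
  have F0: "F s \<ge> 0" for s
    using f_sign[of s] by (cases "s = 0") (auto simp: F_def mult.commute)
  have Fzero: "s = 0" if "F s = 0" for s
  proof (rule ccontr)
    assume "s \<noteq> 0"
    then show False using f_sign[of s] that by (simp add: F_def)
  qed
  \<comment> \<open>This is the demand made by the power \<open>\<alpha>\<^sub>0\<close>; the one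
    made by \<open>\<beta>\<^sub>0\<close> is weaker.\<close>
  obtain m :: nat where m: "p * (\<gamma> + \<alpha>\<^sub>0) / (\<alpha>\<^sub>0 - p + 1) \<le> 2 * real m"
  proof -
    obtain m :: nat where m: "p * (\<gamma> + \<alpha>\<^sub>0) / (\<alpha>\<^sub>0 - p + 1) \<le> real m"
      using real_arch_simple by blast
    have "real m \<le> 2 * real m" by simp
    with m show thesis using that order_trans by blast
  qed
  have "p * (\<gamma> + \<alpha>\<^sub>0) / (\<alpha>\<^sub>0 - p + 1) > 0"
    using p \<alpha> \<gamma> by (intro divide_pos_pos mult_pos_pos) auto
  \<comment> \<open>Positivity matters because \<open>0 ^ 0 = 1\<close>: without it
    \<open>\<theta>\<close> would not vanish outside the ball.\<close>
  then have m0: "m > 0" using m by (cases m) auto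
  obtain \<epsilon> C where \<epsilon>: "\<epsilon> > 0" "C > 0" and absorb:
    "\<And>I1 I2 X Y E. I1 \<ge> 0 \<Longrightarrow> I2 \<ge> 0 \<Longrightarrow> E \<ge> 0 \<Longrightarrow> \<gamma> * I1 + 2 * X = I2 \<Longrightarrow>
      \<alpha>\<^sub>0 * I2 \<le> ((\<gamma> + 1) / 2)\<^sup>2 * (p - 1) * I1 + (\<gamma> + 1) * (p - 1) * X + Y \<Longrightarrow>
      \<bar>X\<bar> \<le> \<epsilon> * (I1 + I2) + E \<Longrightarrow> \<bar>Y\<bar> \<le> \<epsilon> * (I1 + I2) + E \<Longrightarrow> I2 \<le> C * E"
    using energy_absorption[OF \<gamma>(1) p \<gamma>(2)] by blast
  obtain Ca where Ca: "Ca > 0" "\<And>\<xi>. norm (a_field p H \<xi>) \<le> Ca * norm \<xi> powr (p - 1)"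
    using a_field_upper by blast
  obtain Ch where Ch: "Ch > 0"
    "\<And>\<xi> \<eta> \<zeta>. \<bar>hess_form \<xi> \<eta> \<zeta>\<bar> \<le> Ch * (if p = 2 then 1 else norm \<xi> powr (p - 2)) * norm \<eta> * norm \<zeta>"
    using hess_form_upper by blast
  have "Ca * real m > 0" "Ch * (real m)\<^sup>2 > 0" using Ca Ch m0 by auto
  obtain K1 where K1: "K1 \<ge> 0" and YX: "\<And>s \<xi> z L R F. R \<ge> 1 \<Longrightarrow> s \<ge> 0 \<Longrightarrow> 0 \<le> z \<Longrightarrow> z \<le> 1 \<Longrightarrow> 0 \<le> L \<Longrightarrow> L \<le> 16 / R \<Longrightarrow>
     cf * s powr (\<gamma> + \<beta>\<^sub>0) \<le> F \<or> cf * s powr (\<gamma> + \<alpha>\<^sub>0) \<le> F \<Longrightarrow>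
     (Ca * real m) * young_term p \<gamma> m 1 s (norm \<xi>) z L
       \<le> \<epsilon> * (s powr (\<gamma> - 1) * E \<xi> * z ^ (2 * m) + F * z ^ (2 * m)) + K1 * R powr (- \<kappa> \<gamma>)"
    using interpolated_integrand_bound[OF \<gamma>(1) \<alpha> \<beta> _ m \<epsilon>(1) cf(1) \<open>Ca * real m > 0\<close>, of 1]
    unfolding \<kappa>_def by blast
  obtain K2 where K2: "K2 \<ge> 0" and YY: "\<And>s \<xi> z L R F. R \<ge> 1 \<Longrightarrow> s \<ge> 0 \<Longrightarrow> 0 \<le> z \<Longrightarrow> z \<le> 1 \<Longrightarrow> 0 \<le> L \<Longrightarrow> L \<le> 16 / R \<Longrightarrow>
     cf * s powr (\<gamma> + \<beta>\<^sub>0) \<le> F \<or> cf * s powr (\<gamma> + \<alpha>\<^sub>0) \<le> F \<Longrightarrow>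
     (Ch * (real m)\<^sup>2) * young_term p \<gamma> m 2 s (norm \<xi>) z L
       \<le> \<epsilon> * (s powr (\<gamma> - 1) * E \<xi> * z ^ (2 * m) + F * z ^ (2 * m)) + K2 * R powr (- \<kappa> \<gamma>)"
    using interpolated_integrand_bound[OF \<gamma>(1) \<alpha> \<beta> _ m \<epsilon>(1) cf(1) \<open>Ch * (real m)\<^sup>2 > 0\<close>, of 2]
    unfolding \<kappa>_def by blast
  define G where "G = weak_grad u"
  define V where "V = measure lborel (ball (0 :: real ^ 'n) 1)"
  \<comment> \<open>The factor \<open>2 ^ CARD('n) * V\<close> is the volume of the ball of radius
    2, since the cutoff at scale \<open>R\<close> lives on the ball of radius
    \<open>2 * R\<close>.\<close>
  define C' where "C' = C * ((K1 + K2) * (2 ^ CARD('n) * V))"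
  \<comment> \<open>The exponent is the volume growth minus the decay of the Young remainder.
    Integrability is recorded as well, since integrals over different balls are compared at the
    end.\<close>
  have loc: "integrable lebesgue (\<lambda>x. indicator (cball 0 R) x * F (u x)) \<and>
      (\<integral>x. indicator (cball 0 R) x * F (u x) \<partial>lebesgue) \<le> C' * R powr (CARD('n) - \<kappa> \<gamma>)" if R: "R \<ge> 1" for R
  proof -
    let ?\<zeta> = "cutoff_ball R :: real ^ 'n \<Rightarrow> real" and ?\<zeta>' = "grad_cutoff_ball R :: real ^ 'n \<Rightarrow> real ^ 'n"
    have R0: "R > 0" using R by simp
    define \<theta> where "\<theta> x = ?\<zeta> x ^ m" for x
    define \<theta>' where "\<theta>' x = (real m * ?\<zeta> x ^ (m - 1)) *\<^sub>R ?\<zeta>' x" for x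
    have \<theta>: "C1_gradient \<theta> \<theta>'"
      unfolding \<theta>_def[abs_def] \<theta>'_def[abs_def] by (rule C1_gradient_power[OF C1_gradient_cutoff_ball])
    have \<theta>0: "\<theta> x = 0" if "norm x \<ge> 2 * R" for x
      using cutoff_ball_eq_0(1)[OF R0 that] m0 by (simp add: \<theta>_def)
    have \<theta>'0: "\<theta>' x = 0" if "norm x \<ge> 2 * R" for x
      using cutoff_ball_eq_0(2)[OF R0 that] by (simp add: \<theta>'_def)
    define i1 where "i1 x = \<bar>u x\<bar> powr (\<gamma> - 1) * E (G x) * (\<theta> x)\<^sup>2" for x
    define i2 where "i2 x = f (u x) * u x * \<bar>u x\<bar> powr (\<gamma> - 1) * (\<theta> x)\<^sup>2" for x
    define iX where "iX x = \<bar>u x\<bar> powr (\<gamma> - 1) * u x * \<theta> x * (a_field p H (G x) \<bullet> \<theta>' x)" for x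
    define iY where "iY x = \<bar>u x\<bar> powr (\<gamma> + 1) * hess_form (G x) (\<theta>' x) (\<theta>' x)" for x
    note id = energy_identities[OF solution stable f_C1 f_deriv \<gamma>(1) \<theta> \<theta>0, folded G_def,
        folded i1_def[abs_def] i2_def[abs_def] iX_def[abs_def] iY_def[abs_def]]
    have E0: "E \<xi> \<ge> 0" for \<xi> by (simp add: E_def)
    have i1': "i1 x = \<bar>u x\<bar> powr (\<gamma> - 1) * E (G x) * ?\<zeta> x ^ (2 * m)" for x
      by (simp add: i1_def \<theta>_def power_mult[symmetric] mult.commute)
    have i2': "i2 x = F (u x) * ?\<zeta> x ^ (2 * m)" for x
      by (simp add: i2_def F_def \<theta>_def power_mult[symmetric] mult.commute)
    have i10: "i1 x \<ge> 0" for x using E0 by (simp add: i1_def)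
    have i20: "i2 x \<ge> 0" for x using F0 by (simp add: i2' cutoff_ball_bounds)
    have norm\<theta>': "norm (\<theta>' x) = real m * ?\<zeta> x ^ (m - 1) * norm (?\<zeta>' x)" for x
      by (simp add: \<theta>'_def abs_mult power_abs cutoff_ball_bounds)
    let ?I = "indicator (cball (0 :: real ^ 'n) (2 * R)) :: real ^ 'n \<Rightarrow> real"
    \<comment> \<open>The cutoff occurs with exponent \<open>m\<close> from \<open>\<theta>\<close>
      and \<open>m - 1\<close> from its gradient, which is the exponent \<open>2 * m - 1\<close> of
      \<open>young_term\<close> for \<open>j = 1\<close>.\<close>
    have X: "\<bar>iX x\<bar> \<le> \<epsilon> * (i1 x + i2 x) + K1 * R powr (- \<kappa> \<gamma>) * ?I x" for x
    proof (cases "norm x \<le> 2 * R")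
      case True
      let ?s = "\<bar>u x\<bar>" and ?z = "?\<zeta> x" and ?L = "norm (?\<zeta>' x)" and ?g = "norm (G x)"
      have z: "0 \<le> ?z" "?z \<le> 1" by (rule cutoff_ball_bounds)+
      have "\<bar>a_field p H (G x) \<bullet> \<theta>' x\<bar> \<le> norm (a_field p H (G x)) * norm (\<theta>' x)"
        by (rule Cauchy_Schwarz_ineq2)
      also have "\<dots> \<le> (Ca * ?g powr (p - 1)) * (real m * ?z ^ (m - 1) * ?L)"
        unfolding norm\<theta>' using z by (intro mult_right_mono Ca(2)) auto
      finally have "?s powr (\<gamma> - 1) * ?s * ?z ^ m * \<bar>a_field p H (G x) \<bullet> \<theta>' x\<bar>
        \<le> ?s powr (\<gamma> - 1) * ?s * ?z ^ m * ((Ca * ?g powr (p - 1)) * (real m * ?z ^ (m - 1) * ?L))"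
        using z by (intro mult_left_mono) auto
      also have "\<dots> = (Ca * real m) * ((?s powr (\<gamma> - 1) * ?s powr real 1) * ?g powr (p - 1) * (?z ^ m * ?z ^ (m - 1)) * ?L ^ 1)"
        by (simp add: mult_ac)
      also have "?s powr (\<gamma> - 1) * ?s powr real 1 = ?s powr (\<gamma> - 1 + real 1)" by (rule powr_add[symmetric])
      also have "?z ^ m * ?z ^ (m - 1) = ?z ^ (2 * m - 1)"
        using m0 by (simp add: power_add[symmetric] mult_2)
      also have "?g powr (p - 1) = (if p = real 1 then 1 else ?g powr (p - real 1))" using p by simp
      also have "(Ca * real m) * (?s powr (\<gamma> - 1 + real 1) * (if p = real 1 then 1 else ?g powr (p - real 1)) * ?z ^ (2 * m - 1) * ?L ^ 1)
        \<le> \<epsilon> * (?s powr (\<gamma> - 1) * E (G x) * ?z ^ (2 * m) + F (u x) * ?z ^ (2 * m)) + K1 * R powr (- \<kappa> \<gamma>)"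
        using R z norm_grad_cutoff_ball[OF R0, of x] F by (intro YX[unfolded young_term_def]) auto
      finally show ?thesis
        using True z by (simp add: i1' i2' iX_def \<theta>_def abs_mult power_abs)
    next
      case False
      then show ?thesis using \<theta>0[of x] by (simp add: i1_def i2_def iX_def)
    qed
    \<comment> \<open>Both gradients contribute \<open>m - 1\<close>, hence \<open>2 * m - 2\<close>
      and \<open>j = 2\<close>. The conditional \<open>?k\<close> keeps the weight equal to 1 for
      \<open>p = 2\<close> even where \<open>G\<close> vanishes.\<close>
    have Y: "\<bar>iY x\<bar> \<le> \<epsilon> * (i1 x + i2 x) + K2 * R powr (- \<kappa> \<gamma>) * ?I x" for x
    proof (cases "norm x \<le> 2 * R")
      case True
      let ?s = "\<bar>u x\<bar>" and ?z = "?\<zeta> x" and ?L = "norm (?\<zeta>' x)"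
      let ?k = "if p = real 2 then 1 else norm (G x) powr (p - real 2)"
      have z: "0 \<le> ?z" "?z \<le> 1" by (rule cutoff_ball_bounds)+
      have "\<bar>hess_form (G x) (\<theta>' x) (\<theta>' x)\<bar> \<le> Ch * ?k * norm (\<theta>' x) * norm (\<theta>' x)"
        using Ch(2)[of "G x" "\<theta>' x" "\<theta>' x"] by (simp only: of_nat_numeral)
      then have "?s powr (\<gamma> + 1) * \<bar>hess_form (G x) (\<theta>' x) (\<theta>' x)\<bar>
          \<le> ?s powr (\<gamma> + 1) * (Ch * ?k * norm (\<theta>' x) * norm (\<theta>' x))"
        by (rule mult_left_mono) simp
      also have "\<dots> = (Ch * (real m)\<^sup>2) * (?s powr (\<gamma> + 1) * ?k * (?z ^ (m - 1) * ?z ^ (m - 1)) * ?L ^ 2)"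
        unfolding norm\<theta>' by (simp only: power2_eq_square mult_ac)
      also have "?z ^ (m - 1) * ?z ^ (m - 1) = ?z ^ (2 * m - 2)"
      proof -
        have "(m - 1) + (m - 1) = 2 * m - 2" by simp
        then show ?thesis by (simp only: power_add[symmetric])
      qed
      also have "?s powr (\<gamma> + 1) = ?s powr (\<gamma> - 1 + real 2)" by (simp add: add.commute)
      also have "(Ch * (real m)\<^sup>2) * (?s powr (\<gamma> - 1 + real 2) * ?k * ?z ^ (2 * m - 2) * ?L ^ 2)
        \<le> \<epsilon> * (?s powr (\<gamma> - 1) * E (G x) * ?z ^ (2 * m) + F (u x) * ?z ^ (2 * m)) + K2 * R powr (- \<kappa> \<gamma>)"
        using R z norm_grad_cutoff_ball[OF R0, of x] F by (intro YY[unfolded young_term_def]) auto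
      finally show ?thesis using True by (simp add: i1' i2' iY_def abs_mult add.commute)
    next
      case False
      then show ?thesis using \<theta>0[of x] \<theta>'0[of x] by (simp add: i1_def i2_def iY_def hess_form_def)
    qed
    define I1 where "I1 = (\<integral>x. i1 x \<partial>lebesgue)"
    define I2 where "I2 = (\<integral>x. i2 x \<partial>lebesgue)"
    define vol where "vol = measure lborel (cball (0 :: real ^ 'n) (2 * R))"
    have vol0: "vol \<ge> 0" by (simp add: vol_def)
    have Iint: "integrable lebesgue ?I"
      using fmeasurableD2[OF lmeasurable_cball[of "0 :: real ^ 'n" "2 * R"]]
      by (intro integrable_real_indicator) (auto simp: less_top)
    \<comment> \<open>Both error integrals are bounded with the constant \<open>K1 + K2\<close>,
      because \<open>absorb\<close> expects one common error \<open>E\<close>.\<close>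
    have total: "\<bar>\<integral>x. g x \<partial>lebesgue\<bar> \<le> \<epsilon> * (I1 + I2) + (K1 + K2) * R powr (- \<kappa> \<gamma>) * vol"
      if g: "integrable lebesgue g" and K: "0 \<le> K" "K \<le> K1 + K2"
        and le: "\<And>x. \<bar>g x\<bar> \<le> \<epsilon> * (i1 x + i2 x) + K * R powr (- \<kappa> \<gamma>) * ?I x" for g :: "real ^ 'n \<Rightarrow> real" and K
    proof -
      have "\<bar>\<integral>x. g x \<partial>lebesgue\<bar> \<le> (\<integral>x. \<bar>g x\<bar> \<partial>lebesgue)" by (rule integral_abs_bound)
      also have "\<dots> \<le> (\<integral>x. \<epsilon> * (i1 x + i2 x) + K * R powr (- \<kappa> \<gamma>) * ?I x \<partial>lebesgue)"
        using g id(1,2) Iint by (intro integral_mono le) auto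
      also have "\<dots> = \<epsilon> * (I1 + I2) + K * R powr (- \<kappa> \<gamma>) * vol"
        using id(1,2) Iint by (simp add: I1_def I2_def vol_def)
      also have "\<dots> \<le> \<epsilon> * (I1 + I2) + (K1 + K2) * R powr (- \<kappa> \<gamma>) * vol"
        using K vol0 by (intro add_left_mono mult_right_mono) auto
      finally show ?thesis .
    qed
    have "I2 \<le> C * ((K1 + K2) * R powr (- \<kappa> \<gamma>) * vol)"
    proof (rule absorb)
      show "0 \<le> I1" "0 \<le> I2" using i10 i20 by (auto simp: I1_def I2_def)
      show "0 \<le> (K1 + K2) * R powr (- \<kappa> \<gamma>) * vol" using K1 K2 vol0 by simp
      show "\<gamma> * I1 + 2 * (\<integral>x. iX x \<partial>lebesgue) = I2" using id(5) by (simp add: I1_def I2_def)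
      show "\<alpha>\<^sub>0 * I2 \<le> ((\<gamma> + 1) / 2)\<^sup>2 * (p - 1) * I1 + (\<gamma> + 1) * (p - 1) * (\<integral>x. iX x \<partial>lebesgue) + (\<integral>x. iY x \<partial>lebesgue)"
        using id(6) by (simp add: I1_def I2_def)
      show "\<bar>\<integral>x. iX x \<partial>lebesgue\<bar> \<le> \<epsilon> * (I1 + I2) + (K1 + K2) * R powr (- \<kappa> \<gamma>) * vol"
        by (rule total[OF id(3) _ _ X]) (use K1 K2 in auto)
      show "\<bar>\<integral>x. iY x \<partial>lebesgue\<bar> \<le> \<epsilon> * (I1 + I2) + (K1 + K2) * R powr (- \<kappa> \<gamma>) * vol"
        by (rule total[OF id(4) _ _ Y]) (use K1 K2 in auto)
    qed
    also have "\<dots> = C' * R powr (CARD('n) - \<kappa> \<gamma>)"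
    proof -
      have "vol = 2 ^ CARD('n) * V * R powr CARD('n)"
        using R0 content_cball_power[of "2 * R", where 'a="real ^ 'n"]
        by (simp add: vol_def V_def power_mult_distrib powr_realpow)
      moreover have "R powr (CARD('n) - \<kappa> \<gamma>) = R powr CARD('n) * R powr (- \<kappa> \<gamma>)"
        by (simp add: powr_add[symmetric])
      ultimately show ?thesis by (simp add: C'_def)
    qed
    finally have le: "I2 \<le> C' * R powr (CARD('n) - \<kappa> \<gamma>)" .
    \<comment> \<open>On the ball of radius \<open>R\<close> the cutoff is 1, and elsewhere
      \<open>i2\<close> is nonnegative.\<close>
    have dom: "indicator (cball 0 R) x * F (u x) \<le> i2 x" for x
      using cutoff_ball_eq_1[OF R0, of x] i20[of x] by (simp add: i2' indicator_def)
    have um[measurable]: "u \<in> borel_measurable lebesgue"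
      using solution by (simp add: weak_solution_def Linf_loc_def)
    have [measurable]: "F \<in> borel_measurable borel"
      unfolding F_def[abs_def] using borel_measurable_continuous_onI[OF C1_real(3)[OF f_C1]] by measurable
    have [measurable]: "(\<lambda>x. F (u x)) \<in> borel_measurable lebesgue" by measurable
    have [measurable]: "cball (0 :: real ^ 'n) R \<in> sets lebesgue" by simp
    have int: "integrable lebesgue (\<lambda>x. indicator (cball 0 R) x * F (u x))"
      by (rule majorized_integrable[where C=1, OF id(2)], measurable)
         (use dom F0 i20 in \<open>auto simp: abs_mult\<close>)
    have "(\<integral>x. indicator (cball 0 R) x * F (u x) \<partial>lebesgue) \<le> I2"
      unfolding I2_def by (intro integral_mono int id(2) dom)
    with le int show ?thesis by simp
  qed
  have "AE x in lebesgue. norm x \<le> real k \<longrightarrow> u x = 0" for k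
  proof -
    define R where "R = real (Suc k)"
    have R: "R \<ge> 1" by (simp add: R_def)
    \<comment> \<open>This ball stays fixed while the radius \<open>r\<close> of the estimate tends
      to infinity. The bound tends to 0 because its exponent is negative, so the nonnegative
      \<open>J\<close> vanishes.\<close>
    define J where "J = (\<integral>x. indicator (cball 0 R) x * F (u x) \<partial>lebesgue)"
    have "J \<le> 0"
    proof (rule tendsto_lowerbound)
      have "((\<lambda>r. r powr (CARD('n) - \<kappa> \<gamma>)) \<longlongrightarrow> 0) at_top"
        using \<kappa>n by (intro tendsto_neg_powr filterlim_ident) simp
      from tendsto_mult_right_zero[OF this]
      show "((\<lambda>r. C' * r powr (CARD('n) - \<kappa> \<gamma>)) \<longlongrightarrow> 0) at_top" .
      show "eventually (\<lambda>r. J \<le> C' * r powr (CARD('n) - \<kappa> \<gamma>)) at_top"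
        using eventually_ge_at_top[of R]
      proof eventually_elim
        case (elim r)
        have "J \<le> (\<integral>x. indicator (cball 0 r) x * F (u x) \<partial>lebesgue)"
          unfolding J_def using loc[OF R] loc[of r] elim R F0
          by (intro integral_mono) (auto simp: indicator_def)
        also have "\<dots> \<le> C' * r powr (CARD('n) - \<kappa> \<gamma>)" using loc[of r] elim R by simp
        finally show ?case .
      qed
    qed simp
    moreover have "J \<ge> 0" unfolding J_def using F0 by (intro Bochner_Integration.integral_nonneg) simp
    ultimately have "J = 0" by simp
    then have "AE x in lebesgue. indicator (cball 0 R) x * F (u x) = 0"
      unfolding J_def using integral_nonneg_eq_0_iff_AE[of lebesgue "\<lambda>x. indicator (cball 0 R) x * F (u x)"] loc[OF R] F0
      by auto
    then show ?thesis
    proof eventually_elim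
      case (elim x)
      show ?case
      proof
        assume "norm x \<le> real k"
        then have "x \<in> cball 0 R" by (simp add: R_def)
        with elim have "F (u x) = 0" by simp
        then show "u x = 0" by (rule Fzero)
      qed
    qed
  qed
  then have "AE x in lebesgue. \<forall>k::nat. norm x \<le> real k \<longrightarrow> u x = 0"
    unfolding AE_all_countable by blast
  then show ?thesis by eventually_elim (use real_arch_simple in blast)
qed

end
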